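(* Let $(f_n)_{n\in\mathbb N}$ be a sequence of admissible functions and suppose that: (i) for every $n\in\mathbb N$, $f_n\in L^{1,+}_{\rm loc}(E_n)$, where $E_n\uparrow E$ as $n\to\infty$; (ii) there is an admissible function $f\in L^{1,+}_{\rm loc}(E)$ with $(I^1f)(1/2)>0$ such that for all $x\in E$ $$\lim_{n\to\infty}\int_{-\infty}^x|f_n(h)-f(h)|\,dh=0;$$ (iii) for some fixed $x_0\in\mathbb R$ and some $\delta>0$ $$\sup_{n\in\mathbb N}\int_{-\infty}^{x_0}|h|^{\frac d2+\delta}f_n(h)\,dh<\infty .$$ Let $\eta_n:=\eta_{f_n}$, $n\in\mathbb N$, and $\eta:=\eta_f$. Then the random closed sets $\mathrm{skel}(\mathcal L(\eta_n))$ and $\mathrm{skel}(\mathcal L^*(\eta_n))$ converge weakly to $\mathrm{skel}(\mathcal L(\eta))$ and $\mathrm{skel}(\mathcal L^*(\eta))$, respectively, as $n\to\infty$.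
   Context: Let $d\ge2$. Points of $\mathbb R^d\times\mathbb R$ are written $(v,h)$. Put $\mathrm{pow}(w,(v,h))=\|w-v\|^2+h$. For a countable set $A\subset\mathbb R^d\times\mathbb R$ and $(v,h)\in A$ the Laguerre cell is $C((v,h),A)=\{w\in\mathbb R^d:\mathrm{pow}(w,(v,h))\le \mathrm{pow}(w,(v',h'))\ \forall (v',h')\in A\}$, and the Laguerre diagram $\mathcal L(A)$ is the collection of all Laguerre cells with non-empty interior. A tessellation in $\mathbb R^d$ is a locally finite system of convex polytopes (cells) with non-empty, pairwise disjoint interiors covering $\mathbb R^d$, such that the intersection of two distinct cells is empty or a face of both. It is normal if each $k$-dimensional face is contained in precisely $d+1-k$ cells, $0\le k\le d-1$. If $\mathcal L(A)$ is a normal tessellation, its dual $\mathcal L^*(A)$ is the collection of simplices $\mathrm{conv}(v_1,\dots,v_{d+1})$ over distinct $(v_1,h_1),\dots,(v_{d+1},h_{d+1})\in A$ with $\bigcap_{i=1}^{d+1}C((v_i,h_i),A)\ne\varnothing$. The skeleton is $\mathrm{skel}(X)=\bigcup_{c\in X}\mathrm{bd}\,c$. For an interval $E\subset\mathbb R$, $L^{1,+}_{\rm loc}(E)$ is the set of functions $f:\mathrm{int}\,E\to[0,\infty)$ with $\int_K f\,dx<\infty$ for all compact $K\subset E$; such $f$ is regarded as $0$ outside $E$. For $\alpha>0$, $(I^\alpha f)(x)=\frac1{\Gamma(\alpha)}\int_{-\infty}^x f(t)(x-t)^{\alpha-1}\,dt$. For $f\in L^{1,+}_{\rm loc}(E)$,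 $\eta_f$ is the Poisson point process in $\mathbb R^d\times\mathbb R$ with intensity measure $\Lambda_f(\cdot)=\int_{\mathbb R^d}\int_E f(h)\mathbf 1((v,h)\in\cdot)\,dh\,dv$, assumed non-trivial ($\Lambda_f([0,1]^d\times\mathbb R)>0$). A function $f\in L^{1,+}_{\rm loc}(E)$ is admissible if: $E=[a,\infty)$ for some $a\in\mathbb R$, or $E=(-\infty,b)$ for some $b\in\mathbb R$, or $E=\mathbb R$; $(I^{d/2+1}f)(t)<\infty$ for all $t\in E$; and, if $E=(-\infty,b)$, there are $\varepsilon>0$, $n_0\in\mathbb N$ with $(I^{d/2+1}f)(b-1/n)\ge n^\varepsilon$ for all $n>n_0$. For admissible $f$, $\mathcal L(\eta_f)$ is almost surely a normal random tessellation and $\mathcal L^*(\eta_f)$ is almost surely a simplicial random tessellation. Weak convergence of random closed sets is weak convergence of their distributions on the space of closed subsets of $\mathbb R^d$ with the Fell topology. Equivalently, with $T_Z(C)=\mathbb P(Z\cap C\neq\varnothing)$, $T_{Z_n}(C)\to T_Z(C)$ for all compact $C$ with $T_Z(\mathrm{int}\,C)=T_Z(C)$. *)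

theory Defs
  imports "HOL-Probability.Probability"
begin

section \<open>Laguerre diagrams and their duals\<close>

text \<open>A weighted point \<open>p = (v, h)\<close> is an element of \<^typ>\<open>'a \<times> real\<close>, where \<^typ>\<open>'a\<close> is
  the Euclidean space and \<open>d = DIM('a)\<close>.\<close>

definition pow :: "'a::euclidean_space \<Rightarrow> 'a \<times> real \<Rightarrow> real" where
  "pow w p = (norm (w - fst p))\<^sup>2 + snd p"

definition laguerre_cell :: "'a::euclidean_space \<times> real \<Rightarrow> ('a \<times> real) set \<Rightarrow> 'a set" where
  "laguerre_cell p A = {w. \<forall>q\<in>A. pow w p \<le> pow w q}"

definition laguerre_diagram :: "('a::euclidean_space \<times> real) set \<Rightarrow> 'a set set" where
  "laguerre_diagram A = {laguerre_cell p A |p. p \<in> A \<and> interior (laguerre_cell p A) \<noteq> {}}"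

text \<open>Only meaningful if \<^term>\<open>laguerre_diagram A\<close> is a normal tessellation.\<close>

definition dual_laguerre :: "('a::euclidean_space \<times> real) set \<Rightarrow> 'a set set" where
  "dual_laguerre A = {convex hull (fst ` S) |S.
     S \<subseteq> A \<and> finite S \<and> card S = DIM('a) + 1 \<and> (\<Inter>p\<in>S. laguerre_cell p A) \<noteq> {}}"

definition skel :: "'a::euclidean_space set set \<Rightarrow> 'a set" where
  "skel X = (\<Union>c\<in>X. frontier c)"


section \<open>Admissible functions\<close>

text \<open>Functions on \<^term>\<open>interior E\<close> are represented by their extension by zero.\<close>

definition L1loc_plus :: "real set \<Rightarrow> (real \<Rightarrow> real) set" where
  "L1loc_plus E = {f. (\<forall>x. 0 \<le> f x) \<and> (\<forall>x. x \<notin> interior E \<longrightarrow> f x = 0) \<and>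
     (\<forall>K. compact K \<and> K \<subseteq> E \<longrightarrow> set_integrable lebesgue K f)}"

text \<open>The fractional integral \<open>I\<^sup>\<alpha> f\<close> of a nonnegative function, with values in \<open>[0, \<infinity>]\<close>.\<close>

definition frac_integral :: "real \<Rightarrow> (real \<Rightarrow> real) \<Rightarrow> real \<Rightarrow> ennreal" where
  "frac_integral \<alpha> f x =
     ennreal (1 / Gamma \<alpha>) * (\<integral>\<^sup>+t\<in>{..<x}. ennreal (f t * (x - t) powr (\<alpha> - 1)) \<partial>lebesgue)"

definition admissible :: "nat \<Rightarrow> real set \<Rightarrow> (real \<Rightarrow> real) \<Rightarrow> bool" where
  "admissible d E f \<longleftrightarrow>
     f \<in> L1loc_plus E \<and>
     ((\<exists>a. E = {a..}) \<or> (\<exists>b. E = {..<b}) \<or> E = UNIV) \<and>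
     (\<forall>t\<in>E. frac_integral (real d / 2 + 1) f t < \<infinity>) \<and>
     (\<forall>b. E = {..<b} \<longrightarrow>
        (\<exists>\<epsilon>>0. \<exists>n0::nat. \<forall>n>n0.
           ennreal (real n powr \<epsilon>) \<le> frac_integral (real d / 2 + 1) f (b - 1 / real n)))"


section \<open>Poisson point processes\<close>

text \<open>The intensity measure \<open>\<Lambda>\<^sub>f\<close>.  Since \<open>f\<close> is only Lebesgue measurable, the measure with
  density \<open>(v, h) \<mapsto> f h\<close> is formed on the larger \<open>\<sigma>\<close>-algebra and then restricted to the
  Borel sets.\<close>

definition intensity :: "(real \<Rightarrow> real) \<Rightarrow> ('a::euclidean_space \<times> real) measure" where
  "intensity f = distr (density (lborel \<Otimes>\<^sub>M lebesgue) (\<lambda>(v, h). ennreal (f h))) borel (\<lambda>p. p)"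

lemma sigma_finite_lebesgue: "sigma_finite_measure (lebesgue :: 'b::euclidean_space measure)"
proof -
  obtain A :: "'b set set" where A: "countable A" "A \<subseteq> sets lborel" "\<Union>A = space lborel"
      "\<forall>a\<in>A. emeasure lborel a \<noteq> \<infinity>"
    using lborel.sigma_finite_countable by blast
  show ?thesis
    by (standard, rule exI[of _ A]) (use A in auto)
qed

lemma emeasure_intensity:
  fixes B :: "('a::euclidean_space \<times> real) set"
  assumes f: "f \<in> borel_measurable lebesgue" and B: "B \<in> sets borel"
  shows "emeasure (intensity f) B =
    (\<integral>\<^sup>+v. (\<integral>\<^sup>+h. ennreal (f h) * indicator B (v, h) \<partial>lebesgue) \<partial>lborel)"
proof -
  interpret L: sigma_finite_measure "lebesgue :: real measure"
    by (rule sigma_finite_lebesgue)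
  let ?P = "(lborel :: 'a measure) \<Otimes>\<^sub>M (lebesgue :: real measure)"
  let ?g = "\<lambda>(v::'a, h). ennreal (f h)"
  have "(\<lambda>x. x) \<in> lebesgue \<rightarrow>\<^sub>M (borel :: real measure)"
    by (intro measurable_completion) simp
  then have "(\<lambda>p. (fst p, snd p)) \<in> ?P \<rightarrow>\<^sub>M (borel :: 'a measure) \<Otimes>\<^sub>M (borel :: real measure)"
    using measurable_compose[OF measurable_snd] by (intro measurable_Pair) simp_all
  then have id: "(\<lambda>p. p) \<in> ?P \<rightarrow>\<^sub>M borel"
    by (simp add: borel_prod)
  have BP: "B \<in> sets ?P"
    using measurable_sets[OF id B] by (simp add: space_pair_measure)
  have g: "?g \<in> borel_measurable ?P"
    using f by measurable
  have "emeasure (intensity f) B = emeasure (density ?P ?g) B"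
    unfolding intensity_def using id B by (subst emeasure_distr) (auto simp: space_pair_measure)
  also have "\<dots> = (\<integral>\<^sup>+p. ?g p * indicator B p \<partial>?P)"
    by (rule emeasure_density[OF g BP])
  also have "\<dots> = (\<integral>\<^sup>+v. (\<integral>\<^sup>+h. ?g (v, h) * indicator B (v, h) \<partial>lebesgue) \<partial>lborel)"
    by (rule L.nn_integral_fst[symmetric])
      (rule borel_measurable_times_ennreal[OF g borel_measurable_indicator[OF BP]])
  finally show ?thesis by simp
qed

text \<open>\<^term>\<open>emeasure (count_space UNIV) (\<eta> \<omega> \<inter> B)\<close> is the number of points of the process in
  \<open>B\<close>.  If \<open>\<Lambda>(B) = \<infinity>\<close>, the Poisson distribution with parameter \<open>\<Lambda>(B)\<close> is the point mass at
  \<open>\<infinity>\<close>.  A point process given as a random set is simple, which is adequate for measures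
  \<open>\<Lambda>\<close> without atoms such as \<^const>\<open>intensity\<close>.\<close>

definition poisson_process ::
  "'w measure \<Rightarrow> 'b::topological_space measure \<Rightarrow> ('w \<Rightarrow> 'b set) \<Rightarrow> bool" where
  "poisson_process M \<Lambda> \<eta> \<longleftrightarrow>
     prob_space M \<and>
     (\<forall>\<omega>\<in>space M. countable (\<eta> \<omega>)) \<and>
     (\<forall>B\<in>sets borel. (\<lambda>\<omega>. emeasure (count_space UNIV) (\<eta> \<omega> \<inter> B)) \<in> borel_measurable M) \<and>
     (\<forall>B\<in>sets borel. emeasure \<Lambda> B < \<infinity> \<longrightarrow> (\<forall>k::nat.
        measure M {\<omega>\<in>space M. emeasure (count_space UNIV) (\<eta> \<omega> \<inter> B) = of_nat k} =
          measure \<Lambda> B ^ k / fact k * exp (- measure \<Lambda> B))) \<and>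
     (\<forall>B\<in>sets borel. emeasure \<Lambda> B = \<infinity> \<longrightarrow>
        (AE \<omega> in M. emeasure (count_space UNIV) (\<eta> \<omega> \<inter> B) = \<infinity>)) \<and>
     (\<forall>m. \<forall>B :: nat \<Rightarrow> 'b set. (\<forall>i<m. B i \<in> sets borel) \<and> disjoint_family_on B {..<m} \<longrightarrow>
        prob_space.indep_vars M (\<lambda>_. borel)
          (\<lambda>i \<omega>. emeasure (count_space UNIV) (\<eta> \<omega> \<inter> B i)) {..<m})"


section \<open>Weak convergence of random closed sets\<close>

definition fell_topology :: "'a::topological_space set topology" where
  "fell_topology = topology_generated_by
     ({{F. closed F \<and> F \<inter> K = {}} |K. compact K} \<union>
      {{F. closed F \<and> F \<inter> G \<noteq> {}} |G. open G})"

lemma topspace_fell_topology: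
  "topspace fell_topology = {F :: 'b::topological_space set. closed F}"
proof -
  let ?S = "{{F :: 'b set. closed F \<and> F \<inter> K = {}} |K. compact K} \<union>
    {{F. closed F \<and> F \<inter> G \<noteq> {}} |G. open G}"
  have "{F. closed F} \<in> ?S"
    by (rule UnI1, rule CollectI, rule exI[of _ "{}"]) simp
  moreover have "U \<subseteq> {F. closed F}" if "U \<in> ?S" for U
    using that by auto
  ultimately have "\<Union>?S = {F. closed F}"
    by (intro equalityI Union_least Union_upper)
  then show ?thesis
    unfolding fell_topology_def topology_generated_by_topspace .
qed

definition borel_of :: "'b topology \<Rightarrow> 'b measure" where
  "borel_of X = sigma (topspace X) {U. openin X U}"

definition weakly_converges ::
  "'b topology \<Rightarrow> (nat \<Rightarrow> 'b measure) \<Rightarrow> 'b measure \<Rightarrow> bool" where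
  "weakly_converges X \<mu> \<nu> \<longleftrightarrow>
     (\<forall>g. continuous_map X euclideanreal g \<and> bounded (g ` topspace X) \<longrightarrow>
        (\<lambda>n. integral\<^sup>L (\<mu> n) g) \<longlonglongrightarrow> integral\<^sup>L \<nu> g)"

text \<open>The skeletons are closed sets only almost surely, and they depend measurably on the
  underlying point process only outside a null set.  Random closed sets are therefore taken
  modulo null sets: exceptional values are replaced by \<^term>\<open>{}\<close>, and measurability refers to
  the completion of the probability space.\<close>

definition closed_version :: "('w \<Rightarrow> 'a::topological_space set) \<Rightarrow> 'w \<Rightarrow> 'a set" where
  "closed_version Z \<omega> = (if closed (Z \<omega>) then Z \<omega> else {})"

definition random_closed_set :: "'w measure \<Rightarrow> ('w \<Rightarrow> 'a::topological_space set) \<Rightarrow> bool" where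
  "random_closed_set M Z \<longleftrightarrow>
     prob_space M \<and> (AE \<omega> in M. closed (Z \<omega>)) \<and>
     closed_version Z \<in> completion M \<rightarrow>\<^sub>M borel_of fell_topology"

definition rcs_law :: "'w measure \<Rightarrow> ('w \<Rightarrow> 'a::topological_space set) \<Rightarrow> 'a set measure" where
  "rcs_law M Z = distr (completion M) (borel_of fell_topology) (closed_version Z)"

definition rcs_converges_weakly ::
  "(nat \<Rightarrow> 'w measure) \<Rightarrow> (nat \<Rightarrow> 'w \<Rightarrow> 'a::topological_space set) \<Rightarrow>
   'u measure \<Rightarrow> ('u \<Rightarrow> 'a set) \<Rightarrow> bool" where
  "rcs_converges_weakly M Z N Y \<longleftrightarrow>
     (\<forall>n. random_closed_set (M n) (Z n)) \<and> random_closed_set N Y \<and>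
     weakly_converges fell_topology (\<lambda>n. rcs_law (M n) (Z n)) (rcs_law N Y)"

end

theory Submission
  imports Defs
begin

text \<open>The skeletons depend on the Poisson process only through finitely many points: a
  configuration with no points far down relative to their distance from the origin
  (\<open>tail_set\<close>), with points in all orthants, and whose points cover a large ball by power
  balls of level \<open>t\<close> has, in a given smaller ball, the same skeletons as its restriction to a
  bounded window below level \<open>t\<close>.  The moment condition makes the first property hold with
  probability close to 1 uniformly in \<open>n\<close>; the other two are events inside a window.

  On a window, the total variation distance of the two processes is at most
  \<open>2 vol \<integral> \<bar>f\<^sub>n - f\<bar>\<close>.  Only void probabilities and independence are needed for this:
  hitting events of a finite partition are independent Bernoulli events, and the hitting events
  generate the relevant \<open>\<sigma>\<close>-algebra.  Finally, a continuous function on the (compact) Fell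
  space is determined up to \<open>\<epsilon>\<close> by the trace of the closed set on a large ball.

  No general position is used: a point lies in the skeleton of the Laguerre diagram iff two
  points of the configuration minimize its power, and the boundary of a (possibly degenerate)
  simplex is the union of the convex hulls of its facets.\<close>

section \<open>The Fell topology\<close>

text \<open>The processes live on unrelated probability spaces and are given only through counts, so
  there is no coupling and every comparison is one of laws. Total variation on a window is strong
  enough that the skeleton map has only to be measurable there, not continuous. The price is that
  measurability must be obtained from hitting events alone; this is what the relaxed conditions and
  the rounding to grids are for. The order of choices matters: the radius \<open>r\<close> comes
  from the test function, the tail level \<open>H\<close> from bounds that hold for all
  \<open>n\<close> together, the window \<open>N\<close> from the limit process alone, and only then
  \<open>n\<close>. The processes \<open>\<eta>s n\<close> inherit the window events from
  \<open>\<eta>\<close> through total variation, so the tail is the only place where a bound uniform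
  in \<open>n\<close> is required. The levels \<open>\<tau> N\<close> stay inside \<open>E\<close>,
  because the L1 convergence is available only there. If \<open>E\<close> has a finite right end
  \<open>b\<close>, balls must therefore be covered at a level strictly below \<open>b\<close>; this
  is where the growth condition on the fractional integral enters.\<close>

definition rational_cboxes_set :: "'a::euclidean_space set set" where
  "rational_cboxes_set = {cbox a b |a b. (\<forall>i\<in>Basis. a \<bullet> i \<in> \<rat>) \<and> (\<forall>i\<in>Basis. b \<bullet> i \<in> \<rat>)}"

definition rational_boxes_set :: "'a::euclidean_space set set" where
  "rational_boxes_set = {box a b |a b. (\<forall>i\<in>Basis. a \<bullet> i \<in> \<rat>) \<and> (\<forall>i\<in>Basis. b \<bullet> i \<in> \<rat>)}"

text \<open>Countability is the point: with rational boxes every Fell-open set becomes a countable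
  union of finite intersections of such sets, so the Borel sets of the Fell topology are reached
  from countably many events.\<close>

definition fell_subbase :: "'a::euclidean_space set set set" where
  "fell_subbase = (\<lambda>\<C>. {F. closed F \<and> F \<inter> \<Union>\<C> = {}}) ` {\<C>. finite \<C> \<and> \<C> \<subseteq> rational_cboxes_set} \<union>
     (\<lambda>B. {F. closed F \<and> F \<inter> B \<noteq> {}}) ` rational_boxes_set"

lemma countable_rational_vectors:
  "countable {a::'a::euclidean_space. \<forall>i\<in>Basis. a \<bullet> i \<in> \<rat>}"
proof -
  have "{a::'a. \<forall>i\<in>Basis. a \<bullet> i \<in> \<rat>} \<subseteq> (\<lambda>f. \<Sum>i\<in>Basis. f i *\<^sub>R i) ` (Basis \<rightarrow>\<^sub>E \<rat>)"
  proof
    fix a :: 'a assume "a \<in> {a. \<forall>i\<in>Basis. a \<bullet> i \<in> \<rat>}"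
    then have "restrict (\<lambda>i. a \<bullet> i) Basis \<in> Basis \<rightarrow>\<^sub>E \<rat>" by auto
    moreover have "a = (\<Sum>i\<in>Basis. restrict (\<lambda>i. a \<bullet> i) Basis i *\<^sub>R i)"
      by (simp add: euclidean_representation)
    ultimately show "a \<in> (\<lambda>f. \<Sum>i\<in>Basis. f i *\<^sub>R i) ` (Basis \<rightarrow>\<^sub>E \<rat>)" by blast
  qed
  moreover have "countable ((\<lambda>f. \<Sum>i\<in>Basis. f i *\<^sub>R i) ` ((Basis::'a set) \<rightarrow>\<^sub>E \<rat>))"
    by (intro countable_image countable_PiE) (auto intro: countable_rat)
  ultimately show ?thesis
    by (rule countable_subset)
qed

lemma countable_fell_subbase: "countable (fell_subbase :: 'a::euclidean_space set set set)"
proof -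
  let ?Q = "{a::'a. \<forall>i\<in>Basis. a \<bullet> i \<in> \<rat>}"
  have Q: "countable (?Q \<times> ?Q)"
    using countable_rational_vectors by (intro countable_SIGMA) auto
  have "rational_cboxes_set \<subseteq> (\<lambda>(a, b). cbox a b) ` (?Q \<times> ?Q)"
    unfolding rational_cboxes_set_def by auto
  then have 1: "countable (rational_cboxes_set :: 'a set set)"
    by (rule countable_subset) (rule countable_image[OF Q])
  have "rational_boxes_set \<subseteq> (\<lambda>(a, b). box a b) ` (?Q \<times> ?Q)"
    unfolding rational_boxes_set_def by auto
  then have 2: "countable (rational_boxes_set :: 'a set set)"
    by (rule countable_subset) (rule countable_image[OF Q])
  show ?thesis
    unfolding fell_subbase_def
    by (intro countable_Un countable_image countable_Collect_finite_subset 1 2)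
qed

lemma fell_subbaseE:
  assumes "S \<in> fell_subbase"
  obtains (miss) \<C> where "finite \<C>" "\<C> \<subseteq> rational_cboxes_set" "S = {F. closed F \<and> F \<inter> \<Union>\<C> = {}}"
    | (hit) B where "B \<in> rational_boxes_set" "S = {F. closed F \<and> F \<inter> B \<noteq> {}}"
  using assms unfolding fell_subbase_def
  by (elim UnE imageE CollectE conjE) (rule that; assumption)+

lemma openin_fell_subbase:
  assumes "S \<in> fell_subbase"
  shows "openin fell_topology (S :: 'a::euclidean_space set set)"
proof -
  show ?thesis
    using assms
  proof (cases rule: fell_subbaseE)
    case (miss \<C>)
    have "compact (\<Union>\<C>)"
      using miss by (intro compact_Union) (auto simp: rational_cboxes_set_def)
    then show ?thesis
      unfolding fell_topology_def openin_topology_generated_by_iff miss(3)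
      by (intro generate_topology_on.Basis) auto
  next
    case (hit B)
    then have "open B" unfolding rational_boxes_set_def by (auto simp: open_box)
    then show ?thesis
      unfolding fell_topology_def openin_topology_generated_by_iff hit(2)
      by (intro generate_topology_on.Basis) auto
  qed
qed

lemma finite_rational_cbox_cover:
  fixes K :: "'a::euclidean_space set"
  assumes "compact K" "closed F" "F \<inter> K = {}"
  obtains \<C> where "finite \<C>" "\<C> \<subseteq> rational_cboxes_set" "K \<subseteq> \<Union>\<C>" "F \<inter> \<Union>\<C> = {}"
proof -
  have "\<exists>C\<in>rational_cboxes_set. x \<in> interior C \<and> F \<inter> C = {}" if "x \<in> K" for x
  proof -
    have "x \<in> - F" "open (- F)" using that assms by auto
    then obtain e where e: "e > 0" "ball x e \<subseteq> - F" by (meson openE)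
    \<comment> \<open>Radius \<open>e/2\<close> leaves room for the closure: the closed box must
      still miss \<open>F\<close>.\<close>
    from rational_boxes[of "e/2" x] e(1) obtain a b where
      ab: "\<forall>i\<in>Basis. a \<bullet> i \<in> \<rat> \<and> b \<bullet> i \<in> \<rat>" "x \<in> box a b" "box a b \<subseteq> ball x (e/2)"
      by auto
    have "cbox a b = closure (box a b)"
      using ab(2) by (metis closure_box empty_iff)
    also have "\<dots> \<subseteq> cball x (e/2)"
      using ab(3) by (metis ball_subset_cball closed_cball closure_minimal order_trans)
    also have "\<dots> \<subseteq> ball x e" using e by auto
    finally have "F \<inter> cbox a b = {}" using e by auto
    moreover have "cbox a b \<in> rational_cboxes_set"
      unfolding rational_cboxes_set_def using ab(1) by auto
    moreover have "x \<in> interior (cbox a b)" using ab(2) by (simp add: interior_cbox)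
    ultimately show ?thesis by blast
  qed
  then obtain C where C: "\<And>x. x \<in> K \<Longrightarrow> C x \<in> rational_cboxes_set"
      "\<And>x. x \<in> K \<Longrightarrow> x \<in> interior (C x)" "\<And>x. x \<in> K \<Longrightarrow> F \<inter> C x = {}"
    by metis
  have "K \<subseteq> (\<Union>x\<in>K. interior (C x))" using C by auto
  then obtain T where T: "T \<subseteq> K" "finite T" "K \<subseteq> (\<Union>x\<in>T. interior (C x))"
    using compactE_image[OF assms(1), of K "\<lambda>x. interior (C x)"] by auto
  show ?thesis
  proof (rule that[of "C ` T"])
    show "K \<subseteq> \<Union>(C ` T)"
      using T(3) interior_subset by blast
    show "C ` T \<subseteq> rational_cboxes_set" using T C by auto
    show "F \<inter> \<Union>(C ` T) = {}" using T C by blast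
  qed (use T in auto)
qed

text \<open>Induction over the generation of the topology; the two subbasic cases carry the content.
  A compact \<open>K\<close> is enlarged to a finite rational cover still missed by
  \<open>F\<close>, and an open \<open>G\<close> is shrunk to a rational box around a point of
  \<open>F \<inter> G\<close>.\<close>

lemma fell_topology_nhds:
  fixes F :: "'a::euclidean_space set"
  assumes "openin fell_topology U" "F \<in> U"
  shows "\<exists>\<U>. finite \<U> \<and> \<U> \<subseteq> fell_subbase \<and> F \<in> \<Inter>\<U> \<and> {F. closed F} \<inter> \<Inter>\<U> \<subseteq> U"
proof -
  have "generate_topology_on ({{F. closed F \<and> F \<inter> K = {}} |K. compact K} \<union>
      {{F. closed F \<and> F \<inter> G \<noteq> {}} |G. open G}) U"
    using assms(1) unfolding fell_topology_def openin_topology_generated_by_iff .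
  then show ?thesis using assms(2)
  proof (induction arbitrary: F)
    case Empty
    then show ?case by simp
  next
    case (Int a b)
    from Int.IH(1)[of F] Int.prems obtain \<U> where 1: "finite \<U>" "\<U> \<subseteq> fell_subbase" "F \<in> \<Inter>\<U>"
        "{F. closed F} \<inter> \<Inter>\<U> \<subseteq> a" by auto
    from Int.IH(2)[of F] Int.prems obtain \<V> where 2: "finite \<V>" "\<V> \<subseteq> fell_subbase" "F \<in> \<Inter>\<V>"
        "{F. closed F} \<inter> \<Inter>\<V> \<subseteq> b" by auto
    show ?case
      by (rule exI[of _ "\<U> \<union> \<V>"]) (use 1 2 in blast)
  next
    case (UN K)
    then obtain k where k: "k \<in> K" "F \<in> k" by auto
    from UN.IH[OF this] k show ?case by (meson Union_upper order_trans)
  next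
    case (Basis s)
    then consider K where "compact K" "s = {F. closed F \<and> F \<inter> K = {}}"
      | G where "open G" "s = {F. closed F \<and> F \<inter> G \<noteq> {}}" by auto
    then show ?case
    proof cases
      case 1
      then obtain \<C> where \<C>: "finite \<C>" "\<C> \<subseteq> rational_cboxes_set" "K \<subseteq> \<Union>\<C>" "F \<inter> \<Union>\<C> = {}"
        using finite_rational_cbox_cover[of K F] Basis.prems by auto
      have "closed F" using 1 Basis.prems by auto
      have "{F. closed F \<and> F \<inter> \<Union>\<C> = {}} \<in> fell_subbase"
        unfolding fell_subbase_def using \<C> by blast
      moreover have "F \<in> {F. closed F \<and> F \<inter> \<Union>\<C> = {}}" using \<C> \<open>closed F\<close> by blast
      moreover have "{F. closed F \<and> F \<inter> \<Union>\<C> = {}} \<subseteq> s" unfolding 1(2) using \<C>(3) by blast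
      ultimately show ?thesis
        by (intro exI[of _ "{{F. closed F \<and> F \<inter> \<Union>\<C> = {}}}"] conjI) (simp_all add: le_infI2)
    next
      case 2
      then obtain x where x: "x \<in> F" "x \<in> G" using Basis.prems by auto
      from \<open>open G\<close> x obtain e where "e > 0" "ball x e \<subseteq> G" by (meson openE)
      moreover from rational_boxes[OF this(1), of x] obtain a b where
        "\<forall>i\<in>Basis. a \<bullet> i \<in> \<rat> \<and> b \<bullet> i \<in> \<rat>" "x \<in> box a b" "box a b \<subseteq> ball x e" by auto
      ultimately obtain B where B: "B \<in> rational_boxes_set" "x \<in> B" "B \<subseteq> G"
        unfolding rational_boxes_set_def by blast
      have "closed F" using 2 Basis.prems by auto
      have "{F. closed F \<and> F \<inter> B \<noteq> {}} \<in> fell_subbase"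
        unfolding fell_subbase_def using B by blast
      moreover have "F \<in> {F. closed F \<and> F \<inter> B \<noteq> {}}" using B x \<open>closed F\<close> by blast
      moreover have "{F. closed F \<and> F \<inter> B \<noteq> {}} \<subseteq> s" unfolding 2(2) using B(3) by blast
      ultimately show ?thesis
        by (intro exI[of _ "{{F. closed F \<and> F \<inter> B \<noteq> {}}}"] conjI) (simp_all add: le_infI2)
    qed
  qed
qed

text \<open>Testing compact boxes suffices: hitting an open box is a countable union of such hits,
  missing a finite union of boxes is the complement of finitely many, and a Fell-open set is a union
  over the countably many finite subfamilies of the subbase that fit inside it.\<close>

lemma measurable_fell_topology:
  fixes Z :: "'w \<Rightarrow> 'a::euclidean_space set"
  assumes closed: "\<And>\<omega>. \<omega> \<in> space M \<Longrightarrow> closed (Z \<omega>)"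
    and hits: "\<And>a b. {\<omega> \<in> space M. Z \<omega> \<inter> cbox a b \<noteq> {}} \<in> sets M"
  shows "Z \<in> M \<rightarrow>\<^sub>M borel_of fell_topology"
proof -
  have sub: "{\<omega> \<in> space M. Z \<omega> \<in> S} \<in> sets M" if S: "S \<in> fell_subbase" for S
  proof -
    show ?thesis
      using S
    proof (cases rule: fell_subbaseE)
      case (miss \<C>)
      have "{\<omega> \<in> space M. Z \<omega> \<in> S} = space M - (\<Union>C\<in>\<C>. {\<omega> \<in> space M. Z \<omega> \<inter> C \<noteq> {}})"
        using miss(3) closed by auto
      also have "\<dots> \<in> sets M"
      proof (intro sets.Diff sets.finite_UN)
        fix C assume "C \<in> \<C>"
        then obtain a b where "C = cbox a b" using miss(2) unfolding rational_cboxes_set_def by auto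
        then show "{\<omega> \<in> space M. Z \<omega> \<inter> C \<noteq> {}} \<in> sets M" using hits by simp
      qed (use miss in auto)
      finally show ?thesis .
    next
      case (hit B)
      then have "open B" unfolding rational_boxes_set_def by (auto simp: open_box)
      then obtain \<D> where \<D>: "countable \<D>" "\<And>X. X \<in> \<D> \<Longrightarrow> \<exists>a b. X = cbox a b" "\<Union>\<D> = B"
        using open_countable_Union_open_cbox by metis
      have "{\<omega> \<in> space M. Z \<omega> \<in> S} = (\<Union>C\<in>\<D>. {\<omega> \<in> space M. Z \<omega> \<inter> C \<noteq> {}})"
        unfolding hit(2) using closed \<D>(3) by auto
      also have "\<dots> \<in> sets M"
      proof (rule sets.countable_UN''[OF \<D>(1)])
        fix C assume "C \<in> \<D>"
        then show "{\<omega> \<in> space M. Z \<omega> \<inter> C \<noteq> {}} \<in> sets M" using hits \<D>(2)[of C] by auto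
      qed
      finally show ?thesis .
    qed
  qed
  have inter: "{\<omega> \<in> space M. Z \<omega> \<in> \<Inter>\<U>} \<in> sets M" if "finite \<U>" "\<U> \<subseteq> fell_subbase" for \<U>
  proof (cases "\<U> = {}")
    case False
    have "{\<omega> \<in> space M. Z \<omega> \<in> \<Inter>\<U>} = (\<Inter>S\<in>\<U>. {\<omega> \<in> space M. Z \<omega> \<in> S})" using False by auto
    also have "\<dots> \<in> sets M" using that sub False by (intro sets.finite_INT) auto
    finally show ?thesis .
  qed simp
  show ?thesis
    unfolding borel_of_def
  proof (rule measurable_measure_of)
    show "{U. openin fell_topology U} \<subseteq> Pow (topspace (fell_topology :: 'a set topology))"
      using openin_subset by auto
    show "Z \<in> space M \<rightarrow> topspace fell_topology"
      using closed by (auto simp: topspace_fell_topology)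
    fix U :: "'a set set" assume "U \<in> {U. openin fell_topology U}"
    then have U: "openin fell_topology U" by simp
    let ?I = "{\<U>. finite \<U> \<and> \<U> \<subseteq> (fell_subbase :: 'a set set set) \<and> {F. closed F} \<inter> \<Inter>\<U> \<subseteq> U}"
    have "countable ?I"
      by (rule countable_subset[OF _ countable_Collect_finite_subset[OF countable_fell_subbase]]) auto
    moreover have "Z -` U \<inter> space M = (\<Union>\<U>\<in>?I. {\<omega> \<in> space M. Z \<omega> \<in> \<Inter>\<U>})"
    proof (intro equalityI subsetI)
      fix \<omega> assume \<omega>: "\<omega> \<in> Z -` U \<inter> space M"
      then have "Z \<omega> \<in> U" by simp
      from fell_topology_nhds[OF U this] \<omega>
      show "\<omega> \<in> (\<Union>\<U>\<in>?I. {\<omega> \<in> space M. Z \<omega> \<in> \<Inter>\<U>})" by auto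
    qed (use closed in auto)
    ultimately show "Z -` U \<inter> space M \<in> sets M"
      using inter by (simp only:) (rule sets.countable_UN'', auto)
  qed
qed

text \<open>A bridge between two descriptions of a topology: Alexander's lemma speaks of arbitrary
  unions of finite intersections relative to \<open>\<Union>B\<close>, while
  \<open>topology_generated_by\<close> is an inductive closure. Each is shown to be coarser than the
  other.\<close>

lemma compact_space_topology_generated_by:
  assumes "\<And>\<C>. \<C> \<subseteq> B \<Longrightarrow> \<Union>\<C> = \<Union>B \<Longrightarrow> \<exists>\<D>. finite \<D> \<and> \<D> \<subseteq> \<C> \<and> \<Union>\<D> = \<Union>B"
  shows "compact_space (topology_generated_by B)"
proof (rule Alexander_subbase[where \<B> = B])
  let ?Y = "topology (arbitrary union_of (finite intersection_of (\<lambda>x. x \<in> B) relative_to \<Union>B))"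
  show "?Y = topology_generated_by B"
    unfolding topology_eq
  proof (intro allI iffI)
    fix S assume S: "openin ?Y S"
    have U: "openin (topology_generated_by B) (\<Union>B)"
      using openin_topspace[of "topology_generated_by B"] by (simp only: topology_generated_by_topspace)
    show "openin (topology_generated_by B) S"
      by (rule minimal_topology_subbase[OF _ U S]) (rule topology_generated_by_Basis)
  next
    fix S assume "openin (topology_generated_by B) S"
    then have gen: "generate_topology_on B S" by (simp only: openin_topology_generated_by_iff)
    show "openin ?Y S"
    proof (rule generate_topology_on_coarsest[OF istopology_openin _ gen])
      fix S assume S: "S \<in> B"
      then have "(finite intersection_of (\<lambda>x. x \<in> B)) S"
        by (rule finite_intersection_of_inc)
      then have "(finite intersection_of (\<lambda>x. x \<in> B) relative_to \<Union>B) (\<Union>B \<inter> S)"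
        by (rule relative_to_inc)
      moreover have "\<Union>B \<inter> S = S" using S by (intro Int_absorb1 Union_upper)
      ultimately show "openin ?Y S"
        by (simp only: openin_subbase arbitrary_union_of_inc)
    qed
  qed
qed (use assms in \<open>simp add: topology_generated_by_topspace\<close>)

text \<open>Given a subbasic cover, let \<open>G0\<close> be the union of all open \<open>G\<close>
  whose hitting class belongs to it. The closed set \<open>- G0\<close> hits none of these, so a
  class of misses must contain it; that is, some compact \<open>K\<close> lies in \<open>G0\<close>.
  Finitely many \<open>G\<close> cover \<open>K\<close>, and every closed set either misses
  \<open>K\<close> or hits one of them.\<close>

lemma compact_space_fell_topology:
  "compact_space (fell_topology :: 'a::euclidean_space set topology)"
  unfolding fell_topology_def
proof (rule compact_space_topology_generated_by)
  let ?B = "{{F :: 'a set. closed F \<and> F \<inter> K = {}} |K. compact K} \<union>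
      {{F. closed F \<and> F \<inter> G \<noteq> {}} |G. open G}"
  have top: "\<Union>?B = {F :: 'a set. closed F}"
    using topspace_fell_topology[where ?'b = 'a]
    unfolding fell_topology_def topology_generated_by_topspace .
  fix \<C> assume \<C>: "\<C> \<subseteq> ?B" "\<Union>\<C> = \<Union>?B"
  define G0 where "G0 = \<Union>{G. open G \<and> {F. closed F \<and> F \<inter> G \<noteq> {}} \<in> \<C>}"
  have "closed (- G0)" unfolding G0_def by (auto intro: open_Union simp: closed_def)
  then have "- G0 \<in> \<Union>\<C>"
    unfolding \<C>(2) top by simp
  then obtain S where S: "S \<in> \<C>" "- G0 \<in> S" by auto
  from S(1) \<C>(1) have "S \<in> ?B" by (rule set_rev_mp)
  then consider K where "compact K" "S = {F. closed F \<and> F \<inter> K = {}}"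
    | G where "open G" "S = {F. closed F \<and> F \<inter> G \<noteq> {}}"
    by (elim UnE CollectE exE conjE)
  then show "\<exists>\<D>. finite \<D> \<and> \<D> \<subseteq> \<C> \<and> \<Union>\<D> = \<Union>?B"
  proof cases
    case 1
    then have "K \<subseteq> G0" using S by auto
    then have "K \<subseteq> \<Union>{G. open G \<and> {F. closed F \<and> F \<inter> G \<noteq> {}} \<in> \<C>}" unfolding G0_def .
    then obtain \<G> where \<G>: "\<G> \<subseteq> {G. open G \<and> {F. closed F \<and> F \<inter> G \<noteq> {}} \<in> \<C>}"
        "finite \<G>" "K \<subseteq> \<Union>\<G>"
      by (rule compactE[OF 1(1)]) auto
    let ?C = "insert S ((\<lambda>G. {F. closed F \<and> F \<inter> G \<noteq> {}}) ` \<G>)"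
    have sub: "?C \<subseteq> \<C>" using \<G> S by auto
    have "F \<in> \<Union>?C" if F: "closed F" for F
    proof (cases "F \<inter> K = {}")
      case True
      then show ?thesis using 1 F by auto
    next
      case False
      then obtain G where "G \<in> \<G>" "F \<inter> G \<noteq> {}" using \<G> by blast
      then show ?thesis using F by auto
    qed
    then have "{F. closed F} \<subseteq> \<Union>?C" by (simp only: subset_iff mem_Collect_eq) blast
    moreover have "\<Union>?C \<subseteq> {F. closed F}"
      using Union_mono[OF sub] unfolding \<C>(2) top .
    ultimately have "\<Union>?C = \<Union>?B" unfolding top by (rule subset_antisym[rotated])
    then show ?thesis using sub \<G>(2) by (intro exI[of _ ?C] conjI) simp_all
  next
    case 2
    then have "G \<subseteq> G0" using S unfolding G0_def by auto
    then show ?thesis using S 2 by auto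
  qed
qed

lemma fell_subbase_local:
  assumes "S \<in> fell_subbase"
  shows "\<exists>r::nat. \<forall>F F' :: 'a::euclidean_space set. closed F \<and> closed F' \<and>
     F \<inter> cball 0 (real r) = F' \<inter> cball 0 (real r) \<longrightarrow> F \<in> S \<longrightarrow> F' \<in> S"
proof -
  have loc: "\<exists>r::nat. B \<subseteq> cball 0 (real r)" if b: "bounded B" for B :: "'a set"
  proof -
    obtain c where "\<forall>x\<in>B. norm x \<le> c" using b unfolding bounded_iff by blast
    then have "B \<subseteq> cball 0 c" by auto
    moreover obtain r :: nat where "c \<le> real r" using real_arch_simple by blast
    ultimately have "B \<subseteq> cball 0 (real r)" by (meson order_trans subset_cball)
    then show ?thesis ..
  qed
  show ?thesis
    using assms
  proof (cases rule: fell_subbaseE)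
    case (miss \<C>)
    have "bounded (\<Union>\<C>)"
      using miss by (intro bounded_Union) (auto simp: rational_cboxes_set_def)
    then obtain r :: nat where r: "\<Union>\<C> \<subseteq> cball 0 (real r)" using loc by blast
    show ?thesis
    proof (intro exI[of _ r] allI impI)
      fix F F' assume "closed F \<and> closed F' \<and> F \<inter> cball 0 (real r) = F' \<inter> cball 0 (real r)" "F \<in> S"
      then have "closed F'" "F' \<inter> \<Union>\<C> \<subseteq> F \<inter> \<Union>\<C>" "F \<inter> \<Union>\<C> = {}" using r miss(3) by blast+
      then show "F' \<in> S" unfolding miss(3) by simp
    qed
  next
    case (hit B)
    then have "bounded B" by (auto simp: rational_boxes_set_def)
    then obtain r :: nat where r: "B \<subseteq> cball 0 (real r)" using loc by blast
    show ?thesis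
    proof (intro exI[of _ r] allI impI)
      fix F F' assume "closed F \<and> closed F' \<and> F \<inter> cball 0 (real r) = F' \<inter> cball 0 (real r)" "F \<in> S"
      then have "closed F'" "F \<inter> B \<subseteq> F' \<inter> B" "F \<inter> B \<noteq> {}" using r hit(2) by blast+
      then show "F' \<in> S" unfolding hit(2) by blast
    qed
  qed
qed

text \<open>By compactness finitely many basic neighbourhoods suffice on which \<open>g\<close>
  differs by less than \<open>e/2\<close> from its value at the centre. Each is cut out by finitely
  many subbasic sets, which look only at a bounded region; the maximum of these radii
  serves.\<close>

lemma continuous_map_fell_local:
  fixes g :: "'a::euclidean_space set \<Rightarrow> real"
  assumes g: "continuous_map fell_topology euclideanreal g" and e: "e > 0"
  shows "\<exists>r::nat. \<forall>F F'. closed F \<and> closed F' \<and>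
     F \<inter> cball 0 (real r) = F' \<inter> cball 0 (real r) \<longrightarrow> \<bar>g F - g F'\<bar> < e"
proof -
  let ?X = "fell_topology :: 'a set topology"
  let ?V = "\<lambda>F. {F' \<in> topspace ?X. g F' \<in> ball (g F) (e/2)}"
  have "\<forall>F\<in>{F. closed F}. \<exists>\<U>. finite \<U> \<and> \<U> \<subseteq> fell_subbase \<and> F \<in> \<Inter>\<U> \<and> {F. closed F} \<inter> \<Inter>\<U> \<subseteq> ?V F"
  proof
    fix F :: "'a set" assume F: "F \<in> {F. closed F}"
    show "\<exists>\<U>. finite \<U> \<and> \<U> \<subseteq> fell_subbase \<and> F \<in> \<Inter>\<U> \<and> {F. closed F} \<inter> \<Inter>\<U> \<subseteq> ?V F"
    proof (rule fell_topology_nhds)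
      show "openin ?X (?V F)" using g by (rule openin_continuous_map_preimage) simp
      show "F \<in> ?V F" using F e by (simp add: topspace_fell_topology)
    qed
  qed
  from bchoice[OF this] obtain \<U> where \<U>': "\<forall>F\<in>{F. closed F}. finite (\<U> F) \<and> \<U> F \<subseteq> fell_subbase \<and>
      F \<in> \<Inter>(\<U> F) \<and> {F. closed F} \<inter> \<Inter>(\<U> F) \<subseteq> ?V F" ..
  have \<U>: "finite (\<U> F)" "\<U> F \<subseteq> fell_subbase" "F \<in> \<Inter>(\<U> F)" "{F. closed F} \<inter> \<Inter>(\<U> F) \<subseteq> ?V F"
    if "closed F" for F using bspec[OF \<U>', of F] that by simp_all
  \<comment> \<open>The finite family may be empty, and \<open>\<Inter>{}\<close> is the whole type;
    hence the intersection with the closed sets.\<close>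
  let ?O = "\<lambda>F. {F. closed F} \<inter> \<Inter>(\<U> F)"
  have op: "openin ?X (?O F)" if "closed F" for F
  proof -
    have "?O F = \<Inter>(insert (topspace ?X) (\<U> F))" by (auto simp: topspace_fell_topology)
    also have "openin ?X \<dots>"
      using \<U>(1,2)[OF that] openin_fell_subbase by (intro openin_Inter) auto
    finally show ?thesis .
  qed
  have "topspace ?X \<subseteq> \<Union>(?O ` {F. closed F})" using \<U>(3) by (auto simp: topspace_fell_topology)
  then obtain \<F> where \<F>: "finite \<F>" "\<F> \<subseteq> ?O ` {F. closed F}" "topspace ?X \<subseteq> \<Union>\<F>"
    using compactinD[of ?X "topspace ?X" "?O ` {F. closed F}"] compact_space_fell_topology op
    unfolding compact_space_def by blast
  then obtain T where T: "T \<subseteq> {F. closed F}" "finite T" "\<F> = ?O ` T"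
    by (meson finite_subset_image)
  have "\<exists>r::nat. \<forall>F\<in>T. \<forall>S\<in>\<U> F. \<forall>F F'. closed F \<and> closed F' \<and>
     F \<inter> cball 0 (real r) = F' \<inter> cball 0 (real r) \<longrightarrow> F \<in> S \<longrightarrow> F' \<in> S"
  proof -
    let ?P = "\<lambda>S (r::nat). \<forall>F F' :: 'a set. closed F \<and> closed F' \<and>
     F \<inter> cball 0 (real r) = F' \<inter> cball 0 (real r) \<longrightarrow> F \<in> S \<longrightarrow> F' \<in> S"
    let ?\<S> = "\<Union>(\<U> ` T)"
    have fin: "finite ?\<S>" using T \<U>(1) by blast
    have mono: "?P S r'" if "?P S r" "r \<le> r'" for S r r'
    proof (intro allI impI)
      fix F F' :: "'a set"
      assume a: "closed F \<and> closed F' \<and> F \<inter> cball 0 (real r') = F' \<inter> cball 0 (real r')" "F \<in> S"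
      have "cball 0 (real r) \<subseteq> cball (0::'a) (real r')" using that(2) by (intro subset_cball) simp
      then have "F \<inter> cball 0 (real r) = F' \<inter> cball 0 (real r)" using a by blast
      then show "F' \<in> S" using that a by blast
    qed
    have "\<forall>S\<in>?\<S>. \<exists>r. ?P S r"
    proof
      fix S assume "S \<in> ?\<S>"
      then have "S \<in> fell_subbase" using T \<U>(2) by blast
      then show "\<exists>r. ?P S r" by (rule fell_subbase_local)
    qed
    from bchoice[OF this] obtain r where r: "\<forall>S\<in>?\<S>. ?P S (r S)" ..
    have "?P S (Max (r ` ?\<S>))" if "S \<in> ?\<S>" for S
      by (rule mono[OF bspec[OF r that]]) (use fin that in simp)
    then have "\<forall>F\<in>T. \<forall>S\<in>\<U> F. ?P S (Max (r ` ?\<S>))" by blast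
    then show ?thesis by blast
  qed
  then obtain r :: nat where r0: "\<forall>F\<in>T. \<forall>S\<in>\<U> F. \<forall>F F'. closed F \<and> closed F' \<and>
     F \<inter> cball 0 (real r) = F' \<inter> cball 0 (real r) \<longrightarrow> F \<in> S \<longrightarrow> F' \<in> S" ..
  then have r: "\<And>G S F F'. G \<in> T \<Longrightarrow> S \<in> \<U> G \<Longrightarrow> closed F \<Longrightarrow> closed F' \<Longrightarrow>
     F \<inter> cball 0 (real r) = F' \<inter> cball 0 (real r) \<Longrightarrow> F \<in> S \<Longrightarrow> F' \<in> S" by blast
  show ?thesis
  proof (intro exI[of _ r] allI impI)
    fix F F' :: "'a set"
    assume a: "closed F \<and> closed F' \<and> F \<inter> cball 0 (real r) = F' \<inter> cball 0 (real r)"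
    then have "F \<in> \<Union>\<F>" using \<F>(3) by (auto simp: topspace_fell_topology)
    then obtain G where G: "G \<in> T" "F \<in> ?O G" using T(3) by auto
    then have "F' \<in> ?O G" using r[OF G(1)] a by auto
    then have "F \<in> ?V G" "F' \<in> ?V G" using G \<U>(4)[of G] T by blast+
    then have "dist (g G) (g F) < e/2" "dist (g G) (g F') < e/2" by auto
    then show "\<bar>g F - g F'\<bar> < e" unfolding dist_real_def by linarith
  qed
qed

section \<open>Hitting events of Poisson processes\<close>

definition hitting :: "'b set \<Rightarrow> 'b set set" where
  "hitting B = {A. A \<inter> B \<noteq> {}}"

text \<open>Configurations are arbitrary sets, seen only through which Borel subsets of
  \<open>W\<close> they meet. Counts are not recorded as such: for sets they can be recovered from
  the hits of finer and finer cells.\<close>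

definition config_space :: "'b::topological_space set \<Rightarrow> 'b set measure" where
  "config_space W = sigma UNIV (hitting ` {B \<in> sets borel. B \<subseteq> W})"

lemma space_config_space [simp]: "space (config_space W) = UNIV"
  unfolding config_space_def by simp

lemma UNIV_in_config_space [simp]: "UNIV \<in> sets (config_space W)"
  using sets.top[of "config_space W"] by simp

lemma sets_config_space: "sets (config_space W) = sigma_sets UNIV (hitting ` {B \<in> sets borel. B \<subseteq> W})"
  unfolding config_space_def by simp

lemma hitting_in_config_space:
  "B \<in> sets borel \<Longrightarrow> B \<subseteq> W \<Longrightarrow> hitting B \<in> sets (config_space W)"
  unfolding sets_config_space by blast

lemma hits_in_config_space [measurable (raw)]:
  assumes "B \<in> sets borel" "B \<subseteq> W"
  shows "{A. A \<inter> B \<noteq> {}} \<in> sets (config_space W)" "{A. A \<inter> B = {}} \<in> sets (config_space W)"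
proof -
  show 1: "{A. A \<inter> B \<noteq> {}} \<in> sets (config_space W)"
    using hitting_in_config_space[OF assms] unfolding hitting_def .
  have "{A. A \<inter> B = {}} = space (config_space W) - {A. A \<inter> B \<noteq> {}}" by auto
  then show "{A. A \<inter> B = {}} \<in> sets (config_space W)" using 1 by (simp only: sets.compl_sets)
qed

lemma poisson_process_prob_space: "poisson_process M \<Lambda> \<eta> \<Longrightarrow> prob_space M"
  unfolding poisson_process_def by simp

lemma poisson_process_count_measurable:
  "poisson_process M \<Lambda> \<eta> \<Longrightarrow> B \<in> sets borel \<Longrightarrow>
    (\<lambda>\<omega>. emeasure (count_space UNIV) (\<eta> \<omega> \<inter> B)) \<in> borel_measurable M"
  unfolding poisson_process_def by blast

lemma count_eq_0_iff: "emeasure (count_space UNIV) X = 0 \<longleftrightarrow> X = {}"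
  by (subst emeasure_count_space_eq_0) auto

lemma poisson_process_hit_sets:
  assumes "poisson_process M \<Lambda> \<eta>" "B \<in> sets borel"
  shows "{\<omega> \<in> space M. \<eta> \<omega> \<inter> B = {}} \<in> sets M" "{\<omega> \<in> space M. \<eta> \<omega> \<inter> B \<noteq> {}} \<in> sets M"
proof -
  note [measurable] = poisson_process_count_measurable[OF assms]
  have "{\<omega> \<in> space M. emeasure (count_space UNIV) (\<eta> \<omega> \<inter> B) = 0} \<in> sets M"
    "{\<omega> \<in> space M. emeasure (count_space UNIV) (\<eta> \<omega> \<inter> B) \<noteq> 0} \<in> sets M"
    by measurable
  then show "{\<omega> \<in> space M. \<eta> \<omega> \<inter> B = {}} \<in> sets M" "{\<omega> \<in> space M. \<eta> \<omega> \<inter> B \<noteq> {}} \<in> sets M"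
    unfolding count_eq_0_iff .
qed

lemma measurable_config_space:
  assumes "poisson_process M \<Lambda> \<eta>"
  shows "\<eta> \<in> M \<rightarrow>\<^sub>M config_space W"
  unfolding config_space_def
proof (rule measurable_measure_of)
  fix H assume "H \<in> hitting ` {B \<in> sets borel. B \<subseteq> W}"
  then obtain B where B: "H = hitting B" "B \<in> sets borel" by blast
  have "\<eta> -` H \<inter> space M = {\<omega> \<in> space M. \<eta> \<omega> \<inter> B \<noteq> {}}" unfolding B hitting_def by auto
  then show "\<eta> -` H \<inter> space M \<in> sets M" using poisson_process_hit_sets(2)[OF assms B(2)] by simp
qed auto

lemma poisson_process_void_prob:
  assumes "poisson_process M \<Lambda> \<eta>" "B \<in> sets borel" "emeasure \<Lambda> B < \<infinity>"
  shows "measure M {\<omega> \<in> space M. \<eta> \<omega> \<inter> B = {}} = exp (- measure \<Lambda> B)"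
proof -
  have "\<forall>k::nat. measure M {\<omega>\<in>space M. emeasure (count_space UNIV) (\<eta> \<omega> \<inter> B) = of_nat k} =
          measure \<Lambda> B ^ k / fact k * exp (- measure \<Lambda> B)"
    using assms unfolding poisson_process_def by blast
  from spec[OF this, of 0] show ?thesis by (simp add: count_eq_0_iff)
qed

lemma poisson_process_hit_prob_le:
  assumes P: "poisson_process M \<Lambda> \<eta>" and B: "B \<in> sets borel" "emeasure \<Lambda> B < \<infinity>"
  shows "measure M {\<omega> \<in> space M. \<eta> \<omega> \<inter> B \<noteq> {}} \<le> measure \<Lambda> B"
proof -
  interpret prob_space M using P by (rule poisson_process_prob_space)
  have "{\<omega> \<in> space M. \<eta> \<omega> \<inter> B \<noteq> {}} = space M - {\<omega> \<in> space M. \<eta> \<omega> \<inter> B = {}}" by auto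
  then have "prob {\<omega> \<in> space M. \<eta> \<omega> \<inter> B \<noteq> {}} = 1 - exp (- measure \<Lambda> B)"
    using prob_compl[OF poisson_process_hit_sets(1)[OF P B(1)]] poisson_process_void_prob[OF P B] by simp
  then show ?thesis using exp_ge_add_one_self[of "- measure \<Lambda> B"] by simp
qed

lemma poisson_process_infinite_hit:
  assumes "poisson_process M \<Lambda> \<eta>" "B \<in> sets borel" "emeasure \<Lambda> B = \<infinity>"
  shows "AE \<omega> in M. \<eta> \<omega> \<inter> B \<noteq> {}"
proof -
  have "AE \<omega> in M. emeasure (count_space UNIV) (\<eta> \<omega> \<inter> B) = \<infinity>"
    using assms unfolding poisson_process_def by blast
  then show ?thesis by eventually_elim auto
qed

text \<open>Stated with a lower bound on the intensity so that infinite intensity is included, where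
  the void event is null.\<close>

lemma poisson_process_void_prob_le:
  assumes P: "poisson_process M \<Lambda> \<eta>" and B: "B \<in> sets borel" and c: "ennreal c \<le> emeasure \<Lambda> B"
  shows "measure M {\<omega> \<in> space M. \<eta> \<omega> \<inter> B = {}} \<le> exp (- c)"
proof (cases "emeasure \<Lambda> B = \<infinity>")
  case True
  interpret prob_space M using P by (rule poisson_process_prob_space)
  have "AE \<omega> in M. \<omega> \<notin> {\<omega> \<in> space M. \<eta> \<omega> \<inter> B = {}}"
    using poisson_process_infinite_hit[OF P B True] by eventually_elim auto
  then have "prob {\<omega> \<in> space M. \<eta> \<omega> \<inter> B = {}} = 0"
    using poisson_process_hit_sets(1)[OF P B] by (simp add: prob_eq_0)
  then show ?thesis by simp
next
  case False
  then have fin: "emeasure \<Lambda> B < \<infinity>" by (simp add: top.not_eq_extremum)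
  have "c \<le> measure \<Lambda> B"
  proof (cases "c \<ge> 0")
    case True
    then show ?thesis
      using c False by (metis emeasure_eq_ennreal_measure ennreal_le_iff infinity_ennreal_def measure_nonneg)
  next
    case False
    then show ?thesis using measure_nonneg[of \<Lambda> B] by linarith
  qed
  then show ?thesis by (simp add: poisson_process_void_prob[OF P B fin])
qed

text \<open>The Poisson weights sum to 1, so the disjoint events of having exactly \<open>k\<close>
  points exhaust the space up to a null set.\<close>

lemma poisson_process_AE_finite:
  assumes P: "poisson_process M \<Lambda> \<eta>" and B: "B \<in> sets borel" "emeasure \<Lambda> B < \<infinity>"
  shows "AE \<omega> in M. finite (\<eta> \<omega> \<inter> B)"
proof -
  interpret prob_space M using P by (rule poisson_process_prob_space)
  note [measurable] = poisson_process_count_measurable[OF P B(1)]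
  let ?N = "\<lambda>\<omega>. emeasure (count_space UNIV) (\<eta> \<omega> \<inter> B)"
  let ?F = "\<lambda>k::nat. {\<omega> \<in> space M. ?N \<omega> = of_nat k}"
  have k: "\<forall>k. prob (?F k) = measure \<Lambda> B ^ k / fact k * exp (- measure \<Lambda> B)"
    using P B unfolding poisson_process_def by blast
  have "disjoint_family ?F" by (auto simp: disjoint_family_on_def)
  moreover have F: "range ?F \<subseteq> events" by auto
  ultimately have "(\<lambda>k. prob (?F k)) sums prob (\<Union>k. ?F k)"
    by (intro finite_measure_UNION)
  moreover have "(\<lambda>k. prob (?F k)) sums 1"
  proof -
    have "(\<lambda>k. measure \<Lambda> B ^ k /\<^sub>R fact k * exp (- measure \<Lambda> B)) sums
      (exp (measure \<Lambda> B) * exp (- measure \<Lambda> B))"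
      by (intro sums_mult2 exp_converges)
    then show ?thesis using k by (simp add: exp_minus divide_real_def mult.commute)
  qed
  ultimately have "prob (\<Union>k. ?F k) = 1" by (rule sums_unique2)
  then have "AE \<omega> in M. \<omega> \<in> (\<Union>k. ?F k)" using F by (intro AE_prob_1) auto
  then show ?thesis
  proof eventually_elim
    case (elim \<omega>)
    then obtain k :: nat where "?N \<omega> = of_nat k" by auto
    then have "?N \<omega> \<noteq> \<infinity>" by simp
    then show ?case by (metis emeasure_count_space_infinite subset_UNIV)
  qed
qed

text \<open>Counts in disjoint sets are independent and a hit is a nonzero count, so the pattern of
  hit sets is a vector of independent Bernoulli variables.\<close>

lemma poisson_process_pattern_prob:
  fixes B :: "nat \<Rightarrow> 'b::topological_space set"
  assumes P: "poisson_process M \<Lambda> \<eta>" and B: "\<And>i. i < m \<Longrightarrow> B i \<in> sets borel"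
      "\<And>i. i < m \<Longrightarrow> emeasure \<Lambda> (B i) < \<infinity>" and disj: "disjoint_family_on B {..<m}"
  shows "{\<omega> \<in> space M. {i. i < m \<and> \<eta> \<omega> \<inter> B i \<noteq> {}} = J} \<in> sets M"
    and "J \<subseteq> {..<m} \<Longrightarrow> measure M {\<omega> \<in> space M. {i. i < m \<and> \<eta> \<omega> \<inter> B i \<noteq> {}} = J} =
      (\<Prod>i<m. if i \<in> J then 1 - exp (- measure \<Lambda> (B i)) else exp (- measure \<Lambda> (B i)))"
proof -
  interpret prob_space M using P by (rule poisson_process_prob_space)
  let ?N = "\<lambda>i \<omega>. emeasure (count_space UNIV) (\<eta> \<omega> \<inter> B i)"
  let ?S = "\<lambda>i. if i \<in> J then - {0} else {0::ennreal}"
  have indep: "indep_vars (\<lambda>_. borel) ?N {..<m}"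
    using P B disj unfolding poisson_process_def by blast
  \<comment> \<open>The case \<open>m = 0\<close> is excluded because an empty intersection would be
    the whole type instead of \<open>space M\<close>; it is treated separately below.\<close>
  have rep: "{\<omega> \<in> space M. {i. i < m \<and> \<eta> \<omega> \<inter> B i \<noteq> {}} = J} = (\<Inter>i\<in>{..<m}. ?N i -` ?S i \<inter> space M)"
    if "J \<subseteq> {..<m}" "m \<noteq> 0"
  proof -
    have "{i. i < m \<and> \<eta> \<omega> \<inter> B i \<noteq> {}} = J \<longleftrightarrow> (\<forall>i<m. ?N i \<omega> \<in> ?S i)" for \<omega>
    proof -
      have "(\<forall>i<m. ?N i \<omega> \<in> ?S i) \<longleftrightarrow> (\<forall>i<m. (\<eta> \<omega> \<inter> B i \<noteq> {}) = (i \<in> J))"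
        by (intro all_cong) (auto simp: count_eq_0_iff)
      then show ?thesis using that(1) by auto
    qed
    then show ?thesis using that(2) by auto
  qed
  have ev: "?N i -` ?S i \<inter> space M = (if i \<in> J then {\<omega> \<in> space M. \<eta> \<omega> \<inter> B i \<noteq> {}} else {\<omega> \<in> space M. \<eta> \<omega> \<inter> B i = {}})"
    for i by (auto simp: count_eq_0_iff)
  show "{\<omega> \<in> space M. {i. i < m \<and> \<eta> \<omega> \<inter> B i \<noteq> {}} = J} \<in> sets M"
  proof (cases "J \<subseteq> {..<m} \<and> m \<noteq> 0")
    case True
    then show ?thesis
      unfolding rep[OF conjunct1[OF True] conjunct2[OF True]] ev using poisson_process_hit_sets[OF P] B
      by (intro sets.finite_INT) (auto simp: lessThan_empty_iff)
  next
    case False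
    then consider "\<not> J \<subseteq> {..<m}" | "m = 0" by blast
    then show ?thesis
    proof cases
      case 1
      then have "{\<omega> \<in> space M. {i. i < m \<and> \<eta> \<omega> \<inter> B i \<noteq> {}} = J} = {}" by auto
      then show ?thesis by (simp only: sets.empty_sets)
    next
      case 2
      then show ?thesis by simp
    qed
  qed
  assume J: "J \<subseteq> {..<m}"
  show "measure M {\<omega> \<in> space M. {i. i < m \<and> \<eta> \<omega> \<inter> B i \<noteq> {}} = J} =
      (\<Prod>i<m. if i \<in> J then 1 - exp (- measure \<Lambda> (B i)) else exp (- measure \<Lambda> (B i)))"
  proof (cases "m = 0")
    case True
    then show ?thesis using J prob_space by simp
  next
    case False
    have "prob (\<Inter>i\<in>{..<m}. ?N i -` ?S i \<inter> space M) = (\<Prod>i<m. prob (?N i -` ?S i \<inter> space M))"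
      using False by (intro indep_varsD[OF indep]) (auto simp: lessThan_empty_iff)
    also have "\<dots> = (\<Prod>i<m. if i \<in> J then 1 - exp (- measure \<Lambda> (B i)) else exp (- measure \<Lambda> (B i)))"
    proof (intro prod.cong refl)
      fix i assume "i \<in> {..<m}"
      then have i: "B i \<in> sets borel" "emeasure \<Lambda> (B i) < \<infinity>" using B by auto
      have "{\<omega> \<in> space M. \<eta> \<omega> \<inter> B i \<noteq> {}} = space M - {\<omega> \<in> space M. \<eta> \<omega> \<inter> B i = {}}" by auto
      then have "prob {\<omega> \<in> space M. \<eta> \<omega> \<inter> B i \<noteq> {}} = 1 - exp (- measure \<Lambda> (B i))"
        using prob_compl[OF poisson_process_hit_sets(1)[OF P i(1)]] poisson_process_void_prob[OF P i] by simp
      then show "prob (?N i -` ?S i \<inter> space M) = (if i \<in> J then 1 - exp (- measure \<Lambda> (B i)) else exp (- measure \<Lambda> (B i)))"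
        unfolding ev using poisson_process_void_prob[OF P i] by simp
    qed
    finally show ?thesis unfolding rep[OF J False] .
  qed
qed

text \<open>Here \<open>a i\<close> is the probability that the \<open>i\<close>-th set is missed.
  One coordinate is replaced at a time, and each replacement costs
  \<open>\<bar>a i - b i\<bar>\<close> once for the miss and once for the hit, hence the factor 2.
  The normalization in the second claim lets the induction sum out the remaining
  coordinates.\<close>

lemma bernoulli_products_diff:
  fixes a b :: "'i \<Rightarrow> real"
  assumes "finite I" "\<And>i. i \<in> I \<Longrightarrow> 0 \<le> a i \<and> a i \<le> 1" "\<And>i. i \<in> I \<Longrightarrow> 0 \<le> b i \<and> b i \<le> 1"
  shows "(\<Sum>J\<in>Pow I. \<bar>(\<Prod>i\<in>I. if i \<in> J then 1 - a i else a i) - (\<Prod>i\<in>I. if i \<in> J then 1 - b i else b i)\<bar>)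
    \<le> 2 * (\<Sum>i\<in>I. \<bar>a i - b i\<bar>)"
    and "(\<Sum>J\<in>Pow I. \<Prod>i\<in>I. if i \<in> J then 1 - b i else b i) = 1"
proof -
  let ?p = "\<lambda>c I J. \<Prod>i\<in>I. if i \<in> J then 1 - c i else (c i :: real)"
  have "(\<Sum>J\<in>Pow I. \<bar>?p a I J - ?p b I J\<bar>) \<le> 2 * (\<Sum>i\<in>I. \<bar>a i - b i\<bar>) \<and> (\<Sum>J\<in>Pow I. ?p b I J) = 1"
    using assms
  proof (induction I)
    case empty
    then show ?case by simp
  next
    case (insert x I)
    have split: "(\<Sum>J\<in>Pow (insert x I). h J) = (\<Sum>J\<in>Pow I. h J + h (insert x J))" for h :: "'i set \<Rightarrow> real"
    proof -
      have "(\<Sum>J\<in>Pow (insert x I). h J) = (\<Sum>J\<in>Pow I. h J) + (\<Sum>J\<in>insert x ` Pow I. h J)"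
        unfolding Pow_insert using insert.hyps by (intro sum.union_disjoint) auto
      also have "(\<Sum>J\<in>insert x ` Pow I. h J) = (\<Sum>J\<in>Pow I. h (insert x J))"
        using insert.hyps by (subst sum.reindex) (auto simp: inj_on_def)
      finally show ?thesis by (simp add: sum.distrib)
    qed
    have p1: "?p c (insert x I) J = c x * ?p c I J" if "J \<in> Pow I" for c J
      using that insert.hyps by (subst prod.insert) auto
    have p2: "?p c (insert x I) (insert x J) = (1 - c x) * ?p c I J" if "J \<in> Pow I" for c J
    proof -
      have "(\<Prod>i\<in>I. if i \<in> insert x J then 1 - c i else c i) = ?p c I J"
        using insert.hyps by (intro prod.cong) auto
      then show ?thesis using insert.hyps by (subst prod.insert) auto
    qed
    have IH: "(\<Sum>J\<in>Pow I. \<bar>?p a I J - ?p b I J\<bar>) \<le> 2 * (\<Sum>i\<in>I. \<bar>a i - b i\<bar>)" "(\<Sum>J\<in>Pow I. ?p b I J) = 1"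
      using insert by auto
    have ab: "0 \<le> a x" "a x \<le> 1" "0 \<le> b x" "b x \<le> 1" using insert.prems by auto
    have pos: "0 \<le> ?p b I J" for J
      using insert.prems(2) by (intro prod_nonneg) auto
    have "(\<Sum>J\<in>Pow (insert x I). \<bar>?p a (insert x I) J - ?p b (insert x I) J\<bar>) =
      (\<Sum>J\<in>Pow I. \<bar>a x * ?p a I J - b x * ?p b I J\<bar> + \<bar>(1 - a x) * ?p a I J - (1 - b x) * ?p b I J\<bar>)"
      unfolding split by (intro sum.cong refl) (simp only: p1 p2)
    also have "\<dots> \<le> (\<Sum>J\<in>Pow I. \<bar>?p a I J - ?p b I J\<bar> + 2 * \<bar>a x - b x\<bar> * ?p b I J)"
    proof (intro sum_mono)
      fix J
      let ?u = "?p a I J" and ?v = "?p b I J"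
      \<comment> \<open>Each difference splits into a change of the old product and a change of the
        new factor. The weights \<open>a x\<close> and \<open>1 - a x\<close> of the former add up
        to 1.\<close>
      have "a x * ?u - b x * ?v = a x * (?u - ?v) + (a x - b x) * ?v" by (simp add: algebra_simps)
      then have 1: "\<bar>a x * ?u - b x * ?v\<bar> \<le> a x * \<bar>?u - ?v\<bar> + \<bar>a x - b x\<bar> * ?v"
        using abs_triangle_ineq[of "a x * (?u - ?v)" "(a x - b x) * ?v"] ab pos[of J]
        by (simp add: abs_mult)
      have "(1 - a x) * ?u - (1 - b x) * ?v = (1 - a x) * (?u - ?v) + (b x - a x) * ?v"
        by (simp add: algebra_simps)
      then have 2: "\<bar>(1 - a x) * ?u - (1 - b x) * ?v\<bar> \<le> (1 - a x) * \<bar>?u - ?v\<bar> + \<bar>a x - b x\<bar> * ?v"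
        using abs_triangle_ineq[of "(1 - a x) * (?u - ?v)" "(b x - a x) * ?v"] ab pos[of J]
        by (simp add: abs_mult abs_minus_commute)
      have "a x * \<bar>?u - ?v\<bar> + (1 - a x) * \<bar>?u - ?v\<bar> = \<bar>?u - ?v\<bar>" by (simp add: algebra_simps)
      with 1 2 show "\<bar>a x * ?u - b x * ?v\<bar> + \<bar>(1 - a x) * ?u - (1 - b x) * ?v\<bar>
        \<le> \<bar>?u - ?v\<bar> + 2 * \<bar>a x - b x\<bar> * ?v" by linarith
    qed
    also have "\<dots> = (\<Sum>J\<in>Pow I. \<bar>?p a I J - ?p b I J\<bar>) + 2 * \<bar>a x - b x\<bar>"
      by (simp add: sum.distrib sum_distrib_left[symmetric] IH(2))
    also have "\<dots> \<le> 2 * (\<Sum>i\<in>insert x I. \<bar>a i - b i\<bar>)"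
      using IH(1) insert.hyps by simp
    finally have A: "(\<Sum>J\<in>Pow (insert x I). \<bar>?p a (insert x I) J - ?p b (insert x I) J\<bar>) \<le> 2 * (\<Sum>i\<in>insert x I. \<bar>a i - b i\<bar>)" .
    have "(\<Sum>J\<in>Pow (insert x I). ?p b (insert x I) J) = (\<Sum>J\<in>Pow I. ?p b I J)"
      unfolding split by (intro sum.cong refl) (simp only: p1 p2, simp add: algebra_simps)
    then show ?case using A IH(2) by simp
  qed
  then show "(\<Sum>J\<in>Pow I. \<bar>?p a I J - ?p b I J\<bar>) \<le> 2 * (\<Sum>i\<in>I. \<bar>a i - b i\<bar>)" "(\<Sum>J\<in>Pow I. ?p b I J) = 1"
    by blast+
qed

lemma abs_exp_minus_diff_le:
  fixes x y :: real
  assumes "0 \<le> x" "0 \<le> y"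
  shows "\<bar>exp (- x) - exp (- y)\<bar> \<le> \<bar>x - y\<bar>"
proof -
  have *: "exp (- x) - exp (- y) \<le> y - x" if "0 \<le> x" "x \<le> y" for x y :: real
  proof -
    have "exp (- x) - exp (- y) = exp (- x) * (1 - exp (- (y - x)))"
      by (simp add: right_diff_distrib exp_add[symmetric])
    also have "\<dots> \<le> 1 * (y - x)"
    proof (intro mult_mono)
      show "1 - exp (- (y - x)) \<le> y - x" using exp_ge_add_one_self[of "- (y - x)"] by linarith
    qed (use that in auto)
    finally show ?thesis by simp
  qed
  show ?thesis
  proof (cases "x \<le> y")
    case True
    then show ?thesis using *[OF assms(1) True] by simp
  next
    case False
    then show ?thesis using *[OF assms(2), of x] by simp
  qed
qed


text \<open>The pieces are the atoms of the generated algebra, one for each nonempty subfamily of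
  \<open>\<I>\<close>: the points lying in exactly those members. The empty subfamily is left out
  since its atom need not lie in \<open>W\<close>.\<close>

lemma finite_borel_partition:
  assumes "finite \<I>" "\<And>B. B \<in> \<I> \<Longrightarrow> B \<in> sets borel \<and> B \<subseteq> W"
  obtains m and C :: "nat \<Rightarrow> 'b::topological_space set" where
    "\<forall>i<m. C i \<in> sets borel \<and> C i \<subseteq> W" "disjoint_family_on C {..<m}"
    "\<forall>B\<in>\<I>. B = (\<Union>i\<in>{i. i < m \<and> C i \<subseteq> B}. C i)"
proof -
  let ?P = "Pow \<I> - {{}}"
  let ?at = "\<lambda>\<J>. {x. \<forall>B\<in>\<I>. x \<in> B \<longleftrightarrow> B \<in> \<J>}"
  have "finite ?P" using assms(1) by simp
  then obtain h where h: "bij_betw h {0..<card ?P} ?P" using ex_bij_betw_nat_finite by blast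
  let ?m = "card ?P"
  have hin: "h i \<subseteq> \<I>" "h i \<noteq> {}" if "i < ?m" for i
    using bij_betwE[OF h] that by auto
  have at: "?at \<J> \<in> sets borel" for \<J>
  proof -
    have "?at \<J> = (\<Inter>B\<in>\<I>. if B \<in> \<J> then B else - B) \<inter> UNIV" by auto
    also have "\<dots> \<in> sets borel"
    proof (cases "\<I> = {}")
      case False
      have "(if B \<in> \<J> then B else - B) \<in> sets borel" if "B \<in> \<I>" for B
        using assms(2)[OF that] borel_comp[of B] by simp
      then have "(\<Inter>B\<in>\<I>. if B \<in> \<J> then B else - B) \<in> sets borel"
        using assms(1) False by (intro sets.finite_INT)
      then show ?thesis by simp
    qed simp
    finally show ?thesis .
  qed
  show ?thesis
  proof (rule that[of ?m "\<lambda>i. ?at (h i)"], intro allI impI)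
    fix i assume i: "i < ?m"
    obtain B where "B \<in> h i" "B \<in> \<I>" using hin[OF i] by blast
    then show "?at (h i) \<in> sets borel \<and> ?at (h i) \<subseteq> W" using at assms(2)[of B] by blast
  next
    show "disjoint_family_on (\<lambda>i. ?at (h i)) {..<?m}"
      unfolding disjoint_family_on_def
    proof (intro ballI impI)
      fix i j assume ij: "i \<in> {..<?m}" "j \<in> {..<?m}" "i \<noteq> j"
      then have "h i \<noteq> h j" using h by (auto simp: bij_betw_def inj_on_def)
      moreover have "h i \<subseteq> \<I>" "h j \<subseteq> \<I>" using hin ij by auto
      ultimately show "?at (h i) \<inter> ?at (h j) = {}" by blast
    qed
  next
    show "\<forall>B\<in>\<I>. B = (\<Union>i\<in>{i. i < ?m \<and> ?at (h i) \<subseteq> B}. ?at (h i))"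
    proof
      fix B assume B: "B \<in> \<I>"
      show "B = (\<Union>i\<in>{i. i < ?m \<and> ?at (h i) \<subseteq> B}. ?at (h i))"
      proof (intro equalityI subsetI)
        fix x assume x: "x \<in> B"
        let ?J = "{C \<in> \<I>. x \<in> C}"
        have "?J \<in> ?P" using B x by blast
        then have "?J \<in> h ` {0..<?m}" using bij_betw_imp_surj_on[OF h] by simp
        then obtain i where "?J = h i" "i \<in> {0..<?m}" by (rule imageE)
        then have i: "i < ?m" "h i = ?J" by simp_all
        have "x \<in> ?at (h i)" unfolding i(2) by simp
        moreover have "?at (h i) \<subseteq> B" unfolding i(2) using B x by blast
        ultimately show "x \<in> (\<Union>i\<in>{i. i < ?m \<and> ?at (h i) \<subseteq> B}. ?at (h i))" using i(1) by blast
      qed blast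
    qed
  qed
qed

text \<open>The algebra from which the events of \<open>config_space W\<close> are approximated. A
  one-sided implication is enough, as the hypothesis on hits is symmetric in the two
  configurations.\<close>

definition finitely_determined :: "'b::topological_space set \<Rightarrow> 'b set set \<Rightarrow> bool" where
  "finitely_determined W D \<longleftrightarrow> (\<exists>\<I>. finite \<I> \<and> (\<forall>B\<in>\<I>. B \<in> sets borel \<and> B \<subseteq> W) \<and>
     (\<forall>A A'. (\<forall>B\<in>\<I>. A \<inter> B \<noteq> {} \<longleftrightarrow> A' \<inter> B \<noteq> {}) \<longrightarrow> A \<in> D \<longrightarrow> A' \<in> D))"

lemma finitely_determined_hitting:
  "B \<in> sets borel \<Longrightarrow> B \<subseteq> W \<Longrightarrow> finitely_determined W (hitting B)"
  unfolding finitely_determined_def hitting_def by (rule exI[of _ "{B}"]) simp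

lemma finitely_determined_empty: "finitely_determined W {}"
  unfolding finitely_determined_def by (rule exI[of _ "{}"]) simp

lemma finitely_determined_compl:
  assumes "finitely_determined W D"
  shows "finitely_determined W (- D)"
proof -
  obtain \<I> where I: "finite \<I>" "\<forall>B\<in>\<I>. B \<in> sets borel \<and> B \<subseteq> W"
     "\<forall>A A'. (\<forall>B\<in>\<I>. A \<inter> B \<noteq> {} \<longleftrightarrow> A' \<inter> B \<noteq> {}) \<longrightarrow> A \<in> D \<longrightarrow> A' \<in> D"
    using assms unfolding finitely_determined_def by (elim exE conjE)
  have "A' \<in> - D" if "\<forall>B\<in>\<I>. A \<inter> B \<noteq> {} \<longleftrightarrow> A' \<inter> B \<noteq> {}" "A \<in> - D" for A A'
  proof
    assume "A' \<in> D"
    moreover have "\<forall>B\<in>\<I>. A' \<inter> B \<noteq> {} \<longleftrightarrow> A \<inter> B \<noteq> {}" using that(1) by simp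
    ultimately show False using I(3)[rule_format, of A' A] that(2) by simp
  qed
  then show ?thesis unfolding finitely_determined_def using I(1,2) by (intro exI[of _ \<I>] conjI allI impI)
qed

lemma finitely_determined_Un:
  assumes "finitely_determined W D" "finitely_determined W D'"
  shows "finitely_determined W (D \<union> D')"
proof -
  obtain \<I> where I: "finite \<I>" "\<forall>B\<in>\<I>. B \<in> sets borel \<and> B \<subseteq> W"
     "\<forall>A A'. (\<forall>B\<in>\<I>. A \<inter> B \<noteq> {} \<longleftrightarrow> A' \<inter> B \<noteq> {}) \<longrightarrow> A \<in> D \<longrightarrow> A' \<in> D"
    using assms(1) unfolding finitely_determined_def by (elim exE conjE)
  obtain \<J> where J: "finite \<J>" "\<forall>B\<in>\<J>. B \<in> sets borel \<and> B \<subseteq> W"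
     "\<forall>A A'. (\<forall>B\<in>\<J>. A \<inter> B \<noteq> {} \<longleftrightarrow> A' \<inter> B \<noteq> {}) \<longrightarrow> A \<in> D' \<longrightarrow> A' \<in> D'"
    using assms(2) unfolding finitely_determined_def by (elim exE conjE)
  have "A' \<in> D \<union> D'" if a: "\<forall>B\<in>\<I>\<union>\<J>. A \<inter> B \<noteq> {} \<longleftrightarrow> A' \<inter> B \<noteq> {}" "A \<in> D \<union> D'" for A A'
  proof -
    have "\<forall>B\<in>\<I>. A \<inter> B \<noteq> {} \<longleftrightarrow> A' \<inter> B \<noteq> {}" "\<forall>B\<in>\<J>. A \<inter> B \<noteq> {} \<longleftrightarrow> A' \<inter> B \<noteq> {}" using a(1) by simp_all
    then show ?thesis using a(2) I(3)[rule_format, of A A'] J(3)[rule_format, of A A'] by blast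
  qed
  then show ?thesis unfolding finitely_determined_def using I(1,2) J(1,2)
    by (intro exI[of _ "\<I> \<union> \<J>"] conjI allI impI) auto
qed

lemma finitely_determined_in_config_space:
  assumes "finitely_determined W D"
  shows "D \<in> sets (config_space W)"
proof -
  obtain \<I> where I: "finite \<I>" "\<forall>B\<in>\<I>. B \<in> sets borel \<and> B \<subseteq> W"
     "\<forall>A A'. (\<forall>B\<in>\<I>. A \<inter> B \<noteq> {} \<longleftrightarrow> A' \<inter> B \<noteq> {}) \<longrightarrow> A \<in> D \<longrightarrow> A' \<in> D"
    using assms unfolding finitely_determined_def by (elim exE conjE)
  define p where "p = (\<lambda>A. {B\<in>\<I>. A \<inter> B \<noteq> {}})"
  have det: "A' \<in> D" if "p A = p A'" "A \<in> D" for A A'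
  proof -
    have "\<forall>B\<in>\<I>. A \<inter> B \<noteq> {} \<longleftrightarrow> A' \<inter> B \<noteq> {}" using that(1) unfolding p_def by blast
    from I(3)[THEN spec, THEN spec, THEN mp, OF this] that(2) show ?thesis by (rule mp)
  qed
  have pI: "p A \<in> Pow \<I>" for A unfolding p_def by blast
  have "D = (\<Union>J\<in>{J\<in>Pow \<I>. \<exists>A\<in>D. p A = J}. {A. p A = J})"
  proof (intro equalityI subsetI)
    fix A assume "A \<in> D"
    then have "p A \<in> {J\<in>Pow \<I>. \<exists>A\<in>D. p A = J}" using pI by simp blast
    then show "A \<in> (\<Union>J\<in>{J\<in>Pow \<I>. \<exists>A\<in>D. p A = J}. {A. p A = J})" by (rule UN_I) simp
  next
    fix A assume "A \<in> (\<Union>J\<in>{J\<in>Pow \<I>. \<exists>A\<in>D. p A = J}. {A. p A = J})"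
    then obtain A' where "A' \<in> D" "p A' = p A" by (elim UN_E CollectE conjE bexE) simp
    then show "A \<in> D" by (rule det[rotated])
  qed
  also have "\<dots> \<in> sets (config_space W)"
  proof (intro sets.finite_UN)
    show "finite {J\<in>Pow \<I>. \<exists>A\<in>D. p A = J}" using I(1) by simp
    fix J assume "J \<in> {J\<in>Pow \<I>. \<exists>A\<in>D. p A = J}"
    then have J: "J \<subseteq> \<I>" by blast
    have pJ: "p A = J \<longleftrightarrow> (\<forall>B\<in>\<I>. A \<in> (if B \<in> J then {A. A \<inter> B \<noteq> {}} else {A. A \<inter> B = {}}))" for A
    proof -
      have "p A = J \<longleftrightarrow> (\<forall>B\<in>\<I>. (A \<inter> B \<noteq> {}) = (B \<in> J))" unfolding p_def using J by blast
      also have "\<dots> \<longleftrightarrow> (\<forall>B\<in>\<I>. A \<in> (if B \<in> J then {A. A \<inter> B \<noteq> {}} else {A. A \<inter> B = {}}))"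
        by (intro ball_cong) auto
      finally show ?thesis .
    qed
    have "{A. p A = J} = space (config_space W) \<inter>
      (\<Inter>B\<in>\<I>. if B \<in> J then {A. A \<inter> B \<noteq> {}} else {A. A \<inter> B = {}})"
      unfolding pJ by (simp only: space_config_space Int_UNIV_left INTER_eq)
    also have "\<dots> \<in> sets (config_space W)"
    proof (cases "\<I> = {}")
      case True
      then show ?thesis using sets.top[of "config_space W"] by simp
    next
      case False
      have "(if B \<in> J then {A. A \<inter> B \<noteq> {}} else {A. A \<inter> B = {}}) \<in> sets (config_space W)" if "B \<in> \<I>" for B
        using I(2) that hits_in_config_space[of B W] by simp
      then show ?thesis using False I(1)
        by (intro sets.Int sets.finite_INT) simp_all
    qed
    finally show "{A. p A = J} \<in> sets (config_space W)" .
  qed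
  finally show ?thesis .
qed

lemma sets_config_space_eq:
  "sets (config_space W) = sigma_sets UNIV {D. finitely_determined W D}"
proof (rule antisym)
  show "sets (config_space W) \<subseteq> sigma_sets UNIV {D. finitely_determined W D}"
    unfolding sets_config_space
  proof (rule sigma_sets_mono'')
    show "hitting ` {B \<in> sets borel. B \<subseteq> W} \<subseteq> {D. finitely_determined W D}"
      using finitely_determined_hitting by blast
  qed (auto intro: sigma_sets_top)
  have "{D. finitely_determined W D} \<subseteq> sets (config_space W)"
    using finitely_determined_in_config_space by blast
  then show "sigma_sets UNIV {D. finitely_determined W D} \<subseteq> sets (config_space W)"
    using sets.sigma_sets_subset[of "{D. finitely_determined W D}" "config_space W"] by simp
qed

text \<open>The test sets are refined to disjoint atoms, so that \<open>D\<close> becomes a set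
  \<open>\<J>\<close> of hit patterns and both probabilities are sums of Bernoulli products. Passing
  from void probabilities to intensities costs nothing, because \<open>exp (- x)\<close> is
  1-Lipschitz for nonnegative \<open>x\<close>.\<close>

lemma tv_finitely_determined:
  assumes P1: "poisson_process M1 \<Lambda>1 \<eta>1" and P2: "poisson_process M2 \<Lambda>2 \<eta>2"
    and sets: "sets \<Lambda>1 = sets borel" "sets \<Lambda>2 = sets borel" and W: "W \<in> sets borel"
    and fin: "emeasure \<Lambda>1 W < \<infinity>" "emeasure \<Lambda>2 W < \<infinity>"
    and d: "\<And>m C. (\<And>i. i < m \<Longrightarrow> C i \<in> sets borel \<and> C i \<subseteq> W) \<Longrightarrow> disjoint_family_on C {..<m} \<Longrightarrow>
      (\<Sum>i<m::nat. \<bar>measure \<Lambda>1 (C i) - measure \<Lambda>2 (C i)\<bar>) \<le> d"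
    and D: "finitely_determined W D"
  shows "\<bar>measure M1 {\<omega> \<in> space M1. \<eta>1 \<omega> \<in> D} - measure M2 {\<omega> \<in> space M2. \<eta>2 \<omega> \<in> D}\<bar> \<le> 2 * d"
proof -
  obtain \<I> where I: "finite \<I>" "\<forall>B\<in>\<I>. B \<in> sets borel \<and> B \<subseteq> W"
     "\<forall>A A'. (\<forall>B\<in>\<I>. A \<inter> B \<noteq> {} \<longleftrightarrow> A' \<inter> B \<noteq> {}) \<longrightarrow> A \<in> D \<longrightarrow> A' \<in> D"
    using D unfolding finitely_determined_def by (elim exE conjE)
  have IW: "\<And>B. B \<in> \<I> \<Longrightarrow> B \<in> sets borel \<and> B \<subseteq> W" using I(2) by (rule bspec)
  obtain m :: nat and C
    where C: "\<forall>i<m. C i \<in> sets borel \<and> C i \<subseteq> W" "disjoint_family_on C {..<m}"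
      "\<forall>B\<in>\<I>. B = (\<Union>i\<in>{i. i < m \<and> C i \<subseteq> B}. C i)"
    using finite_borel_partition[OF I(1) IW] .
  define p where "p A = {i. i < m \<and> A \<inter> C i \<noteq> {}}" for A
  have det: "A' \<in> D" if "p A = p A'" "A \<in> D" for A A'
  proof -
    have "A \<inter> B \<noteq> {} \<longleftrightarrow> A' \<inter> B \<noteq> {}" if B: "B \<in> \<I>" for B
    proof -
      have "X \<inter> B \<noteq> {} \<longleftrightarrow> (\<exists>i\<in>{i. i < m \<and> C i \<subseteq> B}. i \<in> p X)" for X
        unfolding p_def by (subst bspec[OF C(3) B]) blast
      then show ?thesis using \<open>p A = p A'\<close> by simp
    qed
    then have "\<forall>B\<in>\<I>. A \<inter> B \<noteq> {} \<longleftrightarrow> A' \<inter> B \<noteq> {}" by (rule ballI)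
    from I(3)[THEN spec, THEN spec, THEN mp, OF this] that(2) show ?thesis by (rule mp)
  qed
  define \<J> where "\<J> = {J. J \<subseteq> {..<m} \<and> (\<exists>A\<in>D. p A = J)}"
  have JD: "A \<in> D \<longleftrightarrow> p A \<in> \<J>" for A
  proof
    assume "p A \<in> \<J>"
    then obtain A' where "A' \<in> D" "p A' = p A" unfolding \<J>_def by blast
    then show "A \<in> D" by (rule det[rotated])
  next
    assume "A \<in> D"
    moreover have "p A \<subseteq> {..<m}" unfolding p_def by auto
    ultimately show "p A \<in> \<J>" unfolding \<J>_def by blast
  qed
  have Jsub: "\<J> \<subseteq> Pow {..<m}" unfolding \<J>_def by blast
  then have Jfin: "finite \<J>" by (rule finite_subset) simp
  let ?e = "\<lambda>\<Lambda> J. \<Prod>i<m. if i \<in> J then 1 - exp (- measure \<Lambda> (C i)) else exp (- measure \<Lambda> (C i))"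
  have prob: "measure M {\<omega> \<in> space M. \<eta> \<omega> \<in> D} = (\<Sum>J\<in>\<J>. ?e \<Lambda> J)"
    if P: "poisson_process M \<Lambda> \<eta>" and s: "sets \<Lambda> = sets borel" and f: "emeasure \<Lambda> W < \<infinity>" for M \<Lambda> and \<eta> :: "'z \<Rightarrow> 'b set"
  proof -
    interpret prob_space M using P by (rule poisson_process_prob_space)
    have CB: "C i \<in> sets borel" "emeasure \<Lambda> (C i) < \<infinity>" if "i < m" for i
      using C(1)[rule_format, OF that] emeasure_mono[of "C i" W \<Lambda>] W f s by (auto intro: le_less_trans)
    note pat = poisson_process_pattern_prob[OF P CB C(2), folded p_def]
    have "{\<omega> \<in> space M. \<eta> \<omega> \<in> D} = (\<Union>J\<in>\<J>. {\<omega> \<in> space M. p (\<eta> \<omega>) = J})"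
      unfolding JD by blast
    also have "prob \<dots> = (\<Sum>J\<in>\<J>. prob {\<omega> \<in> space M. p (\<eta> \<omega>) = J})"
      using Jfin pat(1) by (intro finite_measure_finite_Union) (auto simp: disjoint_family_on_def)
    also have "\<dots> = (\<Sum>J\<in>\<J>. ?e \<Lambda> J)"
      using pat(2) Jsub by (intro sum.cong refl) blast
    finally show ?thesis .
  qed
  have "\<bar>(\<Sum>J\<in>\<J>. ?e \<Lambda>1 J) - (\<Sum>J\<in>\<J>. ?e \<Lambda>2 J)\<bar> \<le> (\<Sum>J\<in>\<J>. \<bar>?e \<Lambda>1 J - ?e \<Lambda>2 J\<bar>)"
    unfolding sum_subtractf[symmetric] by (rule sum_abs)
  also have "\<dots> \<le> (\<Sum>J\<in>Pow {..<m}. \<bar>?e \<Lambda>1 J - ?e \<Lambda>2 J\<bar>)"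
    using Jsub by (intro sum_mono2) auto
  also have "\<dots> \<le> 2 * (\<Sum>i<m. \<bar>exp (- measure \<Lambda>1 (C i)) - exp (- measure \<Lambda>2 (C i))\<bar>)"
    by (rule bernoulli_products_diff(1)) auto
  also have "\<dots> \<le> 2 * (\<Sum>i<m. \<bar>measure \<Lambda>1 (C i) - measure \<Lambda>2 (C i)\<bar>)"
    by (intro mult_left_mono sum_mono abs_exp_minus_diff_le) auto
  also have "\<dots> \<le> 2 * d" using d[of m C] C by simp
  finally show ?thesis unfolding prob[OF P1 sets(1) fin(1)] prob[OF P2 sets(2) fin(2)] .
qed

text \<open>The usual approximation of a generated sigma-algebra by its algebra, but with one set
  \<open>A\<close> serving both measures: total variation is first known on the algebra, so both
  probabilities must be moved to the same \<open>A\<close>.\<close>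

lemma finite_measures_approx_algebra:
  fixes Q1 Q2 :: "'b measure"
  assumes "finite_measure Q1" "finite_measure Q2"
    and alg: "{} \<in> \<A>" "\<And>A. A \<in> \<A> \<Longrightarrow> - A \<in> \<A>" "\<And>A B. A \<in> \<A> \<Longrightarrow> B \<in> \<A> \<Longrightarrow> A \<union> B \<in> \<A>"
    and Q: "sets Q1 = sigma_sets UNIV \<A>" "sets Q2 = sigma_sets UNIV \<A>"
    and D: "D \<in> sigma_sets UNIV \<A>" and e: "(0::real) < e"
  shows "\<exists>A\<in>\<A>. measure Q1 ((D - A) \<union> (A - D)) < e \<and> measure Q2 ((D - A) \<union> (A - D)) < e"
proof -
  interpret Q1: finite_measure Q1 by fact
  interpret Q2: finite_measure Q2 by fact
  have As: "A \<in> sigma_sets UNIV \<A>" if "A \<in> \<A>" for A using that by (rule sigma_sets.Basic)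
  have "\<forall>e>0. \<exists>A\<in>\<A>. measure Q1 ((D - A) \<union> (A - D)) < e \<and> measure Q2 ((D - A) \<union> (A - D)) < e"
    using D
  proof (induction D rule: sigma_sets.induct)
    case (Basic a)
    then show ?case by (intro allI impI bexI[of _ a]) simp_all
  next
    case Empty
    then show ?case using alg(1) by (intro allI impI bexI[of _ "{}"]) simp_all
  next
    case (Compl a)
    show ?case
    proof (intro allI impI)
      fix e :: real assume "e > 0"
      then obtain A where A: "A \<in> \<A>" "measure Q1 ((a - A) \<union> (A - a)) < e" "measure Q2 ((a - A) \<union> (A - a)) < e"
        using Compl.IH by blast
      have "((UNIV - a) - (- A)) \<union> ((- A) - (UNIV - a)) = (a - A) \<union> (A - a)" by blast
      then show "\<exists>A\<in>\<A>. measure Q1 (((UNIV - a) - A) \<union> (A - (UNIV - a))) < e \<and> measure Q2 (((UNIV - a) - A) \<union> (A - (UNIV - a))) < e"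
        using A alg(2) by (intro bexI[of _ "- A"]) simp_all
    qed
  next
    case (Union a)
    show ?case
    proof (intro allI impI)
      fix e :: real assume e: "e > 0"
      let ?U = "\<Union>i. a i"
      have am: "a i \<in> sets Q1" "a i \<in> sets Q2" for i using Union.hyps Q by auto
      have lim: "\<exists>N. measure Q (?U - (\<Union>i<N. a i)) < e / 2" if "finite_measure Q" "\<And>i. a i \<in> sets Q" for Q
      proof -
        interpret finite_measure Q by fact
        have "(\<lambda>N. measure Q (\<Union>i<N. a i)) \<longlonglongrightarrow> measure Q (\<Union>N. \<Union>i<N. a i)"
          using that(2) by (intro finite_Lim_measure_incseq) (auto simp: incseq_def intro: less_le_trans)
        moreover have "(\<Union>N. \<Union>i<N. a i) = ?U" by auto
        ultimately have "(\<lambda>N. measure Q (\<Union>i<N. a i)) \<longlonglongrightarrow> measure Q ?U" by simp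
        then have "\<forall>\<^sub>F N in sequentially. measure Q (\<Union>i<N. a i) > measure Q ?U - e / 2"
          using e by (intro order_tendstoD) auto
        then obtain N where "measure Q (\<Union>i<N. a i) > measure Q ?U - e / 2"
          unfolding eventually_sequentially by blast
        moreover have "measure Q (?U - (\<Union>i<N. a i)) = measure Q ?U - measure Q (\<Union>i<N. a i)"
          using that(2) by (intro finite_measure_Diff) auto
        ultimately show ?thesis by (intro exI[of _ N]) simp
      qed
      obtain N1 where N1: "measure Q1 (?U - (\<Union>i<N1. a i)) < e / 2" using lim[OF assms(1) am(1)] by blast
      obtain N2 where N2: "measure Q2 (?U - (\<Union>i<N2. a i)) < e / 2" using lim[OF assms(2) am(2)] by blast
      \<comment> \<open>Half of \<open>e\<close> is spent on cutting the union off at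
        \<open>N\<close>, the other half on \<open>N\<close> approximations of size
        \<open>e / (2 * N)\<close>. The \<open>Suc\<close> keeps \<open>N\<close> positive.\<close>
      define N where "N = Suc (max N1 N2)"
      have "real N > 0" unfolding N_def by simp
      have sub: "?U - (\<Union>i<N. a i) \<subseteq> ?U - (\<Union>i<N1. a i)" "?U - (\<Union>i<N. a i) \<subseteq> ?U - (\<Union>i<N2. a i)"
        unfolding N_def by fastforce+
      have N: "measure Q1 (?U - (\<Union>i<N. a i)) < e / 2" "measure Q2 (?U - (\<Union>i<N. a i)) < e / 2"
        using Q1.finite_measure_mono[OF sub(1)] Q2.finite_measure_mono[OF sub(2)] N1 N2 am
        by (auto intro: le_less_trans)
      have "\<forall>i. \<exists>A\<in>\<A>. measure Q1 ((a i - A) \<union> (A - a i)) < e / (2 * N) \<and> measure Q2 ((a i - A) \<union> (A - a i)) < e / (2 * N)"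
        using Union.IH e unfolding N_def by simp
      then obtain A where A: "\<And>i. A i \<in> \<A>" "\<And>i. measure Q1 ((a i - A i) \<union> (A i - a i)) < e / (2 * N)"
          "\<And>i. measure Q2 ((a i - A i) \<union> (A i - a i)) < e / (2 * N)" by metis
      let ?A = "\<Union>i<N. A i"
      have A_in: "(\<Union>i<n. A i) \<in> \<A>" for n
        by (induction n) (use alg A in \<open>auto simp: lessThan_Suc\<close>)
      have bound: "measure Q ((?U - ?A) \<union> (?A - ?U)) < e"
        if "finite_measure Q" and aQ: "\<And>i. a i \<in> sets Q" "\<And>i. A i \<in> sets Q"
          "measure Q (?U - (\<Union>i<N. a i)) < e / 2" "\<And>i. measure Q ((a i - A i) \<union> (A i - a i)) < e / (2 * N)" for Q
      proof -
        interpret finite_measure Q by fact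
        let ?S = "\<lambda>i. (a i - A i) \<union> (A i - a i)"
        have "measure Q ((?U - ?A) \<union> (?A - ?U)) \<le> measure Q ((?U - (\<Union>i<N. a i)) \<union> (\<Union>i<N. ?S i))"
        proof (rule finite_measure_mono)
          show "(?U - ?A) \<union> (?A - ?U) \<subseteq> (?U - (\<Union>i<N. a i)) \<union> (\<Union>i<N. ?S i)" by blast
          show "(?U - (\<Union>i<N. a i)) \<union> (\<Union>i<N. ?S i) \<in> sets Q" using aQ by auto
        qed
        also have "\<dots> \<le> measure Q (?U - (\<Union>i<N. a i)) + measure Q (\<Union>i<N. ?S i)"
          using aQ by (intro measure_Un_le) auto
        also have "measure Q (\<Union>i<N. ?S i) \<le> (\<Sum>i<N. measure Q (?S i))"
          using aQ by (intro finite_measure_subadditive_finite) auto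
        also have "\<dots> \<le> (\<Sum>i<N. e / (2 * N))"
          using aQ(4) by (intro sum_mono) (simp add: less_imp_le)
        also have "\<dots> = e / 2" using \<open>real N > 0\<close> by (simp add: field_simps)
        finally show ?thesis using aQ(3) by simp
      qed
      have "measure Q1 ((?U - ?A) \<union> (?A - ?U)) < e" "measure Q2 ((?U - ?A) \<union> (?A - ?U)) < e"
        using bound[OF assms(1)] bound[OF assms(2)] am A N As Q by simp_all
      then show "\<exists>A\<in>\<A>. measure Q1 ((?U - A) \<union> (A - ?U)) < e \<and> measure Q2 ((?U - A) \<union> (A - ?U)) < e"
        using A_in[of N] by blast
    qed
  qed
  then show ?thesis using e by blast
qed

text \<open>Under both laws \<open>D\<close> is exchanged for one finitely determined event at a
  cost below \<open>e / 2\<close> each; as \<open>e\<close> is arbitrary, the bound on the algebra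
  carries over without loss.\<close>

lemma tv_config_space:
  assumes P1: "poisson_process M1 \<Lambda>1 \<eta>1" and P2: "poisson_process M2 \<Lambda>2 \<eta>2"
    and sets: "sets \<Lambda>1 = sets borel" "sets \<Lambda>2 = sets borel" and W: "W \<in> sets borel"
    and fin: "emeasure \<Lambda>1 W < \<infinity>" "emeasure \<Lambda>2 W < \<infinity>"
    and d: "\<And>m C. (\<And>i. i < m \<Longrightarrow> C i \<in> sets borel \<and> C i \<subseteq> W) \<Longrightarrow> disjoint_family_on C {..<m} \<Longrightarrow>
      (\<Sum>i<m::nat. \<bar>measure \<Lambda>1 (C i) - measure \<Lambda>2 (C i)\<bar>) \<le> d"
    and D: "D \<in> sets (config_space W)"
  shows "\<bar>measure M1 {\<omega> \<in> space M1. \<eta>1 \<omega> \<in> D} - measure M2 {\<omega> \<in> space M2. \<eta>2 \<omega> \<in> D}\<bar> \<le> 2 * d"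
proof (rule field_le_epsilon)
  fix e :: real assume e: "0 < e"
  interpret M1: prob_space M1 using P1 by (rule poisson_process_prob_space)
  interpret M2: prob_space M2 using P2 by (rule poisson_process_prob_space)
  note m1 = measurable_config_space[OF P1, of W] and m2 = measurable_config_space[OF P2, of W]
  let ?Q1 = "distr M1 (config_space W) \<eta>1" and ?Q2 = "distr M2 (config_space W) \<eta>2"
  interpret Q1: prob_space ?Q1 using m1 by (rule M1.prob_space_distr)
  interpret Q2: prob_space ?Q2 using m2 by (rule M2.prob_space_distr)
  have q1: "measure ?Q1 X = measure M1 {\<omega> \<in> space M1. \<eta>1 \<omega> \<in> X}" if "X \<in> sets (config_space W)" for X
    using that by (subst measure_distr[OF m1]) (auto intro!: arg_cong[where f = "measure M1"])
  have q2: "measure ?Q2 X = measure M2 {\<omega> \<in> space M2. \<eta>2 \<omega> \<in> X}" if "X \<in> sets (config_space W)" for X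
    using that by (subst measure_distr[OF m2]) (auto intro!: arg_cong[where f = "measure M2"])
  have "\<exists>A\<in>{D. finitely_determined W D}. measure ?Q1 ((D - A) \<union> (A - D)) < e / 2 \<and>
      measure ?Q2 ((D - A) \<union> (A - D)) < e / 2"
    using D e finitely_determined_empty finitely_determined_compl finitely_determined_Un
    by (intro finite_measures_approx_algebra Q1.finite_measure_axioms Q2.finite_measure_axioms)
      (auto simp: sets_config_space_eq)
  then obtain A where A: "finitely_determined W A" "measure ?Q1 ((D - A) \<union> (A - D)) < e / 2"
      "measure ?Q2 ((D - A) \<union> (A - D)) < e / 2" by blast
  have As: "A \<in> sets (config_space W)" using A(1) by (rule finitely_determined_in_config_space)
  have diff: "\<bar>measure Q D - measure Q A\<bar> \<le> measure Q ((D - A) \<union> (A - D))"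
    if "prob_space Q" "D \<in> sets Q" "A \<in> sets Q" for Q
  proof -
    interpret prob_space Q by fact
    have "prob D \<le> prob (A \<union> ((D - A) \<union> (A - D)))" "prob A \<le> prob (D \<union> ((D - A) \<union> (A - D)))"
      using that by (auto intro!: finite_measure_mono)
    moreover have "prob (A \<union> ((D - A) \<union> (A - D))) \<le> prob A + prob ((D - A) \<union> (A - D))"
        "prob (D \<union> ((D - A) \<union> (A - D))) \<le> prob D + prob ((D - A) \<union> (A - D))"
      using that by (auto intro!: measure_Un_le)
    ultimately show ?thesis by linarith
  qed
  have "\<bar>measure ?Q1 D - measure ?Q1 A\<bar> < e / 2" "\<bar>measure ?Q2 D - measure ?Q2 A\<bar> < e / 2"
    using diff[OF Q1.prob_space_axioms] diff[OF Q2.prob_space_axioms] A(2,3) D As by simp_all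
  moreover have "\<bar>measure ?Q1 A - measure ?Q2 A\<bar> \<le> 2 * d"
    unfolding q1[OF As] q2[OF As] using tv_finitely_determined[OF P1 P2 sets W fin d A(1)] .
  ultimately have "\<bar>measure ?Q1 D - measure ?Q2 D\<bar> \<le> 2 * d + e" by linarith
  then show "\<bar>measure M1 {\<omega> \<in> space M1. \<eta>1 \<omega> \<in> D} - measure M2 {\<omega> \<in> space M2. \<eta>2 \<omega> \<in> D}\<bar> \<le> 2 * d + e"
    unfolding q1[OF D] q2[OF D] .
qed

lemma integral_tendsto_of_tv:
  fixes h :: "'b \<Rightarrow> real"
  assumes Q: "\<And>n. prob_space (Q n)" "prob_space R" and s: "\<And>n. sets (Q n) = sets R"
    and d: "d \<longlonglongrightarrow> 0" and tv: "\<forall>\<^sub>F n in sequentially. \<forall>D\<in>sets R. \<bar>measure (Q n) D - measure R D\<bar> \<le> d n"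
    and h: "h \<in> borel_measurable R" "\<And>x. \<bar>h x\<bar> \<le> c"
  shows "(\<lambda>n. integral\<^sup>L (Q n) h) \<longlonglongrightarrow> integral\<^sup>L R h"
proof (rule LIMSEQ_I)
  fix e :: real assume e: "0 < e"
  interpret R: prob_space R by fact
  \<comment> \<open>Three errors below \<open>e / 3\<close>: rounding \<open>h\<close> down to
    multiples of \<open>1 / k\<close> under each of the two measures, and the change of measure. As
    \<open>h\<close> is bounded, only the levels in the finite set \<open>J\<close> occur, so the
    last error is at most a fixed multiple \<open>S\<close> of \<open>d n\<close>.\<close>
  define k :: nat where "k = nat \<lceil>3 / e\<rceil> + 1"
  have k: "k > 0" "1 / real k < e / 3"
  proof -
    show "k > 0" unfolding k_def by simp
    have "3 / e < real k" unfolding k_def by linarith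
    then show "1 / real k < e / 3" using e \<open>k > 0\<close> by (simp add: field_simps)
  qed
  define J where "J = {- \<lceil>c * k\<rceil> - 1 .. \<lceil>c * k\<rceil> + 1}"
  let ?E = "\<lambda>j::int. {x \<in> space R. \<lfloor>h x * k\<rfloor> = j}"
  have E: "?E j \<in> sets R" for j using h(1) by measurable
  define h' where "h' = (\<lambda>x. \<Sum>j\<in>J. (real_of_int j / k) * indicator (?E j) x)"
  have h': "h' x = real_of_int \<lfloor>h x * k\<rfloor> / k" if "x \<in> space R" for x
  proof -
    have "\<bar>h x * k\<bar> \<le> c * k" using h(2)[of x] by (simp add: abs_mult mult_right_mono)
    then have "\<lfloor>h x * k\<rfloor> \<in> J" unfolding J_def by (simp, linarith)
    then have "h' x = (\<Sum>j\<in>{\<lfloor>h x * k\<rfloor>}. (real_of_int j / k) * indicator (?E j) x)"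
      unfolding h'_def using that by (intro sum.mono_neutral_right) (auto simp: J_def indicator_def)
    then show ?thesis using that by simp
  qed
  have close: "\<bar>h x - h' x\<bar> \<le> 1 / k" if "x \<in> space R" for x
  proof -
    have "h x - h' x = (h x * k - real_of_int \<lfloor>h x * k\<rfloor>) / k"
      unfolding h'[OF that] using k(1) by (simp add: field_simps)
    moreover have "0 \<le> h x * k - real_of_int \<lfloor>h x * k\<rfloor>" "h x * k - real_of_int \<lfloor>h x * k\<rfloor> \<le> 1" by linarith+
    ultimately show ?thesis using k(1) by (simp add: divide_right_mono)
  qed
  have int: "\<bar>integral\<^sup>L Q h - (\<Sum>j\<in>J. (real_of_int j / k) * measure Q (?E j))\<bar> \<le> 1 / k"
    if "prob_space Q" and s: "sets Q = sets R" for Q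
  proof -
    interpret prob_space Q by fact
    have sp: "space Q = space R" using s by (rule sets_eq_imp_space_eq)
    have E': "?E j \<in> sets Q" for j using E s by simp
    have hQ: "h \<in> borel_measurable Q" using h(1) s by (simp cong: measurable_cong_sets)
    have ih: "integrable Q h" using hQ h(2) by (intro integrable_const_bound[of _ c]) auto
    have ih': "integrable Q h'" unfolding h'_def using E'
      by (intro Bochner_Integration.integrable_sum integrable_mult_right integrable_real_indicator)
        (auto simp: emeasure_eq_measure)
    have "integral\<^sup>L Q h' = (\<Sum>j\<in>J. (real_of_int j / k) * measure Q (?E j))"
      unfolding h'_def using E'
      by (subst Bochner_Integration.integral_sum)
        (auto intro!: integrable_mult_right integrable_real_indicator simp: emeasure_eq_measure)
    moreover have "\<bar>integral\<^sup>L Q h - integral\<^sup>L Q h'\<bar> \<le> 1 / k"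
    proof -
      have "\<bar>integral\<^sup>L Q h - integral\<^sup>L Q h'\<bar> = \<bar>integral\<^sup>L Q (\<lambda>x. h x - h' x)\<bar>"
        using ih ih' by simp
      also have "\<dots> \<le> integral\<^sup>L Q (\<lambda>x. \<bar>h x - h' x\<bar>)" by (rule integral_abs_bound)
      also have "\<dots> \<le> integral\<^sup>L Q (\<lambda>x. 1 / k)"
        using ih ih' close sp by (intro integral_mono) auto
      also have "\<dots> = 1 / k" by (simp add: prob_space)
      finally show ?thesis .
    qed
    ultimately show ?thesis by simp
  qed
  define S where "S = (\<Sum>j\<in>J. \<bar>real_of_int j / k\<bar>)"
  have S: "S \<ge> 0" unfolding S_def by (intro sum_nonneg) auto
  have "(\<lambda>n. S * d n) \<longlonglongrightarrow> S * 0" by (intro tendsto_intros d)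
  then have "\<forall>\<^sub>F n in sequentially. S * d n < e / 3" using e by (intro order_tendstoD) auto
  with tv have "\<forall>\<^sub>F n in sequentially. norm (integral\<^sup>L (Q n) h - integral\<^sup>L R h) < e"
  proof eventually_elim
    case (elim n)
    let ?s = "\<lambda>Q. \<Sum>j\<in>J. (real_of_int j / k) * measure Q (?E j)"
    have "\<bar>?s (Q n) - ?s R\<bar> \<le> (\<Sum>j\<in>J. \<bar>real_of_int j / k\<bar> * \<bar>measure (Q n) (?E j) - measure R (?E j)\<bar>)"
      unfolding sum_subtractf[symmetric] right_diff_distrib[symmetric] abs_mult[symmetric] by (rule sum_abs)
    also have "\<dots> \<le> (\<Sum>j\<in>J. \<bar>real_of_int j / k\<bar> * d n)"
      using elim(1) E by (intro sum_mono mult_left_mono) auto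
    also have "\<dots> = S * d n" unfolding S_def by (rule sum_distrib_right[symmetric])
    finally have "\<bar>?s (Q n) - ?s R\<bar> < e / 3" using elim(2) by simp
    with int[OF Q(1) s, of n] int[OF Q(2) refl] k(2) show ?case
      unfolding real_norm_def by linarith
  qed
  then show "\<exists>N. \<forall>n\<ge>N. norm (integral\<^sup>L (Q n) h - integral\<^sup>L R h) < e"
    unfolding eventually_sequentially .
qed

section \<open>Laguerre skeletons in terms of minimizers\<close>

definition minimizers :: "('a::euclidean_space \<times> real) set \<Rightarrow> 'a \<Rightarrow> ('a \<times> real) set" where
  "minimizers A w = {p \<in> A. \<forall>q\<in>A. pow w p \<le> pow w q}"

lemma minimizers_iff_cell: "p \<in> A \<Longrightarrow> p \<in> minimizers A w \<longleftrightarrow> w \<in> laguerre_cell p A"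
  unfolding minimizers_def laguerre_cell_def by simp

lemma minimizers_subset: "minimizers A w \<subseteq> A"
  unfolding minimizers_def by auto

lemma minimizers_pow_eq: "p \<in> minimizers A w \<Longrightarrow> q \<in> minimizers A w \<Longrightarrow> pow w p = pow w q"
  unfolding minimizers_def by (auto intro: antisym)

text \<open>Equal power and equal nucleus force equal weight. Hence distinct weighted points that
  share an apex give distinct vertices.\<close>

lemma inj_on_fst_minimizers: "inj_on fst (minimizers A w)"
proof (rule inj_onI)
  fix p q assume "p \<in> minimizers A w" "q \<in> minimizers A w" "fst p = fst q"
  then show "p = q" using minimizers_pow_eq[of p A w q] unfolding pow_def by (simp add: prod_eq_iff)
qed

lemma continuous_pow [continuous_intros]: "continuous_on S (\<lambda>w. pow w p)"
  unfolding pow_def by (intro continuous_intros)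

lemma continuous_pow2: "continuous_on S (\<lambda>p. pow w p)"
  unfolding pow_def by (intro continuous_intros)

lemma closed_laguerre_cell: "closed (laguerre_cell p A)"
proof -
  have "laguerre_cell p A = (\<Inter>q\<in>A. {w. pow w p \<le> pow w q})"
    unfolding laguerre_cell_def by auto
  then show ?thesis by (auto intro!: closed_INT closed_Collect_le continuous_pow)
qed

text \<open>A common point \<open>w\<close> of the cells is the same as a point at which all of
  \<open>S\<close> are minimizers. Their nuclei are then distinct, so the image of \<open>S\<close>
  under \<open>fst\<close> has \<open>DIM('a) + 1\<close> points, as the facet formula for the
  frontier requires.\<close>

lemma skel_dual_laguerre:
  fixes A :: "('a::euclidean_space \<times> real) set"
  shows "skel (dual_laguerre A) = {z. \<exists>w S. S \<subseteq> minimizers A w \<and> card S = DIM('a) + 1 \<and>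
    (\<exists>p\<in>S. z \<in> convex hull (fst ` (S - {p})))}"
proof -
  have front: "frontier (convex hull (fst ` S)) = (\<Union>p\<in>S. convex hull (fst ` (S - {p})))"
    if S: "S \<subseteq> minimizers A w" "card S = DIM('a) + 1" for S w
  proof -
    have inj: "inj_on fst S" using inj_on_fst_minimizers S(1) by (rule inj_on_subset)
    then have "card (fst ` S) = Suc (DIM('a))" using S(2) by (simp add: card_image)
    then have "frontier (convex hull (fst ` S)) = \<Union> {convex hull (fst ` S - {a}) |a. a \<in> fst ` S}"
      by (rule frontier_of_convex_hull)
    also have "\<dots> = (\<Union>p\<in>S. convex hull (fst ` S - {fst p}))" by auto
    also have "\<dots> = (\<Union>p\<in>S. convex hull (fst ` (S - {p})))"
    proof (intro SUP_cong refl)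
      fix p assume p: "p \<in> S"
      have "fst ` (S - {p}) = fst ` S - fst ` {p}"
        by (rule inj_on_image_set_diff[OF inj]) (use p in auto)
      then show "convex hull (fst ` S - {fst p}) = convex hull (fst ` (S - {p}))" by simp
    qed
    finally show ?thesis .
  qed
  have cells: "S \<subseteq> A \<and> w \<in> (\<Inter>p\<in>S. laguerre_cell p A) \<longleftrightarrow> S \<subseteq> minimizers A w" for S w
    using minimizers_iff_cell[of _ A w] minimizers_subset[of A w] by blast
  show ?thesis
  proof (intro equalityI subsetI)
    fix z assume "z \<in> skel (dual_laguerre A)"
    then obtain S where S: "S \<subseteq> A" "card S = DIM('a) + 1" "(\<Inter>p\<in>S. laguerre_cell p A) \<noteq> {}"
        "z \<in> frontier (convex hull (fst ` S))"
      unfolding skel_def dual_laguerre_def by blast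
    then obtain w where "w \<in> (\<Inter>p\<in>S. laguerre_cell p A)" by blast
    with S(1) have w: "S \<subseteq> minimizers A w" using cells by blast
    with S(2,4) front[OF w S(2)] show "z \<in> {z. \<exists>w S. S \<subseteq> minimizers A w \<and> card S = DIM('a) + 1 \<and>
    (\<exists>p\<in>S. z \<in> convex hull (fst ` (S - {p})))}" by blast
  next
    fix z assume "z \<in> {z. \<exists>w S. S \<subseteq> minimizers A w \<and> card S = DIM('a) + 1 \<and>
    (\<exists>p\<in>S. z \<in> convex hull (fst ` (S - {p})))}"
    then obtain w S where S: "S \<subseteq> minimizers A w" "card S = DIM('a) + 1"
      "\<exists>p\<in>S. z \<in> convex hull (fst ` (S - {p}))" by blast
    then have "z \<in> frontier (convex hull (fst ` S))" using front[OF S(1,2)] by blast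
    moreover have "S \<subseteq> A" "(\<Inter>p\<in>S. laguerre_cell p A) \<noteq> {}" using cells[of S w] S(1) by blast+
    moreover have "finite S" using S(2) by (metis Suc_eq_plus1 card.infinite nat.distinct(1))
    ultimately show "z \<in> skel (dual_laguerre A)"
      unfolding skel_def dual_laguerre_def using S(2) by blast
  qed
qed

lemma interior_finite_Union_closed_empty:
  fixes \<C> :: "'b::topological_space set set"
  assumes "finite \<C>" "\<And>C. C \<in> \<C> \<Longrightarrow> closed C" "\<And>C. C \<in> \<C> \<Longrightarrow> interior C = {}"
  shows "interior (\<Union>\<C>) = {}"
  using assms
proof (induction \<C>)
  case empty
  then show ?case by simp
next
  case (insert C \<C>)
  have "interior (C \<union> \<Union>\<C>) = interior C"
    using insert by (intro interior_closed_Un_empty_interior) auto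
  then show ?case using insert by simp
qed

text \<open>Finitely many points compete over the ball. If \<open>p\<close> is the only minimizer at
  \<open>w\<close>, it beats the others strictly near \<open>w\<close>, so \<open>w\<close> is
  interior to its cell. Conversely, the cells of the minimizers at \<open>w\<close> cover a
  neighbourhood of \<open>w\<close>, so one of them has interior points and belongs to the diagram;
  a second minimizer keeps \<open>w\<close> on its boundary.\<close>

lemma skel_laguerre_diagram_local:
  fixes A :: "('a::euclidean_space \<times> real) set"
  assumes fin: "finite {p \<in> A. \<exists>w\<in>cball 0 \<rho>. pow w p \<le> t}"
    and cover: "\<And>w. w \<in> cball 0 \<rho> \<Longrightarrow> \<exists>p\<in>A. pow w p \<le> t"
    and w: "norm w < \<rho>"
  shows "w \<in> skel (laguerre_diagram A) \<longleftrightarrow> (\<exists>S\<subseteq>minimizers A w. card S = 2)"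
proof -
  define F where "F = {p \<in> A. \<exists>w\<in>cball 0 \<rho>. pow w p \<le> t}"
  have F: "finite F" "F \<subseteq> A" using fin unfolding F_def by auto
  have minF: "\<exists>p\<in>F. pow x p \<le> t \<and> p \<in> minimizers A x" and sub: "minimizers A x \<subseteq> F" if x: "x \<in> cball 0 \<rho>" for x
  proof -
    obtain q where q: "q \<in> A" "pow x q \<le> t" using cover[OF x] by blast
    then have qF: "q \<in> F" unfolding F_def using x by blast
    then have ne: "F \<noteq> {}" by blast
    define p where "p = arg_min_on (pow x) F"
    have p: "p \<in> F" "\<And>q. q \<in> F \<Longrightarrow> pow x p \<le> pow x q"
      unfolding p_def using F(1) ne by (auto intro: arg_min_if_finite arg_min_least)
    have "pow x p \<le> pow x q'" if "q' \<in> A" for q'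
    proof (cases "q' \<in> F")
      case False
      then have "\<not> pow x q' \<le> t" using that x unfolding F_def by blast
      then show ?thesis using p(2)[OF qF] q by linarith
    qed (rule p)
    then have "p \<in> minimizers A x" using p F unfolding minimizers_def by blast
    moreover have "pow x p \<le> t" using p(2)[OF qF] q by linarith
    ultimately show "\<exists>p\<in>F. pow x p \<le> t \<and> p \<in> minimizers A x" using p by blast
    show "minimizers A x \<subseteq> F"
    proof
      fix p' assume p': "p' \<in> minimizers A x"
      then have "pow x p' \<le> pow x q" using q(1) unfolding minimizers_def by blast
      then have "pow x p' \<le> t" using q(2) by linarith
      then show "p' \<in> F" using p' x minimizers_subset unfolding F_def by blast
    qed
  qed
  have wb: "w \<in> ball 0 \<rho>" "w \<in> cball 0 \<rho>" using w by auto
  show ?thesis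
  proof
    assume "w \<in> skel (laguerre_diagram A)"
    then obtain p where p: "p \<in> A" "w \<in> frontier (laguerre_cell p A)"
      unfolding skel_def laguerre_diagram_def by blast
    have "w \<in> laguerre_cell p A"
      using p(2) closed_laguerre_cell by (metis Diff_iff closure_closed frontier_def)
    then have pm: "p \<in> minimizers A w" using minimizers_iff_cell p by blast
    show "\<exists>S\<subseteq>minimizers A w. card S = 2"
    proof (cases "\<exists>q\<in>minimizers A w. q \<noteq> p")
      case True
      then obtain q where "q \<in> minimizers A w" "q \<noteq> p" by blast
      then show ?thesis using pm by (intro exI[of _ "{p, q}"]) auto
    next
      case False
      have lt: "pow w p < pow w q" if "q \<in> F - {p}" for q
      proof -
        have "q \<notin> minimizers A w" using False that by blast
        moreover have "q \<in> A" using that F by blast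
        ultimately obtain q' where q': "q' \<in> A" "\<not> pow w q \<le> pow w q'" unfolding minimizers_def by blast
        have "pow w p \<le> pow w q'" using pm q'(1) unfolding minimizers_def by blast
        then show ?thesis using q'(2) by linarith
      qed
      let ?U = "ball 0 \<rho> \<inter> (\<Inter>q\<in>F - {p}. {x. pow x p < pow x q})"
      have "open ?U"
        using F(1) by (intro open_Int open_INT ballI open_Collect_less continuous_pow) auto
      moreover have "w \<in> ?U" using wb lt by auto
      moreover have "?U \<subseteq> laguerre_cell p A"
      proof
        fix x assume x: "x \<in> ?U"
        then have "x \<in> cball 0 \<rho>" by auto
        from minF[OF this] obtain p' where p': "p' \<in> F" "p' \<in> minimizers A x" by blast
        have "p' = p"
        proof (rule ccontr)
          assume "p' \<noteq> p"
          then have "pow x p < pow x p'" using x p' by blast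
          moreover have "pow x p' \<le> pow x p" using p'(2) p(1) unfolding minimizers_def by blast
          ultimately show False by simp
        qed
        then show "x \<in> laguerre_cell p A" using p' p(1) minimizers_iff_cell by blast
      qed
      ultimately have "w \<in> interior (laguerre_cell p A)" by (rule interiorI)
      then show ?thesis using p(2) unfolding frontier_def by blast
    qed
  next
    assume "\<exists>S\<subseteq>minimizers A w. card S = 2"
    then obtain S where "S \<subseteq> minimizers A w" "card S = 2" by blast
    then obtain p q where pq: "p \<in> minimizers A w" "q \<in> minimizers A w" "p \<noteq> q"
      unfolding card_2_iff by blast
    let ?M = "minimizers A w"
    have M: "finite ?M" "?M \<subseteq> F" using sub[OF wb(2)] F(1) finite_subset by blast+
    let ?U = "ball 0 \<rho> \<inter> (\<Inter>q\<in>F - ?M. - laguerre_cell q A)"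
    have U: "open ?U"
      using F(1) closed_laguerre_cell by (intro open_Int open_INT ballI) auto
    have wU: "w \<in> ?U" using wb F minimizers_iff_cell by blast
    have Usub: "?U \<subseteq> \<Union>((\<lambda>p. laguerre_cell p A) ` ?M)"
    proof
      fix x assume x: "x \<in> ?U"
      then have "x \<in> cball 0 \<rho>" by auto
      from minF[OF this] obtain p' where p': "p' \<in> F" "p' \<in> minimizers A x" by blast
      then have "x \<in> laguerre_cell p' A" using minimizers_iff_cell F by blast
      then show "x \<in> \<Union>((\<lambda>p. laguerre_cell p A) ` ?M)" using x p' by blast
    qed
    \<comment> \<open>A finite union of closed sets without interior points has none either, but
      this one contains the open set \<open>?U\<close> around \<open>w\<close>.\<close>
    have "\<exists>p'\<in>?M. interior (laguerre_cell p' A) \<noteq> {}"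
    proof (rule ccontr)
      assume "\<not> ?thesis"
      then have "interior (\<Union>((\<lambda>p. laguerre_cell p A) ` ?M)) = {}"
        using M closed_laguerre_cell by (intro interior_finite_Union_closed_empty) auto
      then show False using interiorI[OF U wU Usub] by blast
    qed
    then obtain p' where p': "p' \<in> ?M" "interior (laguerre_cell p' A) \<noteq> {}" by blast
    obtain q' where q': "q' \<in> ?M" "q' \<noteq> p'" using pq by metis
    have "w \<notin> interior (laguerre_cell p' A)"
    proof
      assume "w \<in> interior (laguerre_cell p' A)"
      then obtain e where e: "e > 0" "ball w e \<subseteq> laguerre_cell p' A" by (auto simp: mem_interior)
      let ?u = "fst q' - fst p'"
      have "?u \<noteq> 0"
        using inj_on_fst_minimizers p'(1) q' unfolding inj_on_def by (metis right_minus_eq)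
      then have nu: "norm ?u > 0" by simp
      \<comment> \<open>A step of length \<open>e / 2\<close> from \<open>w\<close> in the direction
        of the other nucleus. The two powers agree at \<open>w\<close>, and the step puts the power
        of \<open>q'\<close> below that of \<open>p'\<close> by
        \<open>2 * s * (?u \<bullet> ?u)\<close>.\<close>
      define s where "s = e / (2 * norm ?u)"
      have s: "s > 0" unfolding s_def using e nu by simp
      have "w + s *\<^sub>R ?u \<in> ball w e" unfolding s_def using e(1) nu by (simp add: dist_norm)
      then have "pow (w + s *\<^sub>R ?u) p' \<le> pow (w + s *\<^sub>R ?u) q'"
        using e(2) q' minimizers_subset unfolding laguerre_cell_def by blast
      moreover have "pow (w + s *\<^sub>R ?u) p' - pow (w + s *\<^sub>R ?u) q' = pow w p' - pow w q' + 2 * s * (?u \<bullet> ?u)"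
        unfolding pow_def power2_norm_eq_inner by (simp add: algebra_simps inner_commute)
      moreover have "pow w p' = pow w q'" using minimizers_pow_eq p' q' by blast
      moreover have "s * (?u \<bullet> ?u) > 0" using s nu by simp
      ultimately show False by linarith
    qed
    moreover have "w \<in> laguerre_cell p' A" using p'(1) minimizers_iff_cell minimizers_subset by blast
    ultimately have "w \<in> frontier (laguerre_cell p' A)"
      using closed_laguerre_cell[of p' A] by (simp add: frontier_def)
    then show "w \<in> skel (laguerre_diagram A)"
      using p' minimizers_subset[of A w] unfolding skel_def laguerre_diagram_def by blast
  qed
qed

section \<open>Localization of minimizers and of points of small power\<close>

lemma minimizers_restrict:
  assumes "B \<subseteq> A" "{p \<in> A. pow w p \<le> t} \<subseteq> B" "\<exists>p\<in>A. pow w p \<le> t"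
  shows "minimizers B w = minimizers A w"
proof -
  obtain q where q: "q \<in> A" "pow w q \<le> t" using assms(3) by blast
  then have qB: "q \<in> B" using assms(2) by blast
  show ?thesis
  proof (intro equalityI subsetI)
    fix p assume p: "p \<in> minimizers B w"
    then have pB: "p \<in> B" "\<And>x. x \<in> B \<Longrightarrow> pow w p \<le> pow w x" unfolding minimizers_def by auto
    have "pow w p \<le> pow w x" if "x \<in> A" for x
    proof (cases "pow w x \<le> t")
      case True
      then show ?thesis using pB(2) assms(2) that by blast
    next
      case False
      then show ?thesis using pB(2)[OF qB] q by linarith
    qed
    then show "p \<in> minimizers A w" using pB assms(1) unfolding minimizers_def by blast
  next
    fix p assume p: "p \<in> minimizers A w"
    then have "p \<in> A" "pow w p \<le> pow w q" using q(1) unfolding minimizers_def by blast+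
    moreover from this q(2) have "pow w p \<le> t" by linarith
    ultimately have "p \<in> B" using assms(2) by blast
    then show "p \<in> minimizers B w" using p assms(1) unfolding minimizers_def by blast
  qed
qed

text \<open>Any factor above 4 could replace 9: outside the set, points with \<open>norm (fst p) \<ge> 2 * norm w\<close> and
  \<open>snd p \<le> - H\<close> then have power bounded below by a positive multiple of \<open>(norm (fst p))\<^sup>2\<close>.\<close>

definition tail_set :: "real \<Rightarrow> ('a::euclidean_space \<times> real) set" where
  "tail_set H = {p. snd p \<le> - H \<and> (norm (fst p))\<^sup>2 \<le> 9 * (- snd p)}"

text \<open>The bracket bounds the norm \<open>n\<close> of the nucleus, and \<open>H\<close> plus
  its square bounds the depth \<open>- snd p\<close>; the sum does both at once. The term
  \<open>8 * \<bar>t\<bar>\<close> reflects the factor 9 of \<open>tail_set\<close>: far out the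
  squared distance is at least \<open>n\<^sup>2 / 4\<close> while the depth is below
  \<open>n\<^sup>2 / 9\<close>, so \<open>n\<^sup>2\<close> is at most
  \<open>(36 / 5) * t\<close>.\<close>

definition tail_bound :: "real \<Rightarrow> real \<Rightarrow> real \<Rightarrow> real" where
  "tail_bound \<rho> t H = H + (2 * \<rho> + 8 * \<bar>t\<bar> + H + 1) + (2 * \<rho> + 8 * \<bar>t\<bar> + H + 1)\<^sup>2"

lemma pow_ge_of_not_tail:
  assumes "p \<notin> tail_set H" "norm z \<le> r" "0 \<le> H"
  shows "pow z p \<ge> - (H + r\<^sup>2)"
proof (cases "snd p \<le> - H")
  case False
  then show ?thesis unfolding pow_def using zero_le_power2[of "norm (z - fst p)"] zero_le_power2[of r] by linarith
next
  case True
  then have n: "(norm (fst p))\<^sup>2 > 9 * (- snd p)" using assms(1) unfolding tail_set_def by auto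
  have r: "0 \<le> r" using assms(2) norm_ge_zero order_trans by blast
  show ?thesis
  proof (cases "norm (fst p) \<ge> 2 * r")
    case True
    have "norm (fst p) / 2 \<le> norm (z - fst p)"
      using True assms(2) norm_triangle_ineq2[of "fst p" z] by (simp add: norm_minus_commute)
    then have "(norm (fst p) / 2)\<^sup>2 \<le> (norm (z - fst p))\<^sup>2" by (intro power_mono) auto
    then have "(norm (fst p))\<^sup>2 / 4 \<le> (norm (z - fst p))\<^sup>2" by (simp add: power_divide)
    then show ?thesis
      unfolding pow_def using n assms(3) zero_le_power2[of r] zero_le_power2[of "norm (fst p)"] by linarith
  next
    case False
    then have "(norm (fst p))\<^sup>2 \<le> (2 * r)\<^sup>2" by (intro power_mono) auto
    then have "(norm (fst p))\<^sup>2 \<le> 4 * r\<^sup>2" by (simp add: power_mult_distrib)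
    then show ?thesis
      unfolding pow_def using n assms(3) zero_le_power2[of r] zero_le_power2[of "norm (z - fst p)"] by linarith
  qed
qed

lemma bounded_of_not_tail:
  assumes "p \<notin> tail_set H" "norm w \<le> \<rho>" "pow w p \<le> t" "0 \<le> H"
  shows "norm (fst p) \<le> tail_bound \<rho> t H \<and> - tail_bound \<rho> t H \<le> snd p"
proof -
  let ?n = "norm (fst p)" and ?R = "2 * \<rho> + 8 * \<bar>t\<bar> + H + 1"
  have \<rho>: "0 \<le> \<rho>" using assms(2) norm_ge_zero order_trans by blast
  have R: "?R \<ge> 1" using \<rho> assms(4) by linarith
  have le: "(norm (w - fst p))\<^sup>2 + snd p \<le> t" using assms(3) unfolding pow_def .
  have tri: "?n - \<rho> \<le> norm (w - fst p)"
    using assms(2) norm_triangle_ineq2[of "fst p" w] by (simp add: norm_minus_commute)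
  have nR: "?n \<le> ?R \<and> - (H + ?R\<^sup>2) \<le> snd p"
  proof (cases "snd p \<le> - H")
    case False
    have "norm (w - fst p) \<le> \<bar>t\<bar> + H + 1"
    proof (rule ccontr)
      assume "\<not> ?thesis"
      then have a: "norm (w - fst p) > \<bar>t\<bar> + H + 1" by simp
      then have "norm (w - fst p) \<le> (norm (w - fst p))\<^sup>2"
        using assms(4) by (intro self_le_power) auto
      then show False using a le False by linarith
    qed
    then have "?n \<le> ?R" using tri \<rho> by linarith
    moreover have "0 \<le> ?R\<^sup>2" by simp
    ultimately show ?thesis using False by linarith
  next
    case True
    then have n: "?n\<^sup>2 > 9 * (- snd p)" using assms(1) unfolding tail_set_def by auto
    have "?n \<le> ?R"
    proof (cases "?n \<ge> 2 * \<rho>")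
      case True
      then have "?n / 2 \<le> norm (w - fst p)" using tri by linarith
      then have "(?n / 2)\<^sup>2 \<le> (norm (w - fst p))\<^sup>2" by (intro power_mono) auto
      then have "?n\<^sup>2 / 4 \<le> (norm (w - fst p))\<^sup>2" by (simp add: power_divide)
      then have n2: "?n\<^sup>2 \<le> 8 * \<bar>t\<bar>" using n le zero_le_power2[of ?n] by linarith
      show ?thesis
      proof (cases "?n \<le> 1")
        case False
        then have "?n \<le> ?n\<^sup>2" by (intro self_le_power) auto
        then show ?thesis using n2 \<rho> assms(4) by linarith
      qed (use R in linarith)
    qed (use assms(4) in linarith)
    moreover from this have "?n\<^sup>2 \<le> ?R\<^sup>2" by (intro power_mono) auto
    ultimately show ?thesis using n assms(4) zero_le_power2[of ?n] by linarith
  qed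
  then show ?thesis unfolding tail_bound_def using R assms(4) zero_le_power2[of ?R] by linarith
qed

text \<open>A sign pattern is coded by the set \<open>J\<close> of coordinates bounded from below,
  so the orthants are indexed by the finite set \<open>Pow Basis\<close>.\<close>

definition orthant :: "real \<Rightarrow> 'a::euclidean_space set \<Rightarrow> ('a \<times> real) set" where
  "orthant c J = {p. \<forall>i\<in>Basis. if i \<in> J then c \<le> fst p \<bullet> i else fst p \<bullet> i \<le> - c}"

text \<open>If \<open>A\<close> has points of bounded weight in all orthants far out, then the apex \<open>w\<close> of a simplex
  meeting a given ball cannot be far away: the point of \<open>A\<close> in the orthant of \<open>w - z\<close> would
  have smaller power at \<open>w\<close> than the vertices.\<close>

lemma apex_bound:
  fixes B :: "('a::euclidean_space \<times> real) set"
  assumes lower: "\<And>p. p \<in> B \<Longrightarrow> - L \<le> pow z p"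
    and surround: "\<And>J. J \<subseteq> Basis \<Longrightarrow> \<exists>q\<in>B. q \<in> orthant (1 + r) J \<and> norm (fst q) \<le> s \<and> snd q \<le> s"
    and S: "S \<subseteq> minimizers B w" and z: "z \<in> convex hull (fst ` S)" "norm z \<le> r"
  shows "norm w \<le> r + ((r + s)\<^sup>2 + s + L)"
proof -
  let ?u = "w - z"
  have r: "0 \<le> r" using z(2) norm_ge_zero order_trans by blast
  \<comment> \<open>If all vertices lay strictly on the side of \<open>w\<close> as seen from
    \<open>z\<close>, so would their hull, which contains \<open>z\<close>.\<close>
  have "\<exists>p\<in>S. (fst p - z) \<bullet> ?u \<le> 0"
  proof (rule ccontr)
    assume neg: "\<not> ?thesis"
    have "fst ` S \<subseteq> {x. ?u \<bullet> x > ?u \<bullet> z}"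
    proof
      fix x assume "x \<in> fst ` S"
      then have "(x - z) \<bullet> ?u > 0" using neg by (auto simp: not_le)
      moreover have "(x - z) \<bullet> ?u = ?u \<bullet> x - ?u \<bullet> z" by (metis inner_commute inner_diff_right)
      ultimately show "x \<in> {x. ?u \<bullet> x > ?u \<bullet> z}" by simp
    qed
    then have "convex hull (fst ` S) \<subseteq> {x. ?u \<bullet> x > ?u \<bullet> z}"
      by (intro hull_minimal) (auto simp: convex_halfspace_gt)
    then show False using z(1) by auto
  qed
  then obtain p where p: "p \<in> S" "(fst p - z) \<bullet> ?u \<le> 0" by blast
  define J where "J = {i \<in> Basis. ?u \<bullet> i \<ge> 0}"
  have "J \<subseteq> Basis" unfolding J_def by blast
  from surround[OF this] obtain q where q: "q \<in> B" "q \<in> orthant (1 + r) J" "norm (fst q) \<le> s" "snd q \<le> s"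
    by blast
  have pm: "p \<in> B" "pow w p \<le> pow w q" using p(1) S q(1) unfolding minimizers_def by auto
  \<comment> \<open>Expansion around \<open>z\<close>. The term \<open>(norm ?u)\<^sup>2\<close> is
    the same for every point, so a comparison of powers at \<open>w\<close> involves only inner
    products with \<open>?u\<close> and powers at \<open>z\<close>.\<close>
  have e: "pow w x = (norm ?u)\<^sup>2 - 2 * ((fst x - z) \<bullet> ?u) + pow z x" for x
    unfolding pow_def power2_norm_eq_inner by (simp add: algebra_simps inner_commute)
  have 1: "2 * ((fst q - z) \<bullet> ?u) \<le> pow z q - pow z p"
    using pm(2) p(2) unfolding e[of p] e[of q] by linarith
  have 2: "pow z q \<le> (r + s)\<^sup>2 + s"
  proof -
    have "norm (z - fst q) \<le> r + s" using norm_triangle_ineq4[of z "fst q"] z(2) q(3) by linarith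
    then have "(norm (z - fst q))\<^sup>2 \<le> (r + s)\<^sup>2" by (intro power_mono) auto
    then show ?thesis unfolding pow_def using q(4) by linarith
  qed
  \<comment> \<open>The 1 in \<open>1 + r\<close> is what survives: matching signs make
    \<open>fst q \<bullet> ?u\<close> at least \<open>1 + r\<close> times the l1 norm of
    \<open>?u\<close>, and \<open>z\<close> takes back at most \<open>r * norm ?u\<close>.\<close>
  have 3: "norm ?u \<le> (fst q - z) \<bullet> ?u"
  proof -
    have "(1 + r) * \<bar>?u \<bullet> i\<bar> \<le> (fst q \<bullet> i) * (?u \<bullet> i)" if i: "i \<in> Basis" for i
    proof (cases "?u \<bullet> i \<ge> 0")
      case True
      then have "1 + r \<le> fst q \<bullet> i" using q(2) i unfolding orthant_def J_def by auto
      then show ?thesis using True by (simp add: mult_right_mono)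
    next
      case False
      then have "fst q \<bullet> i \<le> - (1 + r)" using q(2) i unfolding orthant_def J_def by (auto dest!: bspec[of Basis _ i])
      then have "(- (1 + r)) * (?u \<bullet> i) \<le> (fst q \<bullet> i) * (?u \<bullet> i)"
        using False by (intro mult_right_mono_neg) auto
      moreover have "(1 + r) * \<bar>?u \<bullet> i\<bar> = (- (1 + r)) * (?u \<bullet> i)"
        using False by (simp only: abs_of_neg not_le mult_minus_right mult_minus_left)
      ultimately show ?thesis by linarith
    qed
    then have "(\<Sum>i\<in>Basis. (1 + r) * \<bar>?u \<bullet> i\<bar>) \<le> (\<Sum>i\<in>Basis. (fst q \<bullet> i) * (?u \<bullet> i))"
      by (rule sum_mono)
    also have "\<dots> = fst q \<bullet> ?u" by (rule euclidean_inner[symmetric])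
    finally have "(1 + r) * (\<Sum>i\<in>Basis. \<bar>?u \<bullet> i\<bar>) \<le> fst q \<bullet> ?u" by (simp only: sum_distrib_left)
    moreover have "(1 + r) * norm ?u \<le> (1 + r) * (\<Sum>i\<in>Basis. \<bar>?u \<bullet> i\<bar>)"
      using r by (intro mult_left_mono norm_le_l1) auto
    moreover have "z \<bullet> ?u \<le> r * norm ?u"
      using norm_cauchy_schwarz[of z ?u] z(2) mult_right_mono[of "norm z" r "norm ?u"] by simp
    ultimately show ?thesis by (simp add: algebra_simps)
  qed
  have "norm ?u \<ge> 0" by simp
  then have "norm ?u \<le> (r + s)\<^sup>2 + s + L" using 1 2 3 lower[OF pm(1)] by linarith
  then show ?thesis using norm_triangle_sub[of w z] z(2) by linarith
qed

section \<open>Measurability of the skeleton of a finite configuration\<close>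

text \<open>The flag \<open>dual\<close> selects one of the two skeletons, so that both are treated at once.  In the
  dual case the apexes \<open>w\<close> are confined to a ball, which makes the witnesses range over a compact
  set.\<close>

definition local_skel :: "bool \<Rightarrow> real \<Rightarrow> ('a::euclidean_space \<times> real) set \<Rightarrow> 'a set" where
  "local_skel dual \<rho> B = {z. \<exists>w S. S \<subseteq> minimizers B w \<and> card S = (if dual then DIM('a) + 1 else 2) \<and>
     (if dual then norm w \<le> \<rho> \<and> (\<exists>p\<in>S. z \<in> convex hull (fst ` (S - {p}))) else w = z)}"

text \<open>Minimality and incidence with a facet are weakened by \<open>\<epsilon>\<close>, which
  makes the condition robust under small moves of the points; \<open>\<epsilon> = 0\<close> is the
  exact statement that \<open>K\<close> is hit.\<close>

definition relaxed_hit ::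
    "bool \<Rightarrow> real \<Rightarrow> 'a set \<Rightarrow> real \<Rightarrow> ('a::euclidean_space \<times> real) set \<Rightarrow> bool" where
  "relaxed_hit dual \<rho> K \<epsilon> B \<longleftrightarrow> (\<exists>S\<subseteq>B. card S = (if dual then DIM('a) + 1 else 2) \<and>
     (\<exists>p\<in>S. \<exists>z\<in>K. \<exists>w.
        (if dual then norm w \<le> \<rho> \<and> infdist z (convex hull (fst ` (S - {p}))) \<le> \<epsilon> else w = z) \<and>
        (\<forall>q\<in>S. \<forall>q'\<in>B. pow w q \<le> pow w q' + \<epsilon>)))"

lemma local_skelI:
  fixes S :: "('a::euclidean_space \<times> real) set"
  assumes "S \<subseteq> minimizers B w" "card S = (if dual then DIM('a) + 1 else 2)"
    "if dual then norm w \<le> \<rho> \<and> (\<exists>p\<in>S. z \<in> convex hull (fst ` (S - {p}))) else w = z"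
  shows "z \<in> local_skel dual \<rho> B"
  unfolding local_skel_def using assms by blast

lemma relaxed_hitI:
  fixes S :: "('a::euclidean_space \<times> real) set"
  assumes "S \<subseteq> B" "card S = (if dual then DIM('a) + 1 else 2)" "p \<in> S" "z \<in> K"
    "if dual then norm w \<le> \<rho> \<and> infdist z (convex hull (fst ` (S - {p}))) \<le> \<epsilon> else w = z"
    "\<forall>q\<in>S. \<forall>q'\<in>B. pow w q \<le> pow w q' + \<epsilon>"
  shows "relaxed_hit dual \<rho> K \<epsilon> B"
  unfolding relaxed_hit_def using assms by blast

lemma relaxed_hit_mono: "relaxed_hit dual \<rho> K \<epsilon> B \<Longrightarrow> \<epsilon> \<le> \<epsilon>' \<Longrightarrow> relaxed_hit dual \<rho> K \<epsilon>' B"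
  unfolding relaxed_hit_def
proof (elim exE bexE conjE, intro exI bexI conjI ballI)
  fix S p z w q q'
  assume "\<epsilon> \<le> \<epsilon>'" "\<forall>q\<in>S. \<forall>q'\<in>B. pow w q \<le> pow w q' + \<epsilon>" "q \<in> S" "q' \<in> B"
  then show "pow w q \<le> pow w q' + \<epsilon>'" by fastforce
qed (auto split: if_splits)

lemma finite_simplex:
  fixes S :: "('a::euclidean_space \<times> real) set"
  assumes "card S = DIM('a) + 1"
  shows "finite S" "p \<in> S \<Longrightarrow> S - {p} \<noteq> {}"
proof -
  show fin: "finite S" using assms by (intro card_ge_0_finite) simp
  assume "p \<in> S"
  then have "card (S - {p}) = DIM('a)" using fin assms by simp
  then show "S - {p} \<noteq> {}" using DIM_positive[where 'a = 'a] by (metis card.empty less_irrefl)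
qed

text \<open>Nonempty facets matter because \<open>infdist\<close> to the empty set is 0, which would
  make the incidence in \<open>relaxed_hit\<close> vacuous.\<close>

lemma simplex_hull:
  fixes S :: "('a::euclidean_space \<times> real) set"
  assumes "card S = DIM('a) + 1" "p \<in> S"
  shows "compact (convex hull (fst ` (S - {p})))" "convex hull (fst ` (S - {p})) \<noteq> {}"
  using finite_simplex[OF assms(1)] assms(2)
  by (simp_all add: finite_imp_compact_convex_hull)

lemma local_skel_hit_iff:
  fixes B :: "('a::euclidean_space \<times> real) set"
  shows "local_skel dual \<rho> B \<inter> K \<noteq> {} \<longleftrightarrow> relaxed_hit dual \<rho> K 0 B"
proof -
  have min: "S \<subseteq> minimizers B w \<longleftrightarrow> S \<subseteq> B \<and> (\<forall>q\<in>S. \<forall>q'\<in>B. pow w q \<le> pow w q' + 0)" for S w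
    unfolding minimizers_def by auto
  have hull: "infdist z (convex hull (fst ` (S - {p}))) \<le> 0 \<longleftrightarrow> z \<in> convex hull (fst ` (S - {p}))"
    if "card S = DIM('a) + 1" "p \<in> S" for S :: "('a \<times> real) set" and z p
    using simplex_hull[OF that] in_closed_iff_infdist_zero[OF compact_imp_closed, of "convex hull (fst ` (S - {p}))" z]
      infdist_nonneg[of z "convex hull (fst ` (S - {p}))"] by force
  show ?thesis
  proof (cases dual)
    case True
    show ?thesis
    proof
      assume "local_skel dual \<rho> B \<inter> K \<noteq> {}"
      then obtain z w S p where *: "z \<in> K" "S \<subseteq> minimizers B w" "card S = DIM('a) + 1" "norm w \<le> \<rho>"
          "p \<in> S" "z \<in> convex hull (fst ` (S - {p}))"
        unfolding local_skel_def using True by auto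
      then show "relaxed_hit dual \<rho> K 0 B"
        using True hull[OF *(3,5), of z] min[of S w] by (intro relaxed_hitI[of S B dual p z K w]) simp_all
    next
      assume "relaxed_hit dual \<rho> K 0 B"
      then obtain z w S p where *: "z \<in> K" "S \<subseteq> B" "card S = DIM('a) + 1" "norm w \<le> \<rho>"
          "p \<in> S" "infdist z (convex hull (fst ` (S - {p}))) \<le> 0" "\<forall>q\<in>S. \<forall>q'\<in>B. pow w q \<le> pow w q' + 0"
        unfolding relaxed_hit_def using True by auto
      then have "S \<subseteq> minimizers B w" "z \<in> convex hull (fst ` (S - {p}))"
        using hull[OF *(3,5)] min[of S w] by auto
      then have "z \<in> local_skel dual \<rho> B" using True *(3,4,5) by (intro local_skelI[of S B w]) auto
      then show "local_skel dual \<rho> B \<inter> K \<noteq> {}" using *(1) by blast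
    qed
  next
    case False
    show ?thesis
    proof
      assume "local_skel dual \<rho> B \<inter> K \<noteq> {}"
      then obtain z S where *: "z \<in> K" "S \<subseteq> minimizers B z" "card S = 2"
        unfolding local_skel_def using False by auto
      then obtain p where "p \<in> S" by (metis card.empty ex_in_conv zero_neq_numeral)
      then show "relaxed_hit dual \<rho> K 0 B"
        using False * min[of S z] by (intro relaxed_hitI[of S B dual p z K z]) simp_all
    next
      assume "relaxed_hit dual \<rho> K 0 B"
      then obtain z S where *: "z \<in> K" "S \<subseteq> B" "card S = 2" "\<forall>q\<in>S. \<forall>q'\<in>B. pow z q \<le> pow z q' + 0"
        unfolding relaxed_hit_def using False by auto
      then have "S \<subseteq> minimizers B z" using min[of S z] by auto
      then have "z \<in> local_skel dual \<rho> B" using False *(3) by (intro local_skelI[of S B z]) auto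
      then show "local_skel dual \<rho> B \<inter> K \<noteq> {}" using *(1) by blast
    qed
  qed
qed

text \<open>A finite union of closed sets: hulls of finitely many points in the dual case, otherwise
  the sets on which a fixed pair \<open>S\<close> minimizes.\<close>

lemma closed_local_skel:
  fixes B :: "('a::euclidean_space \<times> real) set"
  assumes "finite B"
  shows "closed (local_skel dual \<rho> B)"
proof (cases dual)
  case True
  let ?I = "{(S, p). S \<in> Pow B \<and> p \<in> B \<and> p \<in> S \<and> card S = DIM('a) + 1 \<and> (\<exists>w. S \<subseteq> minimizers B w \<and> norm w \<le> \<rho>)}"
  have "local_skel dual \<rho> B = (\<Union>(S, p)\<in>?I. convex hull (fst ` (S - {p})))"
  proof (intro equalityI subsetI)
    fix z assume "z \<in> local_skel dual \<rho> B"
    then obtain w S p where *: "S \<subseteq> minimizers B w" "card S = DIM('a) + 1" "norm w \<le> \<rho>"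
          "p \<in> S" "z \<in> convex hull (fst ` (S - {p}))"
      unfolding local_skel_def using True by auto
    have "S \<subseteq> B" using *(1) minimizers_subset[of B w] by blast
    then have "(S, p) \<in> ?I" using * by blast
    then show "z \<in> (\<Union>(S, p)\<in>?I. convex hull (fst ` (S - {p})))" by (rule UN_I) (simp add: *(5))
  next
    fix z assume "z \<in> (\<Union>(S, p)\<in>?I. convex hull (fst ` (S - {p})))"
    then obtain S p w where *: "S \<subseteq> minimizers B w" "card S = DIM('a) + 1" "norm w \<le> \<rho>"
          "p \<in> S" "z \<in> convex hull (fst ` (S - {p}))" by blast
    then show "z \<in> local_skel dual \<rho> B" using True by (intro local_skelI[of S B w]) auto
  qed
  moreover have "closed (\<Union>(S, p)\<in>?I. convex hull (fst ` (S - {p})))"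
  proof (rule closed_UN)
    show "finite ?I"
      by (rule finite_subset[of _ "Pow B \<times> B"]) (use assms in auto)
    show "\<forall>x\<in>?I. closed (case x of (S, p) \<Rightarrow> convex hull (fst ` (S - {p})))"
    proof
      fix x assume "x \<in> ?I"
      then obtain S p where "x = (S, p)" "card S = DIM('a) + 1" "p \<in> S" by blast
      then show "closed (case x of (S, p) \<Rightarrow> convex hull (fst ` (S - {p})))"
        using compact_imp_closed[OF simplex_hull(1)] by simp
    qed
  qed
  ultimately show ?thesis by simp
next
  case False
  let ?I = "{S \<in> Pow B. card S = 2}"
  have "local_skel dual \<rho> B = (\<Union>S\<in>?I. \<Inter>p\<in>S. \<Inter>q\<in>B. {w. pow w p \<le> pow w q})"
  proof (intro equalityI subsetI)
    fix z assume "z \<in> local_skel dual \<rho> B"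
    then obtain S where "S \<subseteq> minimizers B z" "card S = 2" unfolding local_skel_def using False by auto
    then show "z \<in> (\<Union>S\<in>?I. \<Inter>p\<in>S. \<Inter>q\<in>B. {w. pow w p \<le> pow w q})"
      unfolding minimizers_def by (intro UN_I[of S]) auto
  next
    fix z assume "z \<in> (\<Union>S\<in>?I. \<Inter>p\<in>S. \<Inter>q\<in>B. {w. pow w p \<le> pow w q})"
    then obtain S where "S \<subseteq> B" "card S = 2" "\<forall>p\<in>S. \<forall>q\<in>B. pow z p \<le> pow z q" by auto
    then show "z \<in> local_skel dual \<rho> B"
      using False by (intro local_skelI[of S B z]) (auto simp: minimizers_def)
  qed
  moreover have "closed (\<Union>S\<in>?I. \<Inter>p\<in>S. \<Inter>q\<in>B. {w. pow w p \<le> pow w q})"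
    using assms by (intro closed_UN ballI closed_INT closed_Collect_le continuous_pow) simp
  ultimately show ?thesis by simp
qed

text \<open>A witness has a discrete part \<open>(S, p)\<close> with finitely many values and a part
  \<open>(z, w)\<close> in a compact set. By monotonicity one pair \<open>(S, p)\<close> serves all
  \<open>\<epsilon>\<close>, and the nested compact sets of its \<open>(z, w)\<close> have a common
  point, which satisfies the exact inequalities.\<close>

lemma relaxed_hit_closed:
  fixes B :: "('a::euclidean_space \<times> real) set"
  assumes B: "finite B" and K: "compact K" and hit: "\<And>\<epsilon>. \<epsilon> > 0 \<Longrightarrow> relaxed_hit dual \<rho> K \<epsilon> B"
  shows "relaxed_hit dual \<rho> K 0 B"
proof -
  obtain c where c: "\<And>z. z \<in> K \<Longrightarrow> norm z \<le> c"
    using compact_imp_bounded[OF K] unfolding bounded_iff by blast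
  \<comment> \<open>\<open>X S p \<epsilon>\<close> collects the continuous witnesses. Without
    \<open>dual\<close> the point \<open>w\<close> equals \<open>z\<close>, so the bound
    \<open>c\<close> of \<open>K\<close> keeps it in a ball.\<close>
  define X where "X S p \<epsilon> = {(z, w). z \<in> K \<and> w \<in> cball 0 (if dual then \<rho> else c) \<and> (\<not> dual \<longrightarrow> w = z) \<and>
    (dual \<longrightarrow> infdist z (convex hull (fst ` (S - {p}))) \<le> \<epsilon>) \<and> (\<forall>q\<in>S. \<forall>q'\<in>B. pow w q \<le> pow w q' + \<epsilon>)}"
    for S :: "('a \<times> real) set" and p and \<epsilon> :: real
  let ?I = "{(S, p). S \<subseteq> B \<and> card S = (if dual then DIM('a) + 1 else 2) \<and> p \<in> S}"
  have hit_iff: "relaxed_hit dual \<rho> K \<epsilon> B \<longleftrightarrow> (\<exists>(S, p)\<in>?I. X S p \<epsilon> \<noteq> {})" for \<epsilon>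
  proof
    assume "relaxed_hit dual \<rho> K \<epsilon> B"
    then obtain S p z w where S: "S \<subseteq> B" "card S = (if dual then DIM('a) + 1 else 2)" "p \<in> S" "z \<in> K"
      "if dual then norm w \<le> \<rho> \<and> infdist z (convex hull (fst ` (S - {p}))) \<le> \<epsilon> else w = z"
      "\<forall>q\<in>S. \<forall>q'\<in>B. pow w q \<le> pow w q' + \<epsilon>"
      unfolding relaxed_hit_def by blast
    then have "(z, w) \<in> X S p \<epsilon>" unfolding X_def using c by (auto split: if_splits)
    moreover have "(S, p) \<in> ?I" using S(1-3) by blast
    moreover have "X S p \<epsilon> \<noteq> {}" using calculation(1) by blast
    ultimately show "\<exists>(S, p)\<in>?I. X S p \<epsilon> \<noteq> {}" by (intro bexI[of _ "(S, p)"]) simp_all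
  next
    assume "\<exists>(S, p)\<in>?I. X S p \<epsilon> \<noteq> {}"
    then obtain x where x: "x \<in> ?I" "case x of (S, p) \<Rightarrow> X S p \<epsilon> \<noteq> {}" by (rule bexE)
    obtain S p where "x = (S, p)" by (cases x)
    with x have S: "S \<subseteq> B" "card S = (if dual then DIM('a) + 1 else 2)" "p \<in> S" and "X S p \<epsilon> \<noteq> {}"
      by simp_all
    then obtain z w where "(z, w) \<in> X S p \<epsilon>" by (metis ex_in_conv surj_pair)
    with S show "relaxed_hit dual \<rho> K \<epsilon> B"
      unfolding X_def by (intro relaxed_hitI[of S B dual p z K w]) (auto split: if_splits)
  qed
  have fin: "finite ?I" by (rule finite_subset[of _ "Pow B \<times> B"]) (use B in auto)
  have mono: "X S p \<epsilon> \<subseteq> X S p \<epsilon>'" if "\<epsilon> \<le> \<epsilon>'" for S p \<epsilon> \<epsilon>'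
  proof
    fix x assume "x \<in> X S p \<epsilon>"
    moreover have "a \<le> b + \<epsilon>'" if "a \<le> b + \<epsilon>" for a b using that \<open>\<epsilon> \<le> \<epsilon>'\<close> by linarith
    moreover have "a \<le> \<epsilon>'" if "a \<le> \<epsilon>" for a using that \<open>\<epsilon> \<le> \<epsilon>'\<close> by linarith
    ultimately show "x \<in> X S p \<epsilon>'" unfolding X_def by blast
  qed
  let ?e = "\<lambda>k::nat. inverse (real (Suc k))"
  have emono: "?e k' \<le> ?e k" if "k \<le> k'" for k k' using that by (simp add: field_simps)
  have "\<exists>(S, p)\<in>?I. \<forall>k. X S p (?e k) \<noteq> {}"
  proof (rule ccontr)
    assume "\<not> ?thesis"
    then have "\<forall>x\<in>?I. \<exists>k. X (fst x) (snd x) (?e k) = {}" by (auto simp: case_prod_beta)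
    from bchoice[OF this] obtain k where k: "\<forall>x\<in>?I. X (fst x) (snd x) (?e (k x)) = {}" ..
    \<comment> \<open>If every pair failed from some index on, all would fail at the largest of
      these indices, against \<open>hit\<close>.\<close>
    let ?k = "Max (insert 0 (k ` ?I))"
    have "X (fst x) (snd x) (?e ?k) = {}" if "x \<in> ?I" for x
    proof -
      have "k x \<le> ?k" using fin that by (intro Max_ge) auto
      then have "X (fst x) (snd x) (?e ?k) \<subseteq> X (fst x) (snd x) (?e (k x))" by (intro mono emono)
      then show ?thesis using k that by blast
    qed
    moreover have "?e ?k > 0" by simp
    ultimately show False using hit[of "?e ?k"] unfolding hit_iff by (auto simp: case_prod_beta)
  qed
  then obtain x0 where x0: "x0 \<in> ?I" "case x0 of (S, p) \<Rightarrow> \<forall>k. X S p (?e k) \<noteq> {}" by (rule bexE)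
  obtain S p where "x0 = (S, p)" by (cases x0)
  with x0 have Sp: "(S, p) \<in> ?I" "\<And>k. X S p (?e k) \<noteq> {}" by simp_all
  have "\<Inter>(range (\<lambda>k. X S p (?e k))) \<noteq> {}"
  proof (rule compact_nest)
    fix k
    let ?C = "K \<times> cball (0 :: 'a) (if dual then \<rho> else c)"
    have eq: "X S p (?e k) = ?C \<inter> ({x. \<not> dual \<longrightarrow> snd x = fst x} \<inter>
      {x. dual \<longrightarrow> infdist (fst x) (convex hull (fst ` (S - {p}))) \<le> ?e k} \<inter>
      (\<Inter>q\<in>S. \<Inter>q'\<in>B. {x. pow (snd x) q \<le> pow (snd x) q' + ?e k}))"
      unfolding X_def by auto
    have cont: "continuous_on UNIV (\<lambda>x::'a \<times> 'a. pow (snd x) q)" for q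
      unfolding pow_def by (intro continuous_intros)
    have "compact ?C" using K by (intro compact_Times) auto
    moreover have "closed {x::'a \<times> 'a. \<not> dual \<longrightarrow> snd x = fst x}"
      by (intro closed_Collect_imp) (auto intro!: closed_Collect_eq continuous_intros)
    moreover have "closed {x::'a \<times> 'a. dual \<longrightarrow> infdist (fst x) (convex hull (fst ` (S - {p}))) \<le> ?e k}"
      by (intro closed_Collect_imp) (auto intro!: closed_Collect_le continuous_intros)
    moreover have "closed (\<Inter>q\<in>S. \<Inter>q'\<in>B. {x::'a \<times> 'a. pow (snd x) q \<le> pow (snd x) q' + ?e k})"
      by (intro closed_INT ballI closed_Collect_le continuous_intros cont)
    ultimately show "compact (X S p (?e k))"
      unfolding eq by (intro compact_Int_closed closed_Int)
    show "X S p (?e k) \<noteq> {}" by (rule Sp)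
  next
    fix k k' :: nat assume "k \<le> k'"
    then show "X S p (?e k') \<subseteq> X S p (?e k)" by (intro mono emono)
  qed
  then obtain x where x: "\<And>k. x \<in> X S p (?e k)" by blast
  have lim0: "a \<le> b" if "\<And>k. a \<le> b + ?e k" for a b :: real
  proof -
    have "(\<lambda>k. b + ?e k) \<longlonglongrightarrow> b + 0" by (intro tendsto_intros LIMSEQ_inverse_real_of_nat)
    then show ?thesis using that by (intro LIMSEQ_le_const[of "\<lambda>k. b + ?e k" b a]) auto
  qed
  have "x \<in> X S p 0"
    unfolding X_def case_prod_beta
  proof (intro CollectI conjI impI ballI)
    note x' = x[unfolded X_def case_prod_beta mem_Collect_eq]
    show "fst x \<in> K" "snd x \<in> cball 0 (if dual then \<rho> else c)" using x' by blast+
    show "snd x = fst x" if "\<not> dual" using x' that by blast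
    show "infdist (fst x) (convex hull (fst ` (S - {p}))) \<le> 0" if dual
    proof (rule lim0)
      fix k show "infdist (fst x) (convex hull (fst ` (S - {p}))) \<le> 0 + ?e k" using x'[of k] that by simp
    qed
    fix q q' assume "q \<in> S" "q' \<in> B"
    then have "pow (snd x) q \<le> pow (snd x) q' + ?e k" for k
      using x'[of k] by blast
    then have "pow (snd x) q \<le> pow (snd x) q'" by (rule lim0)
    then show "pow (snd x) q \<le> pow (snd x) q' + 0" by simp
  qed
  then have "X S p 0 \<noteq> {}" by blast
  with Sp(1) show ?thesis unfolding hit_iff by (intro bexI[of _ "(S, p)"]) simp_all
qed

text \<open>The sum of a convex hull and a ball is convex, so it contains the hull of the moved
  points as soon as it contains these points.\<close>

lemma hull_perturb:
  fixes V :: "'i set" and f g :: "'i \<Rightarrow> 'a::euclidean_space"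
  assumes V: "finite V" "V \<noteq> {}" and d: "\<And>i. i \<in> V \<Longrightarrow> norm (f i - g i) \<le> \<eta>"
  shows "infdist z (convex hull (g ` V)) \<le> infdist z (convex hull (f ` V)) + \<eta>"
proof -
  let ?T = "\<Union>x\<in>convex hull (g ` V). \<Union>y\<in>cball 0 \<eta>. {x + y}"
  have "convex ?T" by (rule convex_sums) (auto simp: convex_convex_hull)
  moreover have "f ` V \<subseteq> ?T"
  proof
    fix x assume "x \<in> f ` V"
    then obtain i where i: "i \<in> V" "x = f i" by blast
    have "g i \<in> convex hull (g ` V)" using i(1) by (intro hull_inc) blast
    moreover have "f i - g i \<in> cball 0 \<eta>" using d[OF i(1)] by simp
    moreover have "x = g i + (f i - g i)" using i(2) by simp
    ultimately show "x \<in> ?T" by blast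
  qed
  ultimately have sub: "convex hull (f ` V) \<subseteq> ?T" by (simp add: subset_hull)
  have "compact (convex hull (f ` V))" "convex hull (f ` V) \<noteq> {}"
    using V by (simp_all add: finite_imp_compact_convex_hull)
  then obtain y where y: "y \<in> convex hull (f ` V)" "infdist z (convex hull (f ` V)) = dist z y"
    using infdist_attains_inf[of "convex hull (f ` V)" z] by (metis compact_imp_closed)
  obtain x u where xu: "x \<in> convex hull (g ` V)" "norm u \<le> \<eta>" "y = x + u" using y(1) sub by auto
  have "infdist z (convex hull (g ` V)) \<le> dist z x" using xu(1) by (rule infdist_le)
  also have "\<dots> \<le> dist z y + dist y x" by (rule dist_triangle)
  also have "dist y x = norm u" unfolding xu(3) by (simp add: dist_norm)
  finally show ?thesis using xu(2) y(2) by linarith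
qed

text \<open>A difference of squares is at most \<open>\<eta>\<close> times the sum of two distances,
  that is \<open>2 * \<rho> + 2 * c + 1\<close>; the height contributes one more
  \<open>\<eta>\<close>.\<close>

lemma pow_perturb:
  fixes p p' :: "'a::euclidean_space \<times> real"
  assumes "norm (p' - p) \<le> \<eta>" "\<eta> \<le> 1" "norm w \<le> \<rho>" "norm p \<le> c"
  shows "\<bar>pow w p' - pow w p\<bar> \<le> (2 * \<rho> + 2 * c + 2) * \<eta>"
proof -
  let ?a = "norm (w - fst p')" and ?b = "norm (w - fst p)"
  have nf: "norm (fst q) \<le> norm q" and ns: "norm (snd q) \<le> norm q" for q :: "'a \<times> real"
    using norm_fst_le[of "fst q" "snd q"] norm_snd_le[of "snd q" "fst q"] by simp_all
  have 1: "norm (fst p' - fst p) \<le> \<eta>" "\<bar>snd p' - snd p\<bar> \<le> \<eta>"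
    using nf[of "p' - p"] ns[of "p' - p"] assms(1) by simp_all
  have \<eta>: "0 \<le> \<eta>" using assms(1) norm_ge_zero order_trans by blast
  have b: "?b \<le> \<rho> + c" using norm_triangle_ineq4[of w "fst p"] assms(3,4) nf[of p] by linarith
  have ab: "\<bar>?a - ?b\<bar> \<le> \<eta>"
    using norm_triangle_ineq3[of "w - fst p'" "w - fst p"] 1(1) by (simp add: norm_minus_commute)
  then have a: "?a \<le> \<rho> + c + 1" using b assms(2) by linarith
  have "\<bar>?a\<^sup>2 - ?b\<^sup>2\<bar> = \<bar>?a - ?b\<bar> * (?a + ?b)"
    by (simp add: power2_eq_square abs_mult square_diff_square_factored mult.commute)
  also have "\<dots> \<le> \<eta> * (2 * \<rho> + 2 * c + 1)" using ab a b \<eta> by (intro mult_mono) auto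
  finally have "\<bar>?a\<^sup>2 - ?b\<^sup>2\<bar> \<le> \<eta> * (2 * \<rho> + 2 * c + 1)" .
  then show ?thesis unfolding pow_def using 1(2) by (simp add: algebra_simps)
qed

text \<open>The witnesses \<open>z\<close> and \<open>w\<close> are kept and only the points move.
  Injectivity preserves the cardinality of \<open>S\<close>, the factor 2 accounts for the two
  powers in each inequality, and \<open>K \<subseteq> cball 0 \<rho>\<close> bounds \<open>w\<close>
  also when it equals \<open>z\<close>.\<close>

lemma relaxed_hit_perturb:
  fixes B :: "('a::euclidean_space \<times> real) set"
  assumes inj: "inj_on \<pi> B" and d: "\<And>p. p \<in> B \<Longrightarrow> norm (\<pi> p - p) \<le> \<eta>" and \<eta>: "0 \<le> \<eta>" "\<eta> \<le> 1"
    and c: "\<And>p. p \<in> B \<Longrightarrow> norm p \<le> c" and K: "K \<subseteq> cball 0 \<rho>"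
    and hit: "relaxed_hit dual \<rho> K \<epsilon> B"
  shows "relaxed_hit dual \<rho> K (\<epsilon> + 2 * (2 * \<rho> + 2 * c + 2) * \<eta>) (\<pi> ` B)"
proof -
  let ?k = "if dual then DIM('a) + 1 else 2" and ?e = "\<epsilon> + 2 * (2 * \<rho> + 2 * c + 2) * \<eta>"
  obtain S p z w where S: "S \<subseteq> B" "card S = ?k" "p \<in> S" "z \<in> K"
      "if dual then norm w \<le> \<rho> \<and> infdist z (convex hull (fst ` (S - {p}))) \<le> \<epsilon> else w = z"
      "\<forall>q\<in>S. \<forall>q'\<in>B. pow w q \<le> pow w q' + \<epsilon>"
    using hit unfolding relaxed_hit_def by blast
  have w: "norm w \<le> \<rho>" using S(4,5) K by (auto split: if_splits)
  have \<rho>: "0 \<le> \<rho>" using w norm_ge_zero order_trans by blast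
  have c0: "0 \<le> c" using c[of p] S(1,3) norm_ge_zero order_trans by blast
  have injS: "inj_on \<pi> S" using inj S(1) by (rule inj_on_subset)
  have "\<pi> ` S \<subseteq> \<pi> ` B" "\<pi> p \<in> \<pi> ` S" using S by auto
  moreover have "card (\<pi> ` S) = ?k" using injS S(2) by (simp add: card_image)
  moreover have "if dual then norm w \<le> \<rho> \<and> infdist z (convex hull (fst ` (\<pi> ` S - {\<pi> p}))) \<le> ?e else w = z"
  proof (cases dual)
    case True
    have img: "\<pi> ` S - {\<pi> p} = \<pi> ` (S - {p})"
      using inj_on_image_set_diff[OF injS, of S "{p}"] S(3) by simp
    have "norm (fst q - fst (\<pi> q)) \<le> \<eta>" if "q \<in> S - {p}" for q
    proof -
      have "norm (fst (\<pi> q - q)) \<le> norm (\<pi> q - q)" by (metis norm_fst_le surjective_pairing)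
      then show ?thesis using d[of q] that S(1) by (auto simp: norm_minus_commute)
    qed
    then have "infdist z (convex hull ((\<lambda>q. fst (\<pi> q)) ` (S - {p}))) \<le>
        infdist z (convex hull (fst ` (S - {p}))) + \<eta>"
      using finite_simplex(1)[of S] finite_simplex(2)[of S p] S(2,3) True by (intro hull_perturb) auto
    moreover have "\<eta> \<le> 2 * (2 * \<rho> + 2 * c + 2) * \<eta>"
      using mult_right_mono[of 1 "2 * (2 * \<rho> + 2 * c + 2)" \<eta>] \<rho> c0 \<eta>(1) by simp
    ultimately show ?thesis unfolding img using S(5) True by (simp add: image_image)
  next
    case False
    then show ?thesis using S(5) by simp
  qed
  moreover have "\<forall>q\<in>\<pi> ` S. \<forall>q'\<in>\<pi> ` B. pow w q \<le> pow w q' + ?e"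
  proof (intro ballI)
    fix q q' assume "q \<in> \<pi> ` S" "q' \<in> \<pi> ` B"
    then obtain x x' where x: "q = \<pi> x" "x \<in> S" "q' = \<pi> x'" "x' \<in> B" by blast
    have "\<bar>pow w q - pow w x\<bar> \<le> (2 * \<rho> + 2 * c + 2) * \<eta>" "\<bar>pow w q' - pow w x'\<bar> \<le> (2 * \<rho> + 2 * c + 2) * \<eta>"
      unfolding x(1,3) using x(2,4) S(1) w \<eta> by (auto simp del: split_paired_All intro!: pow_perturb d c)
    moreover have "pow w x \<le> pow w x' + \<epsilon>" using S(6) x by blast
    ultimately show "pow w q \<le> pow w q' + ?e" by linarith
  qed
  ultimately show ?thesis unfolding relaxed_hit_def using S(4) by blast
qed


section \<open>Rounding to grids\<close>

definition grid_round :: "real \<Rightarrow> 'a::euclidean_space \<Rightarrow> 'a" where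
  "grid_round q x = (\<Sum>i\<in>Basis. (real_of_int \<lfloor>q * (x \<bullet> i)\<rfloor> / q) *\<^sub>R i)"

lemma grid_round_inner: "i \<in> Basis \<Longrightarrow> grid_round q x \<bullet> i = real_of_int \<lfloor>q * (x \<bullet> i)\<rfloor> / q"
  unfolding grid_round_def by simp

lemma norm_grid_round_diff:
  fixes x :: "'a::euclidean_space"
  assumes "q > 0"
  shows "norm (grid_round q x - x) \<le> real DIM('a) / q"
proof -
  have "norm (grid_round q x - x) \<le> (\<Sum>i\<in>Basis. \<bar>(grid_round q x - x) \<bullet> i\<bar>)" by (rule norm_le_l1)
  also have "\<dots> \<le> (\<Sum>i\<in>(Basis::'a set). 1 / q)"
  proof (intro sum_mono)
    fix i :: 'a assume i: "i \<in> Basis"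
    have "(grid_round q x - x) \<bullet> i = (real_of_int \<lfloor>q * (x \<bullet> i)\<rfloor> - q * (x \<bullet> i)) / q"
      using assms by (simp add: inner_diff_left grid_round_inner[OF i] field_simps)
    moreover have "\<bar>real_of_int \<lfloor>q * (x \<bullet> i)\<rfloor> - q * (x \<bullet> i)\<bar> \<le> 1" by linarith
    ultimately show "\<bar>(grid_round q x - x) \<bullet> i\<bar> \<le> 1 / q"
      using assms by (simp add: divide_right_mono)
  qed
  also have "\<dots> = real DIM('a) / q" by simp
  finally show ?thesis .
qed

lemma grid_round_image:
  fixes X :: "'a::euclidean_space set"
  assumes q: "q > 0" and X: "\<And>x. x \<in> X \<Longrightarrow> norm x \<le> c"
  shows "finite (grid_round q ` X)"
    and "card (grid_round q ` X) \<le> nat (2 * \<lceil>q * c\<rceil> + 3) ^ DIM('a)"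
proof -
  \<comment> \<open>The floors in question lie between \<open>- ?m\<close> and \<open>?m\<close>, an
    interval with \<open>2 * ?m + 1 = 2 * \<lceil>q * c\<rceil> + 3\<close> integers. Finiteness
    will serve measurability, the count a union bound over grid points.\<close>
  let ?m = "\<lceil>q * c\<rceil> + 1"
  let ?P = "(Basis :: 'a set) \<rightarrow>\<^sub>E {- ?m..?m}"
  let ?f = "\<lambda>k::'a \<Rightarrow> int. \<Sum>i\<in>Basis. (real_of_int (k i) / q) *\<^sub>R i"
  have sub: "grid_round q ` X \<subseteq> ?f ` ?P"
  proof
    fix y assume "y \<in> grid_round q ` X"
    then obtain x where x: "x \<in> X" "y = grid_round q x" by blast
    let ?k = "restrict (\<lambda>i. \<lfloor>q * (x \<bullet> i)\<rfloor>) Basis"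
    have "?k \<in> ?P"
    proof (rule restrict_PiE_iff[THEN iffD2], intro ballI)
      fix i :: 'a assume i: "i \<in> Basis"
      have "\<bar>x \<bullet> i\<bar> \<le> c" using Basis_le_norm[OF i, of x] X[OF x(1)] by linarith
      then have "\<bar>q * (x \<bullet> i)\<bar> \<le> q * c" using q by (simp add: abs_mult)
      then show "\<lfloor>q * (x \<bullet> i)\<rfloor> \<in> {- ?m..?m}" by simp linarith
    qed
    moreover have "y = ?f ?k" unfolding x(2) grid_round_def by (intro sum.cong) auto
    ultimately show "y \<in> ?f ` ?P" by blast
  qed
  have fin: "finite ?P" by (intro finite_PiE) auto
  show "finite (grid_round q ` X)" by (rule finite_subset[OF sub finite_imageI[OF fin]])
  have "card (grid_round q ` X) \<le> card (?f ` ?P)"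
    by (rule card_mono[OF finite_imageI[OF fin] sub])
  also have "\<dots> \<le> card ?P" using fin by (rule card_image_le)
  also have "\<dots> = card {- ?m..?m} ^ DIM('a)" by (simp add: card_PiE)
  also have "card {- ?m..?m} = nat (2 * \<lceil>q * c\<rceil> + 3)" by simp
  finally show "card (grid_round q ` X) \<le> nat (2 * \<lceil>q * c\<rceil> + 3) ^ DIM('a)" .
qed

lemma grid_round_measurable [measurable]: "grid_round q \<in> borel_measurable borel"
  unfolding grid_round_def by measurable

text \<open>Roundings converge to the points themselves, so two distinct points are eventually
  separated; a finite set involves finitely many pairs.\<close>

lemma inj_on_grid_round_eventually:
  fixes X :: "'a::euclidean_space set"
  assumes "finite X"
  shows "\<forall>\<^sub>F n in sequentially. inj_on (grid_round (2 ^ n)) X"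
proof -
  have lim: "(\<lambda>n. grid_round (2 ^ n) x) \<longlonglongrightarrow> x" for x :: 'a
  proof (rule LIM_zero_iff[THEN iffD1], rule Lim_null_comparison)
    show "\<forall>\<^sub>F n in sequentially. norm (grid_round (2 ^ n) x - x) \<le> real DIM('a) * (1 / 2) ^ n"
      using norm_grid_round_diff[of "2 ^ _" x] by (intro always_eventually) (simp add: power_divide)
    have "(\<lambda>n. real DIM('a) * (1 / 2) ^ n) \<longlonglongrightarrow> real DIM('a) * 0"
      by (intro tendsto_intros LIMSEQ_power_zero) simp
    then show "(\<lambda>n. real DIM('a) * (1 / 2) ^ n) \<longlonglongrightarrow> 0" by simp
  qed
  have "\<forall>\<^sub>F n in sequentially. grid_round (2 ^ n) x \<noteq> grid_round (2 ^ n) y" if "x \<noteq> y" for x y :: 'a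
  proof -
    have "(\<lambda>n. grid_round (2 ^ n) x - grid_round (2 ^ n) y) \<longlonglongrightarrow> x - y" by (intro tendsto_diff lim)
    then have "\<forall>\<^sub>F n in sequentially. grid_round (2 ^ n) x - grid_round (2 ^ n) y \<noteq> 0"
      using that by (intro tendsto_imp_eventually_ne) auto
    then show ?thesis by eventually_elim auto
  qed
  then have "\<forall>\<^sub>F n in sequentially. \<forall>x\<in>X. \<forall>y\<in>X. x \<noteq> y \<longrightarrow> grid_round (2 ^ n) x \<noteq> grid_round (2 ^ n) y"
    using assms by (intro eventually_ball_finite ballI) auto
  then show ?thesis by eventually_elim (auto simp: inj_on_def)
qed

text \<open>For a finite configuration and a fine grid the rounding is injective, and the condition is
  stable under small perturbations up to an increase of \<open>\<epsilon>\<close>; rounded configurations are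
  described by countably many hitting events.\<close>

lemma relaxed_hit_iff_grid:
  fixes B :: "('a::euclidean_space \<times> real) set"
  assumes B: "finite B" and K: "compact K" "K \<subseteq> cball 0 \<rho>"
  shows "relaxed_hit dual \<rho> K 0 B \<longleftrightarrow>
    (\<forall>k::nat. \<exists>N. \<forall>n\<ge>N. relaxed_hit dual \<rho> K (1 / real (Suc k)) (grid_round (2 ^ n) ` B))"
proof -
  obtain c where c: "\<And>p. p \<in> B \<Longrightarrow> norm p \<le> c" "c \<ge> 0"
    using finite_imp_bounded[OF B] unfolding bounded_iff by (metis norm_ge_zero order_trans linear)
  have c': "norm p \<le> c + 1" if "p \<in> B" for p using c(1)[OF that] by simp
  let ?D = "real DIM('a \<times> real)"
  define b where "b n = ?D / 2 ^ n" for n :: nat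
  \<comment> \<open>The radius \<open>c + 1\<close> instead of \<open>c\<close> bounds the rounded
    points as well, so the perturbation estimate can be used in both directions.\<close>
  define C where "C = 2 * (2 * \<rho> + 2 * (c + 1) + 2)"
  have b0: "0 \<le> b n" for n unfolding b_def by simp
  have blim: "b \<longlonglongrightarrow> 0"
  proof -
    have "(\<lambda>n. ?D * (1 / 2) ^ n) \<longlonglongrightarrow> ?D * 0"
      by (intro tendsto_intros LIMSEQ_power_zero) simp
    then show ?thesis unfolding b_def by (simp add: power_divide)
  qed
  have bd: "norm (grid_round (2 ^ n) p - p) \<le> b n" for n and p :: "'a \<times> real"
    unfolding b_def by (rule norm_grid_round_diff) simp
  have b1: "\<forall>\<^sub>F n in sequentially. b n < 1" using blim by (rule order_tendstoD) simp
  have bC: "\<forall>\<^sub>F n in sequentially. C * b n < e" if "e > 0" for e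
  proof -
    have "(\<lambda>n. C * b n) \<longlonglongrightarrow> C * 0" by (intro tendsto_intros blim)
    then show ?thesis using that by (intro order_tendstoD) auto
  qed
  have ev: "\<forall>\<^sub>F n in sequentially. inj_on (grid_round (2 ^ n)) B \<and> b n < 1 \<and> C * b n < e" if "e > 0" for e
    using inj_on_grid_round_eventually[OF B] b1 bC[OF that] by eventually_elim simp
  show ?thesis
  proof
    assume hit: "relaxed_hit dual \<rho> K 0 B"
    show "\<forall>k::nat. \<exists>N. \<forall>n\<ge>N. relaxed_hit dual \<rho> K (1 / real (Suc k)) (grid_round (2 ^ n) ` B)"
    proof
      fix k :: nat
      have "\<forall>\<^sub>F n in sequentially. relaxed_hit dual \<rho> K (1 / real (Suc k)) (grid_round (2 ^ n) ` B)"
        using ev[of "1 / real (Suc k)", simplified]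
      proof eventually_elim
        case (elim n)
        have "relaxed_hit dual \<rho> K (0 + C * b n) (grid_round (2 ^ n) ` B)"
          unfolding C_def
          by (rule relaxed_hit_perturb[OF _ bd b0 _ c' K(2) hit]) (use elim in auto)
        then show ?case by (rule relaxed_hit_mono) (use elim in simp)
      qed
      then show "\<exists>N. \<forall>n\<ge>N. relaxed_hit dual \<rho> K (1 / real (Suc k)) (grid_round (2 ^ n) ` B)"
        unfolding eventually_sequentially .
    qed
  next
    assume grid: "\<forall>k::nat. \<exists>N. \<forall>n\<ge>N. relaxed_hit dual \<rho> K (1 / real (Suc k)) (grid_round (2 ^ n) ` B)"
    show "relaxed_hit dual \<rho> K 0 B"
    proof (rule relaxed_hit_closed[OF B K(1)])
      fix e :: real assume e: "e > 0"
      obtain k :: nat where k: "1 / real (Suc k) < e / 2"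
        using e nat_approx_posE[of "e / 2"] by auto
      have "\<forall>\<^sub>F n in sequentially. relaxed_hit dual \<rho> K (1 / real (Suc k)) (grid_round (2 ^ n) ` B)"
        using grid unfolding eventually_sequentially by blast
      moreover have "\<forall>\<^sub>F n in sequentially. inj_on (grid_round (2 ^ n)) B \<and> b n < 1 \<and> C * b n < e / 2"
        using e by (intro ev) simp
      ultimately have "\<forall>\<^sub>F n in sequentially. relaxed_hit dual \<rho> K e B"
      proof eventually_elim
        case (elim n)
        let ?g = "grid_round (2 ^ n) :: 'a \<times> real \<Rightarrow> 'a \<times> real"
        \<comment> \<open>Backwards, the inverse of the rounding is itself a small injective
          perturbation, taking the rounded configuration to \<open>B\<close>.\<close>
        have inv: "the_inv_into B ?g (?g p) = p" if "p \<in> B" for p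
          using elim that by (simp add: the_inv_into_f_f)
        have "relaxed_hit dual \<rho> K (1 / real (Suc k) + C * b n) (the_inv_into B ?g ` ?g ` B)"
          unfolding C_def
        proof (rule relaxed_hit_perturb[OF _ _ b0])
          show "inj_on (the_inv_into B ?g) (?g ` B)" using elim by (intro inj_on_the_inv_into) simp
          show "norm (the_inv_into B ?g p - p) \<le> b n" if "p \<in> ?g ` B" for p
            using that inv bd by (auto simp: norm_minus_commute)
          show "norm p \<le> c + 1" if p: "p \<in> ?g ` B" for p
          proof -
            obtain x where x: "x \<in> B" "p = ?g x" using p by blast
            have "norm p \<le> norm x + norm (?g x - x)" unfolding x(2) by (metis norm_triangle_sub)
            then show ?thesis using c(1)[OF x(1)] bd[of n x] elim by linarith
          qed
        qed (use elim K in auto)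
        moreover have "the_inv_into B ?g ` ?g ` B = B" using inv by force
        ultimately have "relaxed_hit dual \<rho> K (1 / real (Suc k) + C * b n) B" by simp
        then show ?case by (rule relaxed_hit_mono) (use elim k in simp)
      qed
      then show "relaxed_hit dual \<rho> K e B" by simp
    qed
  qed
qed

text \<open>A rounded configuration is the set of occupied grid cells, and a bounded window meets
  finitely many cells; so an arbitrary predicate \<open>P\<close> of it depends on finitely many
  hits.\<close>

lemma grid_predicate_in_config_space:
  fixes W :: "'b::euclidean_space set"
  assumes W: "W \<in> sets borel" "bounded W"
  shows "{A. P (grid_round (2 ^ n) ` (A \<inter> W))} \<in> sets (config_space W)"
proof (rule finitely_determined_in_config_space)
  let ?g = "grid_round (2 ^ n) :: 'b \<Rightarrow> 'b"
  let ?B = "\<lambda>y. W \<inter> ?g -` {y}"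
  obtain c where c: "\<And>x. x \<in> W \<Longrightarrow> norm x \<le> c" using W(2) unfolding bounded_iff by blast
  have fin: "finite (?g ` W)" by (rule grid_round_image(1)[OF _ c]) simp_all
  have img: "?g ` (A \<inter> W) = {y \<in> ?g ` W. A \<inter> ?B y \<noteq> {}}" for A
  proof (intro equalityI subsetI)
    fix y assume "y \<in> ?g ` (A \<inter> W)"
    then obtain x where "x \<in> A" "x \<in> W" "y = ?g x" by blast
    then show "y \<in> {y \<in> ?g ` W. A \<inter> ?B y \<noteq> {}}" by auto
  next
    fix y assume "y \<in> {y \<in> ?g ` W. A \<inter> ?B y \<noteq> {}}"
    then obtain x where "x \<in> A" "x \<in> W" "?g x = y" by auto
    then show "y \<in> ?g ` (A \<inter> W)" by blast
  qed
  define \<I> where "\<I> = ?B ` ?g ` W"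
  have "finite \<I>" using fin unfolding \<I>_def by simp
  moreover have "\<forall>B\<in>\<I>. B \<in> sets borel \<and> B \<subseteq> W"
  proof
    fix B assume "B \<in> \<I>"
    then obtain y where y: "B = ?B y" unfolding \<I>_def by blast
    have "?g -` {y} \<in> sets borel"
      using measurable_sets[OF grid_round_measurable, of "{y}" "2 ^ n"] by simp
    then show "B \<in> sets borel \<and> B \<subseteq> W" unfolding y using W(1) by auto
  qed
  moreover have "P (?g ` (A' \<inter> W))"
    if a: "\<forall>B\<in>\<I>. A \<inter> B \<noteq> {} \<longleftrightarrow> A' \<inter> B \<noteq> {}" and P: "P (?g ` (A \<inter> W))" for A A'
  proof -
    have "A \<inter> ?B y \<noteq> {} \<longleftrightarrow> A' \<inter> ?B y \<noteq> {}" if y: "y \<in> ?g ` W" for y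
    proof -
      have "?B y \<in> \<I>" unfolding \<I>_def by (rule imageI[OF y])
      from bspec[OF a this] show ?thesis .
    qed
    then have "?g ` (A \<inter> W) = ?g ` (A' \<inter> W)" unfolding img by (intro Collect_cong conj_cong refl)
    then show ?thesis using P by simp
  qed
  ultimately show "finitely_determined W {A. P (?g ` (A \<inter> W))}"
    unfolding finitely_determined_def mem_Collect_eq by (intro exI[of _ \<I>] conjI allI impI)
qed

text \<open>Finiteness is equivalent to a bound on the number of occupied cells that is uniform in
  the mesh, because any \<open>m + 1\<close> points are separated by a sufficiently fine
  grid.\<close>

lemma finite_in_config_space:
  fixes W :: "'b::euclidean_space set"
  assumes W: "W \<in> sets borel" "bounded W"
  shows "{A. finite (A \<inter> W)} \<in> sets (config_space W)"
proof -
  obtain c where c: "\<And>x. x \<in> W \<Longrightarrow> norm x \<le> c" using W(2) unfolding bounded_iff by blast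
  have "finite (A \<inter> W) \<longleftrightarrow> (\<exists>m::nat. \<forall>n::nat. card (grid_round (2 ^ n) ` (A \<inter> W)) \<le> m)" for A
  proof
    assume "finite (A \<inter> W)"
    then show "\<exists>m::nat. \<forall>n::nat. card (grid_round (2 ^ n) ` (A \<inter> W)) \<le> m"
      using card_image_le by blast
  next
    assume "\<exists>m::nat. \<forall>n::nat. card (grid_round (2 ^ n) ` (A \<inter> W)) \<le> m"
    then obtain m :: nat where m: "\<And>n::nat. card (grid_round (2 ^ n) ` (A \<inter> W)) \<le> m" by blast
    show "finite (A \<inter> W)"
    proof (rule ccontr)
      assume "infinite (A \<inter> W)"
      then obtain Y where Y: "Y \<subseteq> A \<inter> W" "finite Y" "card Y = Suc m"
        using infinite_arbitrarily_large by blast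
      obtain n where "inj_on (grid_round (2 ^ n)) Y"
        using eventually_happens[OF inj_on_grid_round_eventually[OF Y(2)]] by auto
      then have "Suc m = card (grid_round (2 ^ n) ` Y)" using Y by (simp add: card_image)
      also have "\<dots> \<le> card (grid_round (2 ^ n) ` (A \<inter> W))"
      proof (rule card_mono)
        show "finite (grid_round (2 ^ n) ` (A \<inter> W))"
          by (rule grid_round_image(1)[of _ _ c]) (use c in auto)
      qed (use Y(1) in blast)
      finally show False using m[of n] by simp
    qed
  qed
  then have "{A. finite (A \<inter> W)} = {A. \<exists>m::nat. \<forall>n::nat. card (grid_round (2 ^ n) ` (A \<inter> W)) \<le> m}"
    by (intro Collect_cong)
  also have "\<dots> = (\<Union>m. \<Inter>n. {A. card (grid_round (2 ^ n) ` (A \<inter> W)) \<le> m})" by blast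
  also have "\<dots> \<in> sets (config_space W)"
    using grid_predicate_in_config_space[OF W, of "\<lambda>X. card X \<le> _"] by (intro sets.countable_UN sets.countable_INT) auto
  finally show ?thesis .
qed

text \<open>The value \<open>{}\<close> on infinite configurations makes this a total map into
  closed sets. The intersection with \<open>cball 0 \<rho>\<close> provides the bound on the points
  hit that the rounding argument requires.\<close>

definition window_skel ::
    "bool \<Rightarrow> real \<Rightarrow> ('a::euclidean_space \<times> real) set \<Rightarrow> ('a \<times> real) set \<Rightarrow> 'a set" where
  "window_skel dual \<rho> W A = (if finite (A \<inter> W) then local_skel dual \<rho> (A \<inter> W) \<inter> cball 0 \<rho> else {})"

lemma closed_window_skel: "closed (window_skel dual \<rho> W A)"
  unfolding window_skel_def using closed_local_skel by auto

lemma window_skel_hit_in_config_space: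
  fixes W :: "('a::euclidean_space \<times> real) set"
  assumes W: "W \<in> sets borel" "bounded W" and K: "compact K"
  shows "{A. window_skel dual \<rho> W A \<inter> K \<noteq> {}} \<in> sets (config_space W)"
proof -
  let ?K = "cball 0 \<rho> \<inter> K"
  let ?R = "\<lambda>k n. {A. relaxed_hit dual \<rho> ?K (1 / real (Suc k)) (grid_round (2 ^ n) ` (A \<inter> W))}"
  have K': "compact ?K" "?K \<subseteq> cball 0 \<rho>" using K by (auto simp: compact_Int)
  have "window_skel dual \<rho> W A \<inter> K \<noteq> {} \<longleftrightarrow> finite (A \<inter> W) \<and> (\<forall>k. \<exists>N. \<forall>n\<in>{N..}. A \<in> ?R k n)" for A
  proof (cases "finite (A \<inter> W)")
    case True
    have "window_skel dual \<rho> W A \<inter> K \<noteq> {} \<longleftrightarrow> local_skel dual \<rho> (A \<inter> W) \<inter> ?K \<noteq> {}"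
      unfolding window_skel_def using True by (simp add: Int_assoc)
    also have "\<dots> \<longleftrightarrow> relaxed_hit dual \<rho> ?K 0 (A \<inter> W)" by (rule local_skel_hit_iff)
    also have "\<dots> \<longleftrightarrow> (\<forall>k. \<exists>N. \<forall>n\<in>{N..}. A \<in> ?R k n)"
      unfolding relaxed_hit_iff_grid[OF True K'] by (simp only: mem_Collect_eq Ball_def atLeast_iff)
    finally show ?thesis using True by simp
  qed (simp add: window_skel_def)
  then have "{A. window_skel dual \<rho> W A \<inter> K \<noteq> {}} =
      {A. finite (A \<inter> W) \<and> (\<forall>k. \<exists>N. \<forall>n\<in>{N..}. A \<in> ?R k n)}" by (intro Collect_cong)
  also have "\<dots> = {A. finite (A \<inter> W)} \<inter> (\<Inter>k. \<Union>N. \<Inter>n\<in>{N..}. ?R k n)"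
    by (rule set_eqI) (simp only: Int_iff INT_iff UN_iff mem_Collect_eq UNIV_I simp_thms bex_UNIV ball_UNIV)
  also have "\<dots> \<in> sets (config_space W)"
    using grid_predicate_in_config_space[OF W] finite_in_config_space[OF W]
    by (intro sets.Int sets.countable_INT sets.countable_UN sets.countable_INT'') auto
  finally show ?thesis .
qed

lemma window_skel_measurable:
  fixes W :: "('a::euclidean_space \<times> real) set"
  assumes W: "W \<in> sets borel" "bounded W"
  shows "window_skel dual \<rho> W \<in> config_space W \<rightarrow>\<^sub>M borel_of fell_topology"
proof (rule measurable_fell_topology)
  show "closed (window_skel dual \<rho> W A)" for A by (rule closed_window_skel)
  show "{A \<in> space (config_space W). window_skel dual \<rho> W A \<inter> cbox a b \<noteq> {}} \<in> sets (config_space W)" for a b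
    using window_skel_hit_in_config_space[OF W compact_cbox] by simp
qed

section \<open>Estimates of the intensity measure\<close>

lemma sets_intensity [simp]: "sets (intensity f :: ('a::euclidean_space \<times> real) measure) = sets borel"
  unfolding intensity_def by simp

text \<open>Integrability on compact sets gives measurability piece by piece; countably many boxes
  exhaust \<open>interior E\<close>, and \<open>f\<close> is 0 elsewhere.\<close>

lemma L1loc_plus_measurable:
  assumes "f \<in> L1loc_plus E"
  shows "f \<in> borel_measurable lebesgue"
proof -
  have f: "\<And>x. x \<notin> interior E \<Longrightarrow> f x = 0" "\<And>K. compact K \<Longrightarrow> K \<subseteq> E \<Longrightarrow> set_integrable lebesgue K f"
    using assms unfolding L1loc_plus_def by auto
  obtain \<D> where \<D>: "countable \<D>" "\<D> \<subseteq> Pow (interior E)" "\<And>X. X \<in> \<D> \<Longrightarrow> \<exists>a b. X = cbox a b" "\<Union>\<D> = interior E"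
    using open_countable_Union_open_cbox[OF open_interior, of E] by metis
  have "f -` S \<in> sets lebesgue" if S: "S \<in> sets borel" for S
  proof -
    have piece: "f -` S \<inter> X \<in> sets lebesgue" if X: "X \<in> \<D>" for X
    proof -
      obtain a b where ab: "X = cbox a b" using \<D>(3)[OF X] by blast
      have "X \<subseteq> E" using \<D>(2) X interior_subset by blast
      then have "set_integrable lebesgue X f" using f(2)[of X] unfolding ab by simp
      then have "(\<lambda>x. indicator X x *\<^sub>R f x) \<in> borel_measurable lebesgue"
        unfolding set_integrable_def by (rule borel_measurable_integrable)
      from measurable_sets[OF this S]
      have "(\<lambda>x. indicator X x *\<^sub>R f x) -` S \<inter> X \<in> sets lebesgue" unfolding ab by (intro sets.Int) auto
      moreover have "(\<lambda>x. indicator X x *\<^sub>R f x) -` S \<inter> X = f -` S \<inter> X" by auto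
      ultimately show ?thesis by simp
    qed
    have rest: "f -` S - interior E \<in> sets lebesgue"
    proof -
      have "f -` S - interior E = (if 0 \<in> S then - interior E else {})"
      proof (rule set_eqI)
        show "x \<in> f -` S - interior E \<longleftrightarrow> x \<in> (if 0 \<in> S then - interior E else {})" for x
          using f(1)[of x] by (cases "x \<in> interior E") auto
      qed
      moreover have "- interior E \<in> sets lebesgue" using open_interior[of E] by auto
      ultimately show ?thesis by simp
    qed
    have "f -` S = (\<Union>X\<in>\<D>. f -` S \<inter> X) \<union> (f -` S - interior E)" using \<D>(4) by blast
    moreover have "(\<Union>X\<in>\<D>. f -` S \<inter> X) \<in> sets lebesgue"
      using piece by (rule sets.countable_UN''[OF \<D>(1)])
    ultimately show ?thesis using rest by (metis sets.Un)
  qed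
  then show ?thesis by (intro measurableI) auto
qed

lemma id_measurable_lborel_lebesgue:
  "(\<lambda>p. p) \<in> (lborel :: 'a::euclidean_space measure) \<Otimes>\<^sub>M (lebesgue :: real measure) \<rightarrow>\<^sub>M borel"
proof -
  have "(\<lambda>x. x) \<in> lebesgue \<rightarrow>\<^sub>M (borel :: real measure)"
    by (intro measurable_completion) simp
  then have "(\<lambda>p. (fst p, snd p)) \<in> (lborel :: 'a measure) \<Otimes>\<^sub>M lebesgue \<rightarrow>\<^sub>M (borel :: 'a measure) \<Otimes>\<^sub>M (borel :: real measure)"
    using measurable_compose[OF measurable_snd] by (intro measurable_Pair) simp_all
  then show ?thesis by (simp add: borel_prod)
qed

lemma borel_in_lborel_lebesgue:
  "B \<in> sets borel \<Longrightarrow> B \<in> sets ((lborel :: 'a::euclidean_space measure) \<Otimes>\<^sub>M (lebesgue :: real measure))"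
  using measurable_sets[OF id_measurable_lborel_lebesgue, of B] by (simp add: space_pair_measure)

lemma emeasure_intensity_pair:
  fixes B :: "('a::euclidean_space \<times> real) set"
  assumes f: "f \<in> borel_measurable lebesgue" and B: "B \<in> sets borel"
  shows "emeasure (intensity f) B = (\<integral>\<^sup>+p. ennreal (f (snd p)) * indicator B p \<partial>(lborel \<Otimes>\<^sub>M lebesgue))"
proof -
  let ?P = "(lborel :: 'a measure) \<Otimes>\<^sub>M (lebesgue :: real measure)"
  have g: "(\<lambda>(v, h). ennreal (f h)) \<in> borel_measurable ?P" using f by measurable
  have "emeasure (intensity f) B = emeasure (density ?P (\<lambda>(v, h). ennreal (f h))) B"
    unfolding intensity_def using id_measurable_lborel_lebesgue B
    by (subst emeasure_distr) (auto simp: space_pair_measure)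
  also have "\<dots> = (\<integral>\<^sup>+p. (case p of (v, h) \<Rightarrow> ennreal (f h)) * indicator B p \<partial>?P)"
    by (rule emeasure_density[OF g borel_in_lborel_lebesgue[OF B]])
  finally show ?thesis by (simp add: case_prod_beta)
qed

text \<open>The order of integration opposite to \<open>emeasure_intensity\<close>: heights outside,
  so that the volume of a slice becomes the weight of \<open>f h\<close>.\<close>

lemma emeasure_intensity_slices:
  fixes B :: "('a::euclidean_space \<times> real) set"
  assumes f: "f \<in> borel_measurable lebesgue" and B: "B \<in> sets borel"
  shows "emeasure (intensity f) B = (\<integral>\<^sup>+h. ennreal (f h) * emeasure lborel {v. (v, h) \<in> B} \<partial>lebesgue)"
proof -
  interpret L: sigma_finite_measure "lebesgue :: real measure" by (rule sigma_finite_lebesgue)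
  interpret pair_sigma_finite "lborel :: 'a measure" "lebesgue :: real measure" ..
  have BP: "B \<in> sets ((lborel :: 'a measure) \<Otimes>\<^sub>M (lebesgue :: real measure))"
    by (rule borel_in_lborel_lebesgue[OF B])
  have m: "(\<lambda>p. ennreal (f (snd p)) * indicator B p) \<in> borel_measurable ((lborel :: 'a measure) \<Otimes>\<^sub>M lebesgue)"
    using f BP by measurable
  have "emeasure (intensity f) B = (\<integral>\<^sup>+h. \<integral>\<^sup>+v. ennreal (f h) * indicator B (v, h) \<partial>lborel \<partial>lebesgue)"
    unfolding emeasure_intensity_pair[OF f B] by (subst nn_integral_snd[OF m, symmetric]) simp
  also have "\<dots> = (\<integral>\<^sup>+h. ennreal (f h) * emeasure lborel {v. (v, h) \<in> B} \<partial>lebesgue)"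
  proof (intro nn_integral_cong)
    fix h :: real
    have "(\<lambda>v. (v, h)) \<in> borel \<rightarrow>\<^sub>M (borel :: ('a \<times> real) measure)"
      by (intro borel_measurable_continuous_onI continuous_intros)
    from measurable_sets[OF this B] have s: "{v. (v, h) \<in> B} \<in> sets lborel" by (simp add: vimage_def)
    have "(\<integral>\<^sup>+v. ennreal (f h) * indicator B (v, h) \<partial>lborel) =
        (\<integral>\<^sup>+v. ennreal (f h) * indicator {v. (v, h) \<in> B} v \<partial>lborel)"
      by (intro nn_integral_cong) (auto simp: indicator_def)
    also have "\<dots> = ennreal (f h) * emeasure lborel {v. (v, h) \<in> B}"
      by (rule nn_integral_cmult_indicator[OF s])
    finally show "(\<integral>\<^sup>+v. ennreal (f h) * indicator B (v, h) \<partial>lborel) = ennreal (f h) * emeasure lborel {v. (v, h) \<in> B}" .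
  qed
  finally show ?thesis .
qed

lemma emeasure_intensity_Times:
  fixes V :: "'a::euclidean_space set"
  assumes f: "f \<in> borel_measurable lebesgue" and V: "V \<in> sets borel" and I: "I \<in> sets borel"
  shows "emeasure (intensity f) (V \<times> I) = emeasure lborel V * (\<integral>\<^sup>+h\<in>I. ennreal (f h) \<partial>lebesgue)"
proof -
  have VI: "V \<times> I \<in> sets borel" using V I by (rule borel_Times)
  have I': "I \<in> sets lebesgue" using I by (simp add: sets_completionI_sets)
  have "emeasure (intensity f) (V \<times> I) = (\<integral>\<^sup>+h. emeasure lborel V * (ennreal (f h) * indicator I h) \<partial>lebesgue)"
    unfolding emeasure_intensity_slices[OF f VI]
    by (intro nn_integral_cong) (auto simp: indicator_def mult.commute)
  also have "\<dots> = emeasure lborel V * (\<integral>\<^sup>+h. ennreal (f h) * indicator I h \<partial>lebesgue)"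
    by (intro nn_integral_cmult borel_measurable_times_ennreal borel_measurable_indicator I'
      measurable_compose[OF f measurable_ennreal])
  finally show ?thesis .
qed

lemma emeasure_lborel_cball_sqrt:
  fixes c :: "'a::euclidean_space"
  assumes "0 \<le> x"
  shows "emeasure lborel (cball c (sqrt x)) = ennreal (unit_ball_vol DIM('a)) * ennreal (x powr (real DIM('a) / 2))"
proof -
  have "sqrt x ^ DIM('a) = x powr (real DIM('a) / 2)"
  proof (cases "x = 0")
    case True
    then show ?thesis using DIM_positive[where 'a = 'a] by simp
  next
    case False
    then have "x > 0" using assms by simp
    then have "sqrt x ^ DIM('a) = (x powr (1 / 2)) powr (real DIM('a))"
      by (simp add: powr_half_sqrt powr_realpow)
    then show ?thesis by (simp add: powr_powr)
  qed
  then show ?thesis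
    using assms by (simp add: emeasure_cball ennreal_mult'' unit_ball_vol_nonneg)
qed

text \<open>At height \<open>h\<close> the set is a ball of radius \<open>sqrt (t - h)\<close>, with
  volume proportional to \<open>(t - h) powr (d / 2)\<close>. Integrated against \<open>f\<close>
  this is the fractional integral of order \<open>d / 2 + 1\<close> up to its Gamma factor; the
  identity turns the growth condition into void probabilities.\<close>

lemma emeasure_intensity_pow_le:
  fixes w :: "'a::euclidean_space"
  assumes f: "f \<in> borel_measurable lebesgue" "\<And>x. 0 \<le> f x"
  shows "{p. pow w p \<le> t} \<in> sets borel"
    and "emeasure (intensity f) {p. pow w p \<le> t} =
      ennreal (unit_ball_vol DIM('a) * Gamma (real DIM('a) / 2 + 1)) * frac_integral (real DIM('a) / 2 + 1) f t"
proof -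
  have "closed {p. pow w p \<le> t}" by (intro closed_Collect_le continuous_pow2 continuous_intros)
  then show B: "{p. pow w p \<le> t} \<in> sets borel" by (rule borel_closed)
  let ?d = "real DIM('a)" and ?k = "unit_ball_vol (real DIM('a))"
  have G: "Gamma (?d / 2 + 1) > 0" by (intro Gamma_real_pos) (simp add: add_nonneg_pos)
  then have G0: "Gamma (?d / 2 + 1) \<noteq> 0" by linarith
  have slice: "ennreal (f h) * emeasure lborel {v. (v, h) \<in> {p. pow w p \<le> t}} =
      ennreal ?k * (ennreal (f h * (t - h) powr (?d / 2)) * indicator {..<t} h)" for h
  proof (cases "h \<le> t")
    case True
    have "{v. (v, h) \<in> {p. pow w p \<le> t}} = cball w (sqrt (t - h))"
    proof (intro set_eqI)
      fix v
      have "(norm (w - v))\<^sup>2 + h \<le> t \<longleftrightarrow> norm (w - v) \<le> sqrt (t - h)"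
        using True real_le_rsqrt[of "norm (w - v)" "t - h"] sqrt_ge_absD[of "norm (w - v)" "t - h"] by auto
      then show "v \<in> {v. (v, h) \<in> {p. pow w p \<le> t}} \<longleftrightarrow> v \<in> cball w (sqrt (t - h))"
        by (simp add: pow_def dist_norm)
    qed
    then have "ennreal (f h) * emeasure lborel {v. (v, h) \<in> {p. pow w p \<le> t}} =
      ennreal (f h) * (ennreal ?k * ennreal ((t - h) powr (?d / 2)))"
      using True by (simp add: emeasure_lborel_cball_sqrt)
    also have "\<dots> = ennreal ?k * ennreal (f h * (t - h) powr (?d / 2))"
      using f(2) by (simp add: ennreal_mult mult_ac)
    also have "\<dots> = ennreal ?k * (ennreal (f h * (t - h) powr (?d / 2)) * indicator {..<t} h)"
      using True DIM_positive[where 'a = 'a] by (cases "h = t") (auto simp: indicator_def)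
    finally show ?thesis .
  next
    case False
    then have "{v. (v, h) \<in> {p. pow w p \<le> t}} = {}"
      unfolding pow_def using zero_le_power2[of "norm (w - _)"] by (auto simp: not_le intro: add_nonneg_pos less_le_trans)
    then show ?thesis using False by (simp add: indicator_def)
  qed
  have "emeasure (intensity f) {p. pow w p \<le> t} =
      ennreal ?k * (\<integral>\<^sup>+h. ennreal (f h * (t - h) powr (?d / 2)) * indicator {..<t} h \<partial>lebesgue)"
    unfolding emeasure_intensity_slices[OF f(1) B] slice
  proof (intro nn_integral_cmult borel_measurable_times_ennreal borel_measurable_indicator)
    have "(\<lambda>h. (t - h) powr (?d / 2)) \<in> borel_measurable lebesgue"
      by (rule measurable_completion) measurable
    then have "(\<lambda>h. f h * (t - h) powr (?d / 2)) \<in> borel_measurable lebesgue"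
      by (rule borel_measurable_times[OF f(1)])
    then show "(\<lambda>h. ennreal (f h * (t - h) powr (?d / 2))) \<in> borel_measurable lebesgue"
      by (rule measurable_compose[OF _ measurable_ennreal])
  qed (simp add: sets_completionI_sets)
  also have "\<dots> = ennreal ?k * (ennreal (Gamma (?d / 2 + 1)) * (ennreal (1 / Gamma (?d / 2 + 1)) *
      (\<integral>\<^sup>+h. ennreal (f h * (t - h) powr (?d / 2)) * indicator {..<t} h \<partial>lebesgue)))"
  proof -
    have one: "ennreal (Gamma (?d / 2 + 1)) * ennreal (1 / Gamma (?d / 2 + 1)) = 1"
      using G G0 by (subst ennreal_mult'[symmetric]) (auto simp: less_imp_le)
    show ?thesis
      unfolding mult.assoc[of "ennreal (Gamma (?d / 2 + 1))", symmetric] one mult_1_left ..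
  qed
  also have "\<dots> = ennreal (?k * Gamma (?d / 2 + 1)) * frac_integral (?d / 2 + 1) f t"
    unfolding frac_integral_def using less_imp_le[OF G] by (subst ennreal_mult'') (simp_all add: mult.assoc)
  finally show "emeasure (intensity f) {p. pow w p \<le> t} =
      ennreal (unit_ball_vol DIM('a) * Gamma (real DIM('a) / 2 + 1)) * frac_integral (real DIM('a) / 2 + 1) f t"
    by simp
qed

lemma closed_tail_set: "closed (tail_set H :: ('a::euclidean_space \<times> real) set)"
proof -
  have "tail_set H = {p :: 'a \<times> real. snd p \<le> - H} \<inter> {p. (norm (fst p))\<^sup>2 \<le> 9 * (- snd p)}"
    unfolding tail_set_def by auto
  then show ?thesis by (auto intro!: closed_Int closed_Collect_le continuous_intros)
qed

text \<open>The slice at height \<open>h\<close> is a ball of radius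
  \<open>3 * sqrt \<bar>h\<bar>\<close>, whence the factor \<open>3 ^ DIM('a)\<close> and the moment
  of order \<open>d / 2\<close>. A slightly higher moment will make it small.\<close>

lemma emeasure_intensity_tail_set:
  assumes f: "f \<in> borel_measurable lebesgue" "\<And>x. 0 \<le> f x" and H: "0 \<le> H"
  shows "emeasure (intensity f) (tail_set H :: ('a::euclidean_space \<times> real) set) =
    ennreal (unit_ball_vol DIM('a) * 3 ^ DIM('a)) *
      (\<integral>\<^sup>+h\<in>{..-H}. ennreal (\<bar>h\<bar> powr (real DIM('a) / 2) * f h) \<partial>lebesgue)"
proof -
  let ?d = "real DIM('a)" and ?k = "unit_ball_vol (real DIM('a))"
  let ?T = "tail_set H :: ('a \<times> real) set"
  have slice: "ennreal (f h) * emeasure lborel {v. (v, h) \<in> ?T} =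
      ennreal (?k * 3 ^ DIM('a)) * (ennreal (\<bar>h\<bar> powr (?d / 2) * f h) * indicator {..-H} h)" for h
  proof (cases "h \<le> - H")
    case True
    have h: "h \<le> 0" using True H by simp
    have "{v. (v, h) \<in> ?T} = cball 0 (sqrt (9 * \<bar>h\<bar>))"
    proof (intro set_eqI)
      fix v :: 'a
      have "(norm v)\<^sup>2 \<le> 9 * (- h) \<longleftrightarrow> norm v \<le> sqrt (9 * \<bar>h\<bar>)"
        using h real_le_rsqrt[of "norm v" "9 * \<bar>h\<bar>"] sqrt_ge_absD[of "norm v" "9 * \<bar>h\<bar>"] by auto
      then show "v \<in> {v. (v, h) \<in> ?T} \<longleftrightarrow> v \<in> cball 0 (sqrt (9 * \<bar>h\<bar>))"
        using True by (simp add: tail_set_def)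
    qed
    then have "ennreal (f h) * emeasure lborel {v. (v, h) \<in> ?T} =
        ennreal (f h) * (ennreal ?k * ennreal ((9 * \<bar>h\<bar>) powr (?d / 2)))"
      by (simp only:) (subst emeasure_lborel_cball_sqrt, auto)
    also have "(9 * \<bar>h\<bar>) powr (?d / 2) = 3 ^ DIM('a) * \<bar>h\<bar> powr (?d / 2)"
    proof -
      have "(9::real) powr (?d / 2) = ((3::real) powr 2) powr (?d / 2)" by simp
      also have "\<dots> = 3 powr ?d" by (simp only: powr_powr) simp
      also have "\<dots> = 3 ^ DIM('a)" by (simp add: powr_realpow)
      finally show ?thesis by (simp add: powr_mult)
    qed
    also have "ennreal (f h) * (ennreal ?k * ennreal (3 ^ DIM('a) * \<bar>h\<bar> powr (?d / 2))) =
        ennreal (f h * (?k * (3 ^ DIM('a) * \<bar>h\<bar> powr (?d / 2))))"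
      using f(2) by (simp add: ennreal_mult)
    also have "\<dots> = ennreal ((?k * 3 ^ DIM('a)) * (\<bar>h\<bar> powr (?d / 2) * f h))"
      by (simp add: mult_ac)
    also have "\<dots> = ennreal (?k * 3 ^ DIM('a)) * ennreal (\<bar>h\<bar> powr (?d / 2) * f h)"
      using f(2) by (intro ennreal_mult) auto
    finally show ?thesis using True by simp
  next
    case False
    then show ?thesis by (simp add: tail_set_def indicator_def)
  qed
  show ?thesis
    unfolding emeasure_intensity_slices[OF f(1) borel_closed[OF closed_tail_set]] slice
  proof (intro nn_integral_cmult borel_measurable_times_ennreal borel_measurable_indicator)
    have "(\<lambda>h. \<bar>h\<bar> powr (?d / 2)) \<in> borel_measurable lebesgue"
      by (rule measurable_completion) measurable
    then have "(\<lambda>h. \<bar>h\<bar> powr (?d / 2) * f h) \<in> borel_measurable lebesgue"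
      by (rule borel_measurable_times[OF _ f(1)])
    then show "(\<lambda>h. ennreal (\<bar>h\<bar> powr (?d / 2) * f h)) \<in> borel_measurable lebesgue"
      by (rule measurable_compose[OF _ measurable_ennreal])
  qed (simp add: sets_completionI_sets)
qed

lemma tail_set_antimono: "H \<le> H' \<Longrightarrow> tail_set H' \<subseteq> tail_set H"
  unfolding tail_set_def by auto

lemma emeasure_orthant:
  fixes J :: "'a::euclidean_space set"
  shows "{v. \<forall>i\<in>Basis. if i \<in> J then c \<le> v \<bullet> i else v \<bullet> i \<le> - c} \<in> sets borel"
    and "emeasure lborel {v::'a. \<forall>i\<in>Basis. if i \<in> J then c \<le> v \<bullet> i else v \<bullet> i \<le> - c} = \<infinity>"
proof -
  let ?O = "{v::'a. \<forall>i\<in>Basis. if i \<in> J then c \<le> v \<bullet> i else v \<bullet> i \<le> - c}"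
  have "?O = (\<Inter>i\<in>Basis. if i \<in> J then {v. c \<le> v \<bullet> i} else {v. v \<bullet> i \<le> - c})"
    by (auto split: if_splits)
  also have "closed \<dots>" by (auto intro!: closed_INT closed_Collect_le continuous_intros)
  finally show O: "?O \<in> sets borel" by (rule borel_closed)
  have ge: "of_nat n \<le> emeasure lborel ?O" for n :: nat
  proof -
    let ?l = "\<Sum>i\<in>Basis. (if i \<in> J then c else - c - real n) *\<^sub>R i :: 'a"
    let ?u = "\<Sum>i\<in>Basis. (if i \<in> J then c + real n else - c) *\<^sub>R i :: 'a"
    have "cbox ?l ?u \<subseteq> ?O" by (auto simp: mem_box split: if_splits)
    moreover have "emeasure lborel (cbox ?l ?u) = ennreal (real n ^ DIM('a))"
    proof -
      have "emeasure lborel (cbox ?l ?u) = ennreal (\<Prod>i\<in>Basis. (?u - ?l) \<bullet> i)"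
        by (intro emeasure_lborel_cbox) auto
      also have "(\<Prod>i\<in>Basis. (?u - ?l) \<bullet> i) = (\<Prod>i\<in>(Basis::'a set). real n)"
        by (intro prod.cong) (auto simp: inner_diff_left)
      finally show ?thesis by simp
    qed
    ultimately have "ennreal (real n ^ DIM('a)) \<le> emeasure lborel ?O"
      using emeasure_mono[of "cbox ?l ?u" ?O lborel] O by simp
    moreover have "real n \<le> real n ^ DIM('a)"
    proof (cases "n = 0")
      case False
      then show ?thesis using DIM_positive[where 'a = 'a] by (intro self_le_power) simp_all
    qed simp
    then have "ennreal (real n) \<le> ennreal (real n ^ DIM('a))" by (rule ennreal_leI)
    ultimately show ?thesis
      unfolding ennreal_of_nat_eq_real_of_nat by (rule order_trans[rotated])
  qed
  have "\<not> emeasure lborel ?O < top"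
  proof
    assume "emeasure lborel ?O < top"
    then obtain n where "emeasure lborel ?O < of_nat n" using ennreal_Ex_less_of_nat by blast
    with ge[of n] show False by (simp only: leD)
  qed
  then show "emeasure lborel ?O = \<infinity>" by (simp add: less_top[symmetric])
qed

text \<open>Infinite volume times a positive mass of weights: such a set is hit almost surely,
  however far out the orthant starts.\<close>

lemma emeasure_intensity_orthant:
  assumes f: "f \<in> borel_measurable lebesgue" and pos: "(\<integral>\<^sup>+h\<in>{..t}. ennreal (f h) \<partial>lebesgue) > 0"
  shows "orthant c J \<inter> UNIV \<times> {..t} \<in> sets (borel :: ('a::euclidean_space \<times> real) measure)"
    and "emeasure (intensity f) (orthant c J \<inter> UNIV \<times> {..t} :: ('a \<times> real) set) = \<infinity>"
proof -
  let ?O = "{v::'a. \<forall>i\<in>Basis. if i \<in> J then c \<le> v \<bullet> i else v \<bullet> i \<le> - c}"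
  have eq: "orthant c J \<inter> UNIV \<times> {..t} = ?O \<times> {..t}" unfolding orthant_def by auto
  show "orthant c J \<inter> UNIV \<times> {..t} \<in> sets (borel :: ('a \<times> real) measure)"
    unfolding eq using emeasure_orthant(1) by (intro borel_Times) auto
  show "emeasure (intensity f) (orthant c J \<inter> UNIV \<times> {..t} :: ('a \<times> real) set) = \<infinity>"
    unfolding eq using pos by (subst emeasure_intensity_Times[OF f emeasure_orthant(1)])
      (auto simp: emeasure_orthant(2) ennreal_top_mult)
qed

lemma emeasure_intensity_le_diff:
  fixes C :: "('a::euclidean_space \<times> real) set"
  assumes f: "f \<in> borel_measurable lebesgue" and g: "g \<in> borel_measurable lebesgue" "\<And>x. 0 \<le> g x"
    and C: "C \<in> sets borel"
  shows "emeasure (intensity f) C \<le> emeasure (intensity g) C + emeasure (intensity (\<lambda>x. \<bar>f x - g x\<bar>)) C"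
proof -
  let ?P = "(lborel :: 'a measure) \<Otimes>\<^sub>M (lebesgue :: real measure)"
  have d: "(\<lambda>x. \<bar>f x - g x\<bar>) \<in> borel_measurable lebesgue" using f g by measurable
  have CP: "C \<in> sets ?P" by (rule borel_in_lborel_lebesgue[OF C])
  have "(\<integral>\<^sup>+p. ennreal (f (snd p)) * indicator C p \<partial>?P) \<le>
     (\<integral>\<^sup>+p. ennreal (g (snd p)) * indicator C p + ennreal \<bar>f (snd p) - g (snd p)\<bar> * indicator C p \<partial>?P)"
  proof (intro nn_integral_mono)
    fix p :: "'a \<times> real"
    have "ennreal (f (snd p)) \<le> ennreal (g (snd p) + \<bar>f (snd p) - g (snd p)\<bar>)" by (intro ennreal_leI) linarith
    also have "\<dots> = ennreal (g (snd p)) + ennreal \<bar>f (snd p) - g (snd p)\<bar>"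
      using g(2) by (intro ennreal_plus) auto
    finally show "ennreal (f (snd p)) * indicator C p \<le>
      ennreal (g (snd p)) * indicator C p + ennreal \<bar>f (snd p) - g (snd p)\<bar> * indicator C p"
      by (auto simp: indicator_def)
  qed
  also have "\<dots> = (\<integral>\<^sup>+p. ennreal (g (snd p)) * indicator C p \<partial>?P) +
     (\<integral>\<^sup>+p. ennreal \<bar>f (snd p) - g (snd p)\<bar> * indicator C p \<partial>?P)"
    by (intro nn_integral_add borel_measurable_times_ennreal borel_measurable_indicator CP
        measurable_compose[OF measurable_compose[OF measurable_snd] measurable_ennreal] f g d)
  finally show ?thesis
    unfolding emeasure_intensity_pair[OF f C] emeasure_intensity_pair[OF g(1) C] emeasure_intensity_pair[OF d C] .
qed

text \<open>On every set the difference of the two intensities is dominated by the intensity of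
  \<open>\<bar>f - g\<bar>\<close>, which is additive over disjoint pieces. This supplies the bound
  \<open>d\<close> of \<open>tv_config_space\<close>.\<close>

lemma intensity_sum_diff_le:
  fixes W :: "('a::euclidean_space \<times> real) set" and C :: "nat \<Rightarrow> ('a \<times> real) set"
  assumes f: "f \<in> borel_measurable lebesgue" "\<And>x. 0 \<le> f x" and g: "g \<in> borel_measurable lebesgue" "\<And>x. 0 \<le> g x"
    and fin: "emeasure (intensity f) W < \<infinity>" "emeasure (intensity g) W < \<infinity>"
      "emeasure (intensity (\<lambda>x. \<bar>f x - g x\<bar>)) W < \<infinity>"
    and W: "W \<in> sets borel"
    and C: "\<And>i. i < m \<Longrightarrow> C i \<in> sets borel \<and> C i \<subseteq> W" "disjoint_family_on C {..<m}"
  shows "(\<Sum>i<m. \<bar>measure (intensity f) (C i) - measure (intensity g) (C i)\<bar>) \<le>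
    measure (intensity (\<lambda>x. \<bar>f x - g x\<bar>)) W"
proof -
  let ?D = "intensity (\<lambda>x. \<bar>f x - g x\<bar>) :: ('a \<times> real) measure"
  have finC: "emeasure (intensity h) (C i) < \<infinity>" if "i < m" "emeasure (intensity h) W < \<infinity>" for h i
    using emeasure_mono[of "C i" W "intensity h"] C(1)[OF that(1)] W that(2) by (auto intro: le_less_trans)
  have "\<bar>measure (intensity f) (C i) - measure (intensity g) (C i)\<bar> \<le> measure ?D (C i)" if i: "i < m" for i
  proof -
    have Ci: "C i \<in> sets borel" using C(1) i by blast
    have m: "emeasure (intensity h) (C i) = ennreal (measure (intensity h) (C i))"
      if "emeasure (intensity h) W < \<infinity>" for h
      using finC[OF i that] by (intro emeasure_eq_ennreal_measure) auto
    have sym: "(\<lambda>x. \<bar>g x - f x\<bar>) = (\<lambda>x. \<bar>f x - g x\<bar>)" by (auto simp: abs_minus_commute)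
    have "ennreal (measure (intensity f) (C i)) \<le> ennreal (measure (intensity g) (C i) + measure ?D (C i))"
      using emeasure_intensity_le_diff[OF f(1) g Ci] unfolding m[OF fin(1)] m[OF fin(2)] m[OF fin(3)]
      by (simp add: ennreal_plus)
    moreover have "ennreal (measure (intensity g) (C i)) \<le> ennreal (measure (intensity f) (C i) + measure ?D (C i))"
      using emeasure_intensity_le_diff[OF g(1) f Ci] unfolding sym m[OF fin(1)] m[OF fin(2)] m[OF fin(3)]
      by (simp add: ennreal_plus)
    ultimately have "measure (intensity f) (C i) \<le> measure (intensity g) (C i) + measure ?D (C i)"
      "measure (intensity g) (C i) \<le> measure (intensity f) (C i) + measure ?D (C i)"
      by (auto simp: ennreal_le_iff simp del: ennreal_plus)
    then show ?thesis by linarith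
  qed
  then have "(\<Sum>i<m. \<bar>measure (intensity f) (C i) - measure (intensity g) (C i)\<bar>) \<le> (\<Sum>i<m. measure ?D (C i))"
    by (intro sum_mono) simp
  also have "\<dots> = measure ?D (\<Union>i<m. C i)"
    using C finC fin(3) by (intro measure_finite_Union[symmetric]) (auto simp: less_top)
  also have "\<dots> \<le> measure ?D W"
    using C(1) W fin(3) by (intro measure_mono_fmeasurable) (auto simp: fmeasurable_def)
  finally show ?thesis .
qed

lemma emeasure_intensity_bounded_window:
  fixes W :: "('a::euclidean_space \<times> real) set"
  assumes f: "f \<in> borel_measurable lebesgue" and W: "W \<subseteq> cball 0 N \<times> {..t}" and N: "0 \<le> N"
  shows "emeasure (intensity f) W \<le> ennreal (unit_ball_vol DIM('a) * N ^ DIM('a)) * (\<integral>\<^sup>+h\<in>{..t}. ennreal (f h) \<partial>lebesgue)"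
proof -
  have "emeasure (intensity f) W \<le> emeasure (intensity f) (cball (0::'a) N \<times> {..t})"
    using W by (intro emeasure_mono) (auto intro!: borel_Times)
  then show ?thesis using emeasure_intensity_Times[OF f, of "cball (0::'a) N" "{..t}"] emeasure_cball[OF N, of "0::'a"] by simp
qed

section \<open>Configurations whose skeletons are determined by a window\<close>

definition laguerre_skel :: "bool \<Rightarrow> ('a::euclidean_space \<times> real) set \<Rightarrow> 'a set" where
  "laguerre_skel dual A = (if dual then skel (dual_laguerre A) else skel (laguerre_diagram A))"

definition window :: "(nat \<Rightarrow> real) \<Rightarrow> nat \<Rightarrow> ('a::euclidean_space \<times> real) set" where
  "window \<tau> N = {p. norm (fst p) \<le> real N \<and> - real N \<le> snd p \<and> snd p \<le> \<tau> N}"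

text \<open>The bound of \<open>apex_bound\<close> with \<open>L = H + r\<^sup>2\<close> from
  \<open>pow_ge_of_not_tail\<close>, enlarged by 1 so that the ball of radius \<open>r\<close> lies
  strictly inside.\<close>

definition apex_radius :: "nat \<Rightarrow> nat \<Rightarrow> nat \<Rightarrow> real" where
  "apex_radius r s H = real r + ((real r + real s)\<^sup>2 + real s + (real H + (real r)\<^sup>2)) + 1"

text \<open>\<open>s\<close> is the size of the surrounding points and \<open>j\<close> the index of
  a covering level. Everything refers to points in the window, and rational \<open>w\<close> leave
  countably many conditions, so this is an event of \<open>config_space (window \<tau> N)\<close>.
  The last two inequalities involve no points: they say that the window is large enough for the
  bounds.\<close>

definition good_configs :: "(nat \<Rightarrow> real) \<Rightarrow> nat \<Rightarrow> nat \<Rightarrow> nat \<Rightarrow> ('a::euclidean_space \<times> real) set set" where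
  "good_configs \<tau> H r N = {A. \<exists>s\<in>{..N}. \<exists>j\<in>{..N}.
     (\<forall>J\<in>Pow Basis. A \<inter> (window \<tau> N \<inter> (orthant (1 + real r) J \<inter> {p. norm (fst p) \<le> real s \<and> snd p \<le> real s})) \<noteq> {}) \<and>
     (\<forall>w\<in>{w. \<forall>i\<in>Basis. w \<bullet> i \<in> \<rat>} \<inter> ball 0 (apex_radius r s H). A \<inter> (window \<tau> N \<inter> {p. pow w p \<le> \<tau> j}) \<noteq> {}) \<and>
     tail_bound (apex_radius r s H) (\<tau> j) (real H) \<le> real N \<and> apex_radius r s H \<le> real N}"

lemma closed_window: "closed (window \<tau> N :: ('a::euclidean_space \<times> real) set)"
proof -
  have "window \<tau> N = {p :: 'a \<times> real. norm (fst p) \<le> real N} \<inter> {p. - real N \<le> snd p} \<inter> {p. snd p \<le> \<tau> N}"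
    unfolding window_def by auto
  then show ?thesis by (auto intro!: closed_Int closed_Collect_le continuous_intros)
qed

lemma window_subset: "window \<tau> N \<subseteq> cball 0 (real N) \<times> {..\<tau> N}"
  unfolding window_def by auto

lemma bounded_window: "bounded (window \<tau> N :: ('a::euclidean_space \<times> real) set)"
proof (rule bounded_subset)
  show "bounded (cball (0::'a) (real N) \<times> {- real N..\<tau> N})" by (intro bounded_Times) auto
  show "window \<tau> N \<subseteq> cball (0::'a) (real N) \<times> {- real N..\<tau> N}" unfolding window_def by auto
qed

lemma closed_orthant: "closed (orthant c J :: ('a::euclidean_space \<times> real) set)"
proof -
  have "orthant c J = (\<Inter>i\<in>Basis. if i \<in> J then {p :: 'a \<times> real. c \<le> fst p \<bullet> i} else {p. fst p \<bullet> i \<le> - c})"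
    unfolding orthant_def by (auto split: if_splits)
  then show ?thesis by (auto intro!: closed_INT closed_Collect_le continuous_intros)
qed

lemma good_configs_in_config_space:
  "good_configs \<tau> H r N \<in> sets (config_space (window \<tau> N :: ('a::euclidean_space \<times> real) set))"
proof -
  let ?W = "window \<tau> N :: ('a \<times> real) set"
  let ?O = "\<lambda>s J. ?W \<inter> (orthant (1 + real r) J \<inter> {p. norm (fst p) \<le> real s \<and> snd p \<le> real s})"
  let ?P = "\<lambda>w j. ?W \<inter> {p. pow w p \<le> \<tau> j}"
  let ?Q = "\<lambda>s. {w::'a. \<forall>i\<in>Basis. w \<bullet> i \<in> \<rat>} \<inter> ball 0 (apex_radius r s H)"
  let ?C = "\<lambda>s j. {A::('a \<times> real) set. tail_bound (apex_radius r s H) (\<tau> j) (real H) \<le> real N \<and> apex_radius r s H \<le> real N}"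
  have eq: "good_configs \<tau> H r N = (\<Union>s\<in>{..N}. \<Union>j\<in>{..N}.
     (\<Inter>J\<in>Pow Basis. {A. A \<inter> ?O s J \<noteq> {}}) \<inter> ((\<Inter>w\<in>?Q s. {A. A \<inter> ?P w j \<noteq> {}}) \<inter> ?C s j))"
    unfolding good_configs_def
    by (rule set_eqI) (simp only: Int_iff INT_iff UN_iff mem_Collect_eq)
  have cs: "closed {p :: 'a \<times> real. norm (fst p) \<le> real s \<and> snd p \<le> real s}" for s :: nat
    by (intro closed_Collect_conj closed_Collect_le continuous_intros)
  have 1: "{A. A \<inter> ?O s J \<noteq> {}} \<in> sets (config_space ?W)" for s J
    by (intro hits_in_config_space borel_closed closed_Int closed_window closed_orthant cs) blast
  have 2: "{A. A \<inter> ?P w j \<noteq> {}} \<in> sets (config_space ?W)" for w j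
    by (intro hits_in_config_space borel_closed closed_Int closed_window closed_Collect_le continuous_pow2 continuous_intros) blast
  have 3: "?C s j \<in> sets (config_space ?W)" for s j
    by (cases "tail_bound (apex_radius r s H) (\<tau> j) (real H) \<le> real N \<and> apex_radius r s H \<le> real N") simp_all
  have 4: "(\<Inter>w\<in>?Q s. {A. A \<inter> ?P w j \<noteq> {}}) \<in> sets (config_space ?W)" for s j
  proof (cases "?Q s = {}")
    case False
    have "countable (?Q s)"
      by (rule countable_subset[OF _ countable_rational_vectors]) blast
    then show ?thesis using False 2 by (intro sets.countable_INT' image_subsetI)
  qed simp
  show ?thesis
    unfolding eq by (intro sets.finite_UN sets.Int sets.finite_INT 1 3 4) auto
qed

lemma ball_rational_closure:
  fixes w :: "'a::euclidean_space"
  assumes "closed X" and X: "\<And>x. (\<forall>i\<in>Basis. x \<bullet> i \<in> \<rat>) \<Longrightarrow> norm x < \<rho> \<Longrightarrow> x \<in> X" and \<rho>: "0 < \<rho>"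
    and w: "norm w \<le> \<rho>"
  shows "w \<in> X"
proof -
  have "x \<in> X" if x: "norm x < \<rho>" for x
  proof (rule closed_approachable[THEN iffD1, OF assms(1)], intro allI impI)
    fix e :: real assume e: "e > 0"
    let ?e = "min e (\<rho> - norm x)"
    have "?e > 0" using e x by simp
    from rational_cboxes[OF this, of x] obtain a b where
      ab: "\<forall>i\<in>Basis. a \<bullet> i \<in> \<rat> \<and> b \<bullet> i \<in> \<rat>" "x \<in> cbox a b" "cbox a b \<subseteq> ball x ?e" by blast
    have "cbox a b \<noteq> {}" using ab(2) by blast
    then have "a \<in> cbox a b" by (simp add: box_ne_empty mem_box)
    then have "dist x a < ?e" using ab(3) by auto
    then have d: "dist a x < e" "dist a x < \<rho> - norm x" by (auto simp: dist_commute)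
    then have "norm a < \<rho>" using norm_triangle_sub[of a x] by (simp add: dist_norm)
    then show "\<exists>y\<in>X. dist y x < e" using X[of a] ab(1) d by blast
  qed
  then have "ball 0 \<rho> \<subseteq> X" by auto
  then have "closure (ball 0 \<rho>) \<subseteq> X" using assms(1) by (rule closure_minimal)
  moreover have "w \<in> closure (ball 0 \<rho>)" using w \<rho> by simp
  ultimately show ?thesis by blast
qed

text \<open>Over the ball of radius \<open>apex_radius r s H\<close> points of power at most
  \<open>\<tau> j\<close> exist, and by the tail bound all of them lie in the window. So
  \<open>A\<close> and its part in the window have the same minimizers there, and in the ball of
  radius \<open>r\<close> both skeletons are read off from these.\<close>

lemma good_config_skel:
  fixes A :: "('a::euclidean_space \<times> real) set"
  assumes good: "A \<in> good_configs \<tau> H r N" and tail: "A \<inter> tail_set (real H) = {}"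
    and fin: "finite (A \<inter> window \<tau> N)" and \<tau>: "incseq \<tau>"
  shows "laguerre_skel dual A \<inter> cball 0 (real r) = window_skel dual (real N) (window \<tau> N) A \<inter> cball 0 (real r)"
proof -
  let ?W = "window \<tau> N :: ('a \<times> real) set"
  obtain s j where sj: "s \<le> N" "j \<le> N"
    "\<And>J. J \<subseteq> Basis \<Longrightarrow> A \<inter> (?W \<inter> (orthant (1 + real r) J \<inter> {p. norm (fst p) \<le> real s \<and> snd p \<le> real s})) \<noteq> {}"
    "\<And>w. (\<forall>i\<in>Basis. w \<bullet> i \<in> \<rat>) \<Longrightarrow> norm w < apex_radius r s H \<Longrightarrow> A \<inter> (?W \<inter> {p. pow w p \<le> \<tau> j}) \<noteq> {}"
    "tail_bound (apex_radius r s H) (\<tau> j) (real H) \<le> real N" "apex_radius r s H \<le> real N"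
    using good unfolding good_configs_def by auto
  define \<rho> where "\<rho> = apex_radius r s H"
  define B where "B = A \<inter> ?W"
  have sq: "0 \<le> (real r + real s)\<^sup>2" "0 \<le> (real r)\<^sup>2" by simp_all
  have \<rho>: "real r < \<rho>" "\<rho> \<le> real N" "0 < \<rho>"
    "\<rho> = real r + ((real r + real s)\<^sup>2 + real s + (real H + (real r)\<^sup>2)) + 1"
    using sj(6) sq unfolding \<rho>_def apex_radius_def by linarith+
  have surround: "\<exists>q\<in>B. q \<in> orthant (1 + real r) J \<and> norm (fst q) \<le> real s \<and> snd q \<le> real s" if "J \<subseteq> Basis" for J
    using sj(3)[OF that] unfolding B_def by blast
  \<comment> \<open>Covering is assumed at rational points of the open ball; finitely many points
    make the covered set closed, so it extends to the closed ball.\<close>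
  have cover: "\<exists>p\<in>B. pow w p \<le> \<tau> j" if w: "w \<in> cball 0 \<rho>" for w
  proof -
    let ?X = "\<Union>p\<in>B. {w. pow w p \<le> \<tau> j}"
    have "w \<in> ?X"
    proof (rule ball_rational_closure[OF _ _ \<rho>(3)])
      show "closed ?X" using fin unfolding B_def
        by (intro closed_UN ballI closed_Collect_le continuous_pow continuous_intros)
      fix x :: 'a assume "\<forall>i\<in>Basis. x \<bullet> i \<in> \<rat>" "norm x < \<rho>"
      then show "x \<in> ?X" using sj(4)[of x] unfolding B_def \<rho>_def by blast
    qed (use w in simp)
    then show ?thesis by blast
  qed
  have nt: "p \<notin> tail_set (real H)" if "p \<in> A" for p using tail that by blast
  have box: "p \<in> B" if p: "p \<in> A" "w \<in> cball 0 \<rho>" "pow w p \<le> \<tau> j" for p w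
  proof -
    have "norm (fst p) \<le> real N" "- real N \<le> snd p"
      using bounded_of_not_tail[OF nt[OF p(1)], of w \<rho> "\<tau> j"] p sj(5) unfolding \<rho>_def by auto
    moreover have "snd p \<le> \<tau> N"
    proof -
      have "snd p \<le> pow w p" unfolding pow_def by simp
      also have "\<dots> \<le> \<tau> j" by (rule p)
      also have "\<dots> \<le> \<tau> N" using \<tau> sj(2) by (rule incseqD)
      finally show ?thesis .
    qed
    ultimately show ?thesis using p(1) unfolding B_def window_def by simp
  qed
  have BA: "B \<subseteq> A" unfolding B_def by blast
  have min: "minimizers B w = minimizers A w" if w: "w \<in> cball 0 \<rho>" for w
  proof (rule minimizers_restrict[OF BA])
    show "{p \<in> A. pow w p \<le> \<tau> j} \<subseteq> B" using box[OF _ w] by blast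
    show "\<exists>p\<in>A. pow w p \<le> \<tau> j" using cover[OF w] BA by blast
  qed
  have lower: "- (real H + (real r)\<^sup>2) \<le> pow z p" if "p \<in> A" "norm z \<le> real r" for p z
    using pow_ge_of_not_tail[OF nt[OF that(1)] that(2)] by simp
  have ws: "z \<in> window_skel dual (real N) ?W A \<longleftrightarrow> z \<in> local_skel dual (real N) B" if "norm z \<le> real r" for z
  proof -
    have "norm z \<le> real N" using that \<rho> by linarith
    then show ?thesis unfolding window_skel_def using fin unfolding B_def by simp
  qed
  have "z \<in> laguerre_skel dual A \<longleftrightarrow> z \<in> local_skel dual (real N) B" if z: "norm z \<le> real r" for z
  proof (cases dual)
    case False
    have zr: "norm z < \<rho>" using z \<rho> by linarith
    have F: "finite {p \<in> A. \<exists>w\<in>cball 0 \<rho>. pow w p \<le> \<tau> j}"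
    proof (rule finite_subset)
      show "{p \<in> A. \<exists>w\<in>cball 0 \<rho>. pow w p \<le> \<tau> j} \<subseteq> B" using box by blast
      show "finite B" using fin unfolding B_def .
    qed
    have c: "\<exists>p\<in>A. pow w p \<le> \<tau> j" if "w \<in> cball 0 \<rho>" for w using cover[OF that] BA by blast
    have "z \<in> skel (laguerre_diagram A) \<longleftrightarrow> (\<exists>S\<subseteq>minimizers A z. card S = 2)"
      by (rule skel_laguerre_diagram_local[OF F c zr])
    also have "\<dots> \<longleftrightarrow> (\<exists>S\<subseteq>minimizers B z. card S = 2)"
      using min[of z] zr by simp
    finally show ?thesis unfolding laguerre_skel_def local_skel_def using False by simp
  next
    case True
    \<comment> \<open>The apex bound is applied to both configurations: a simplex of
      \<open>A\<close> must have its apex within reach, and \<open>local_skel\<close> by itself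
      would allow apexes as far away as \<open>real N\<close>.\<close>
    have "z \<in> skel (dual_laguerre A) \<longleftrightarrow> z \<in> local_skel True (real N) B"
    proof
      assume "z \<in> skel (dual_laguerre A)"
      then obtain w S p where S: "S \<subseteq> minimizers A w" "card S = DIM('a) + 1" "p \<in> S" "z \<in> convex hull (fst ` (S - {p}))"
        unfolding skel_dual_laguerre by blast
      have "z \<in> convex hull (fst ` S)" using S(4) hull_mono[of "fst ` (S - {p})" "fst ` S"] by blast
      then have "norm w \<le> real r + ((real r + real s)\<^sup>2 + real s + (real H + (real r)\<^sup>2))"
        using surround BA S(1) z by (intro apex_bound[of A _ z _ _ S] lower) blast+
      then have w: "w \<in> cball 0 \<rho>" unfolding \<rho>(4) by simp
      then have "S \<subseteq> minimizers B w" "norm w \<le> real N" using S(1) min[OF w] \<rho>(2) by auto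
      then show "z \<in> local_skel True (real N) B" using S by (intro local_skelI[of S B w]) auto
    next
      assume "z \<in> local_skel True (real N) B"
      then obtain w S p where S: "S \<subseteq> minimizers B w" "card S = DIM('a) + 1" "p \<in> S" "z \<in> convex hull (fst ` (S - {p}))"
        unfolding local_skel_def by auto
      have "z \<in> convex hull (fst ` S)" using S(4) hull_mono[of "fst ` (S - {p})" "fst ` S"] by blast
      then have "norm w \<le> real r + ((real r + real s)\<^sup>2 + real s + (real H + (real r)\<^sup>2))"
        using surround BA S(1) z by (intro apex_bound[of B _ z _ _ S] lower) blast+
      then have w: "w \<in> cball 0 \<rho>" unfolding \<rho>(4) by simp
      then have "S \<subseteq> minimizers A w" using S(1) min[OF w] by auto
      then show "z \<in> skel (dual_laguerre A)" unfolding skel_dual_laguerre using S by blast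
    qed
    then show ?thesis unfolding laguerre_skel_def using True by simp
  qed
  then show ?thesis using ws by auto
qed

text \<open>Choices in the order of dependence: points in the finitely many orthants give
  \<open>s\<close>, this gives the radius, the radius gives a covering level \<open>j\<close>, and
  only then is \<open>N\<close> taken large. In the absence of tail points the covering points fall
  into the window.\<close>

lemma eventually_good_config:
  fixes A :: "('a::euclidean_space \<times> real) set"
  assumes \<tau>: "incseq \<tau>" and tail: "A \<inter> tail_set (real H) = {}"
    and surround: "\<And>J. J \<subseteq> Basis \<Longrightarrow> \<exists>q\<in>A. q \<in> orthant (1 + real r) J \<and> snd q \<le> \<tau> j0"
    and cover: "\<And>\<rho>. \<exists>j. \<forall>w\<in>cball 0 \<rho>. \<exists>p\<in>A. pow w p \<le> \<tau> j"
  shows "\<forall>\<^sub>F N in sequentially. A \<in> good_configs \<tau> H r N"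
proof -
  have "\<forall>J\<in>Pow Basis. \<exists>q. q \<in> A \<and> q \<in> orthant (1 + real r) J \<and> snd q \<le> \<tau> j0" using surround by blast
  from bchoice[OF this] obtain q where q: "\<forall>J\<in>Pow Basis. q J \<in> A \<and> q J \<in> orthant (1 + real r) J \<and> snd (q J) \<le> \<tau> j0" ..
  define s where "s = Max ((\<lambda>J. nat \<lceil>norm (fst (q J)) + \<bar>snd (q J)\<bar>\<rceil>) ` Pow Basis)"
  have s: "norm (fst (q J)) \<le> real s \<and> \<bar>snd (q J)\<bar> \<le> real s" if "J \<in> Pow Basis" for J
  proof -
    have "nat \<lceil>norm (fst (q J)) + \<bar>snd (q J)\<bar>\<rceil> \<le> s"
      unfolding s_def by (rule Max_ge) (use that in auto)
    then have "norm (fst (q J)) + \<bar>snd (q J)\<bar> \<le> real s" by linarith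
    then show ?thesis using norm_ge_zero[of "fst (q J)"] abs_ge_zero[of "snd (q J)"] by linarith
  qed
  define \<rho> where "\<rho> = apex_radius r s H"
  obtain j1 where j1: "\<forall>w\<in>cball 0 \<rho>. \<exists>p\<in>A. pow w p \<le> \<tau> j1" using cover by blast
  define j where "j = max j0 j1"
  have tj: "\<tau> j0 \<le> \<tau> j" "\<tau> j1 \<le> \<tau> j" using \<tau> by (auto simp: j_def intro: incseqD)
  define n0 where "n0 = nat \<lceil>tail_bound \<rho> (\<tau> j) (real H)\<rceil> + nat \<lceil>\<rho>\<rceil> + s + j"
  have "A \<in> good_configs \<tau> H r N" if N: "N \<ge> n0" for N
  proof -
    have N1: "tail_bound \<rho> (\<tau> j) (real H) \<le> real N" "\<rho> \<le> real N" "s \<le> N" "j \<le> N"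
      using N unfolding n0_def by linarith+
    have tN: "\<tau> j \<le> \<tau> N" using \<tau> N1(4) by (rule incseqD)
    have nt: "p \<notin> tail_set (real H)" if "p \<in> A" for p using tail that by blast
    show ?thesis
      unfolding good_configs_def
    proof (rule CollectI, rule bexI[of _ s], rule bexI[of _ j], intro conjI ballI)
      fix J :: "'a set" assume J: "J \<in> Pow Basis"
      have qJ: "q J \<in> A" "q J \<in> orthant (1 + real r) J" "snd (q J) \<le> \<tau> j0" using q J by blast+
      have "norm (fst (q J)) \<le> real N" "- real N \<le> snd (q J)" "snd (q J) \<le> \<tau> N"
        using s[OF J] N1(3) tN tj(1) qJ(3) by linarith+
      then have "q J \<in> window \<tau> N" unfolding window_def by simp
      moreover have "snd (q J) \<le> real s" using s[OF J] by linarith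
      ultimately have "q J \<in> A \<inter> (window \<tau> N \<inter> (orthant (1 + real r) J \<inter> {p. norm (fst p) \<le> real s \<and> snd p \<le> real s}))"
        using qJ s[OF J] by blast
      then show "A \<inter> (window \<tau> N \<inter> (orthant (1 + real r) J \<inter> {p. norm (fst p) \<le> real s \<and> snd p \<le> real s})) \<noteq> {}"
        by blast
    next
      fix w :: 'a assume "w \<in> {w. \<forall>i\<in>Basis. w \<bullet> i \<in> \<rat>} \<inter> ball 0 (apex_radius r s H)"
      then have w: "w \<in> cball 0 \<rho>" unfolding \<rho>_def by simp
      then obtain p where p: "p \<in> A" "pow w p \<le> \<tau> j1" using j1 by blast
      then have pj: "pow w p \<le> \<tau> j" using tj by linarith
      have "norm (fst p) \<le> real N" "- real N \<le> snd p"
        using bounded_of_not_tail[OF nt[OF p(1)], of w \<rho> "\<tau> j"] w pj N1(1) by auto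
      moreover have "snd p \<le> \<tau> N"
      proof -
        have "snd p \<le> pow w p" unfolding pow_def by simp
        then show ?thesis using pj tN by linarith
      qed
      ultimately have "p \<in> A \<inter> (window \<tau> N \<inter> {p. pow w p \<le> \<tau> j})"
        using p(1) pj unfolding window_def by simp
      then show "A \<inter> (window \<tau> N \<inter> {p. pow w p \<le> \<tau> j}) \<noteq> {}" by blast
    qed (use N1 in \<open>auto simp: \<rho>_def\<close>)
  qed
  then show ?thesis unfolding eventually_sequentially by blast
qed

section \<open>Almost sure properties of a single process\<close>

text \<open>A single escape is claimed, so convergence of the measures to 0 suffices in place of
  Borel-Cantelli: the intersection lies in each \<open>B n\<close> with
  \<open>n \<ge> n0\<close>.\<close>

lemma AE_eventually_notin:
  assumes "finite_measure M" and B: "\<And>n. B n \<in> sets M" and lim: "(\<lambda>n. measure M (B n)) \<longlonglongrightarrow> 0"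
  shows "AE \<omega> in M. \<exists>n\<ge>n0. \<omega> \<notin> B n"
proof -
  interpret finite_measure M by fact
  let ?I = "\<Inter>n\<in>{n0..}. B n"
  have I: "?I \<in> sets M" using B by (intro sets.countable_INT') auto
  have "measure M ?I \<le> measure M (B n)" if "n \<ge> n0" for n
    using B that by (intro finite_measure_mono) auto
  then have "measure M ?I \<le> 0"
    by (intro LIMSEQ_le_const[OF lim]) auto
  then have "measure M ?I = 0" using measure_nonneg[of M ?I] by linarith
  then have "?I \<in> null_sets M" using I by (intro null_setsI) (simp_all add: emeasure_eq_measure)
  then have "AE \<omega> in M. \<omega> \<notin> ?I" by (rule AE_not_in)
  then show ?thesis by eventually_elim auto
qed

text \<open>The unions of \<open>B m\<close> over \<open>m \<ge> n\<close> decrease to the limit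
  superior, which is null; continuity from above bounds \<open>B n\<close>.\<close>

lemma measure_tendsto_0_of_AE:
  assumes "finite_measure M" and B: "\<And>n. B n \<in> sets M"
    and ev: "AE \<omega> in M. \<forall>\<^sub>F n in sequentially. \<omega> \<notin> B n"
  shows "(\<lambda>n. measure M (B n)) \<longlonglongrightarrow> 0"
proof -
  interpret finite_measure M by fact
  let ?Y = "\<lambda>n. \<Union>m\<in>{n..}. B m"
  have Y: "?Y n \<in> sets M" for n using B by auto
  have "(\<lambda>n. measure M (?Y n)) \<longlonglongrightarrow> measure M (\<Inter>n. ?Y n)"
    using Y by (intro finite_Lim_measure_decseq) (auto simp: decseq_def intro: order_trans)
  moreover have "measure M (\<Inter>n. ?Y n) = 0"
  proof -
    have "AE \<omega> in M. \<omega> \<notin> (\<Inter>n. ?Y n)"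
      using ev by eventually_elim (auto simp: eventually_sequentially)
    moreover have "(\<Inter>n. ?Y n) \<in> sets M" using Y by auto
    ultimately have "(\<Inter>n. ?Y n) \<in> null_sets M" by (simp add: AE_iff_null_sets)
    then show ?thesis by (simp add: measure_def null_sets_def)
  qed
  ultimately have lim: "(\<lambda>n. measure M (?Y n)) \<longlonglongrightarrow> 0" by simp
  have "measure M (B n) \<le> measure M (?Y n)" for n
    using Y by (intro finite_measure_mono) auto
  then show ?thesis
    by (intro tendsto_sandwich[OF _ _ tendsto_const lim]) auto
qed

section \<open>Consequences of admissibility\<close>

lemma admissible_measurable: "admissible d E f \<Longrightarrow> f \<in> borel_measurable lebesgue"
  unfolding admissible_def by (elim conjE) (rule L1loc_plus_measurable)

lemma admissible_nonneg: "admissible d E f \<Longrightarrow> 0 \<le> f x"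
  unfolding admissible_def L1loc_plus_def by simp

text \<open>The sequence climbs through \<open>E\<close>. The last alternative prepares the covering
  argument: either arbitrarily high levels are available, or \<open>E\<close> ends at some
  \<open>b\<close>, which the levels approach without reaching it.\<close>

lemma admissible_levels:
  assumes "(\<exists>a. E = {a..}) \<or> (\<exists>b. E = {..<b}) \<or> E = (UNIV :: real set)"
  obtains \<tau> :: "nat \<Rightarrow> real" where "incseq \<tau>" "\<forall>N. \<tau> N \<in> E" "\<forall>t\<in>E. \<exists>N. t \<le> \<tau> N"
    "(\<exists>b. E = {..<b}) \<or> (\<forall>t. \<exists>N. t \<le> \<tau> N)"
proof -
  have arch: "\<exists>N::nat. t \<le> c + real N" for t c :: real
    using real_arch_simple[of "t - c"] by (auto simp: algebra_simps)
  consider a where "E = {a..}" | b where "E = {..<b}" | "E = UNIV" using assms by blast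
  then show thesis
  proof cases
    case 1
    show thesis
      by (rule that[of "\<lambda>N. a + real N"]) (auto simp: incseq_def 1 arch)
  next
    case 2
    show thesis
    proof (rule that[of "\<lambda>N. b - 1 / real (Suc N)"])
      show "incseq (\<lambda>N. b - 1 / real (Suc N))" by (auto simp: incseq_def frac_le)
      show "\<forall>N. b - 1 / real (Suc N) \<in> E" unfolding 2 by simp
      show "\<forall>t\<in>E. \<exists>N. t \<le> b - 1 / real (Suc N)"
      proof
        fix t assume "t \<in> E"
        then have "0 < b - t" unfolding 2 by simp
        then obtain N :: nat where "1 / real (Suc N) < b - t" by (rule nat_approx_posE)
        then show "\<exists>N. t \<le> b - 1 / real (Suc N)" by (intro exI[of _ N]) simp
      qed
      show "(\<exists>b. E = {..<b}) \<or> (\<forall>t. \<exists>N. t \<le> b - 1 / real (Suc N))" using 2 by blast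
    qed
  next
    case 3
    show thesis
      by (rule that[of "\<lambda>N. 0 + real N"]) (auto simp: incseq_def 3 intro: arch[of _ 0, simplified])
  qed
qed

text \<open>\<open>E\<close> has no greatest element, so there is some \<open>t' > t\<close> in
  \<open>E\<close>; for \<open>h \<le> t\<close> the kernel of the fractional integral at
  \<open>t'\<close> is at least \<open>(t' - t) powr (d / 2)\<close>.\<close>

lemma admissible_mono_integral:
  assumes adm: "admissible d E f" and t: "t \<in> E"
  shows "(\<integral>\<^sup>+h\<in>{..t}. ennreal (f h) \<partial>lebesgue) < \<infinity>"
proof -
  note f = admissible_measurable[OF adm] admissible_nonneg[OF adm]
  have "(\<exists>a. E = {a..}) \<or> (\<exists>b. E = {..<b}) \<or> E = UNIV" using adm unfolding admissible_def by blast
  then have "\<exists>t'\<in>E. t < t'"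
  proof (elim disjE exE)
    fix a assume "E = {a..}"
    then show ?thesis using t by (intro bexI[of _ "t + 1"]) auto
  next
    fix b assume "E = {..<b}"
    then show ?thesis using t by (intro bexI[of _ "(t + b) / 2"]) auto
  next
    assume "E = UNIV"
    then show ?thesis by (intro bexI[of _ "t + 1"]) auto
  qed
  then obtain t' where t': "t' \<in> E" "t < t'" by blast
  let ?\<alpha> = "real d / 2 + 1"
  let ?I = "\<integral>\<^sup>+h\<in>{..<t'}. ennreal (f h * (t' - h) powr (?\<alpha> - 1)) \<partial>lebesgue"
  have G: "Gamma ?\<alpha> > 0" by (intro Gamma_real_pos) (simp add: add_nonneg_pos)
  have "frac_integral ?\<alpha> f t' < \<infinity>" using adm t'(1) unfolding admissible_def by blast
  then have I: "?I < \<infinity>"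
    unfolding frac_integral_def using G by (auto simp: ennreal_mult_less_top)
  let ?c = "(t' - t) powr (?\<alpha> - 1)"
  have c: "?c > 0" using t' by simp
  have "(\<integral>\<^sup>+h\<in>{..t}. ennreal (f h) \<partial>lebesgue) \<le> (\<integral>\<^sup>+h. ennreal (1 / ?c) * (ennreal (f h * (t' - h) powr (?\<alpha> - 1)) * indicator {..<t'} h) \<partial>lebesgue)"
  proof (intro nn_integral_mono)
    fix h
    show "ennreal (f h) * indicator {..t} h \<le> ennreal (1 / ?c) * (ennreal (f h * (t' - h) powr (?\<alpha> - 1)) * indicator {..<t'} h)"
    proof (cases "h \<le> t")
      case True
      have "?c \<le> (t' - h) powr (?\<alpha> - 1)" using True t' by (intro powr_mono2) auto
      then have "f h * ?c \<le> f h * (t' - h) powr (?\<alpha> - 1)" using f(2) by (intro mult_left_mono)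
      then have "f h \<le> 1 / ?c * (f h * (t' - h) powr (?\<alpha> - 1))" using c by (simp add: field_simps)
      then have "ennreal (f h) \<le> ennreal (1 / ?c * (f h * (t' - h) powr (?\<alpha> - 1)))" by (rule ennreal_leI)
      also have "\<dots> = ennreal (1 / ?c) * ennreal (f h * (t' - h) powr (?\<alpha> - 1))"
        using c f(2)[of h] by (intro ennreal_mult) auto
      finally show ?thesis using True t' by simp
    qed simp
  qed
  also have "\<dots> = ennreal (1 / ?c) * ?I"
  proof (intro nn_integral_cmult borel_measurable_times_ennreal borel_measurable_indicator)
    have "(\<lambda>h. (t' - h) powr (?\<alpha> - 1)) \<in> borel_measurable lebesgue"
      by (rule measurable_completion) measurable
    then have "(\<lambda>h. f h * (t' - h) powr (?\<alpha> - 1)) \<in> borel_measurable lebesgue"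
      by (rule borel_measurable_times[OF f(1)])
    then show "(\<lambda>h. ennreal (f h * (t' - h) powr (?\<alpha> - 1))) \<in> borel_measurable lebesgue"
      by (rule measurable_compose[OF _ measurable_ennreal])
  qed (simp add: sets_completionI_sets)
  also have "\<dots> < \<infinity>" using I by (simp add: ennreal_mult_less_top)
  finally show ?thesis .
qed

text \<open>From \<open>h \<le> - (2 * \<bar>t\<bar>)\<close> follows
  \<open>\<bar>h\<bar> \<le> 2 * (t - h)\<close>, so the moment of order \<open>d / 2\<close> is
  controlled by the kernel of the fractional integral at \<open>t\<close>.\<close>

lemma admissible_tail_finite:
  assumes adm: "admissible DIM('a) E f" and t: "t \<in> E"
  shows "emeasure (intensity f) (tail_set (2 * \<bar>t\<bar>) :: ('a::euclidean_space \<times> real) set) < \<infinity>"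
proof -
  note f = admissible_measurable[OF adm] admissible_nonneg[OF adm]
  let ?d = "real DIM('a) / 2"
  let ?I = "\<integral>\<^sup>+h\<in>{..<t}. ennreal (f h * (t - h) powr ((?d + 1) - 1)) \<partial>lebesgue"
  have G: "Gamma (?d + 1) > 0" by (intro Gamma_real_pos) (simp add: add_nonneg_pos)
  have "frac_integral (?d + 1) f t < \<infinity>" using adm t unfolding admissible_def by blast
  then have I: "?I < \<infinity>"
    unfolding frac_integral_def using G by (auto simp: ennreal_mult_less_top)
  have "(\<integral>\<^sup>+h\<in>{..-(2 * \<bar>t\<bar>)}. ennreal (\<bar>h\<bar> powr ?d * f h) \<partial>lebesgue) \<le>
    (\<integral>\<^sup>+h. ennreal (2 powr ?d) * (ennreal (f h * (t - h) powr ((?d + 1) - 1)) * indicator {..<t} h) \<partial>lebesgue)"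
  proof (intro nn_integral_mono)
    fix h
    show "ennreal (\<bar>h\<bar> powr ?d * f h) * indicator {..-(2 * \<bar>t\<bar>)} h \<le>
      ennreal (2 powr ?d) * (ennreal (f h * (t - h) powr ((?d + 1) - 1)) * indicator {..<t} h)"
    proof (cases "h \<le> - (2 * \<bar>t\<bar>)")
      case True
      show ?thesis
      proof (cases "h < t")
        case ht: True
        have "\<bar>h\<bar> powr ?d \<le> (2 * (t - h)) powr ?d" using True by (intro powr_mono2) auto
        also have "\<dots> = 2 powr ?d * (t - h) powr ?d" by (rule powr_mult)
        finally have "\<bar>h\<bar> powr ?d * f h \<le> (2 powr ?d * (t - h) powr ?d) * f h"
          using f(2) by (intro mult_right_mono)
        then have "ennreal (\<bar>h\<bar> powr ?d * f h) \<le> ennreal (2 powr ?d * (f h * (t - h) powr ((?d + 1) - 1)))"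
          by (intro ennreal_leI) (simp add: mult_ac)
        also have "\<dots> = ennreal (2 powr ?d) * ennreal (f h * (t - h) powr ((?d + 1) - 1))"
          using f(2)[of h] by (intro ennreal_mult) auto
        finally show ?thesis using True ht by simp
      next
        case False
        then have "h = 0" using True by auto
        then show ?thesis by simp
      qed
    qed simp
  qed
  also have "\<dots> = ennreal (2 powr ?d) * ?I"
  proof (intro nn_integral_cmult borel_measurable_times_ennreal borel_measurable_indicator)
    have "(\<lambda>h. (t - h) powr ((?d + 1) - 1)) \<in> borel_measurable lebesgue"
      by (rule measurable_completion) measurable
    then have "(\<lambda>h. f h * (t - h) powr ((?d + 1) - 1)) \<in> borel_measurable lebesgue"
      by (rule borel_measurable_times[OF f(1)])
    then show "(\<lambda>h. ennreal (f h * (t - h) powr ((?d + 1) - 1))) \<in> borel_measurable lebesgue"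
      by (rule measurable_compose[OF _ measurable_ennreal])
  qed (simp add: sets_completionI_sets)
  also have "\<dots> < \<infinity>" using I by (simp add: ennreal_mult_less_top)
  finally show ?thesis
    by (subst emeasure_intensity_tail_set[OF f]) (simp_all add: ennreal_mult_less_top)
qed

lemma admissible_tail_tendsto:
  assumes adm: "admissible DIM('a) E f"
  shows "(\<lambda>n. emeasure (intensity f) (tail_set (real n) :: ('a::euclidean_space \<times> real) set)) \<longlonglongrightarrow> 0"
proof -
  have "(\<exists>a. E = {a..}) \<or> (\<exists>b. E = {..<b}) \<or> E = UNIV" using adm unfolding admissible_def by blast
  then obtain t where t: "t \<in> E" using admissible_levels by metis
  obtain n0 :: nat where n0: "2 * \<bar>t\<bar> \<le> real n0" using real_arch_simple by blast
  let ?\<Lambda> = "intensity f :: ('a \<times> real) measure"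
  have T: "tail_set (real n) \<in> sets ?\<Lambda>" for n by (simp add: borel_closed closed_tail_set)
  have fin: "emeasure ?\<Lambda> (tail_set (real (n + n0))) \<noteq> \<infinity>" for n
  proof -
    have "emeasure ?\<Lambda> (tail_set (real (n + n0))) \<le> emeasure ?\<Lambda> (tail_set (2 * \<bar>t\<bar>))"
      using n0 by (intro emeasure_mono tail_set_antimono) (simp_all add: borel_closed closed_tail_set)
    then show ?thesis using admissible_tail_finite[OF adm t] by (auto simp: less_top)
  qed
  have "(\<lambda>n. emeasure ?\<Lambda> (tail_set (real (n + n0)))) \<longlonglongrightarrow> emeasure ?\<Lambda> (\<Inter>n. tail_set (real (n + n0)))"
    using fin T[of "_ + n0"]
    by (intro Lim_emeasure_decseq) (auto simp: decseq_def closed_tail_set intro!: tail_set_antimono)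
  moreover have "(\<Inter>n. tail_set (real (n + n0))) = ({} :: ('a \<times> real) set)"
  proof (intro equalityI subsetI)
    fix p :: "'a \<times> real" assume p: "p \<in> (\<Inter>n. tail_set (real (n + n0)))"
    obtain n :: nat where "- snd p < real n" using reals_Archimedean2 by blast
    moreover have "snd p \<le> - real (n + n0)" using p unfolding tail_set_def by auto
    ultimately show "p \<in> {}" by simp
  qed simp
  ultimately have "(\<lambda>n. emeasure ?\<Lambda> (tail_set (real (n + n0)))) \<longlonglongrightarrow> 0" by simp
  then show ?thesis by (rule LIMSEQ_offset)
qed

lemma poisson_AE_tail:
  fixes \<eta> :: "'w \<Rightarrow> ('a::euclidean_space \<times> real) set"
  assumes P: "poisson_process M (intensity f) \<eta>" and adm: "admissible DIM('a) E f"
  shows "AE \<omega> in M. \<exists>H::nat. \<eta> \<omega> \<inter> tail_set (real H) = {}"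
proof -
  interpret prob_space M using P by (rule poisson_process_prob_space)
  let ?\<Lambda> = "intensity f :: ('a \<times> real) measure"
  let ?B = "\<lambda>H::nat. {\<omega> \<in> space M. \<eta> \<omega> \<inter> tail_set (real H) \<noteq> {}}"
  have T: "tail_set (real n) \<in> sets (borel :: ('a \<times> real) measure)" for n by (simp add: borel_closed closed_tail_set)
  have le: "ennreal (prob (?B H)) \<le> emeasure ?\<Lambda> (tail_set (real H))" for H
  proof (cases "emeasure ?\<Lambda> (tail_set (real H)) < \<infinity>")
    case True
    have "ennreal (prob (?B H)) \<le> ennreal (measure ?\<Lambda> (tail_set (real H)))"
      using poisson_process_hit_prob_le[OF P T True] by (rule ennreal_leI)
    then show ?thesis using True by (subst emeasure_eq_ennreal_measure) auto
  next
    case False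
    then show ?thesis by (simp add: not_less top_unique)
  qed
  have "(\<lambda>H. ennreal (prob (?B H))) \<longlonglongrightarrow> 0"
    by (rule tendsto_sandwich[OF _ _ tendsto_const admissible_tail_tendsto[OF adm]]) (auto simp: le)
  then have "(\<lambda>H. prob (?B H)) \<longlonglongrightarrow> 0"
    by (simp add: ennreal_tendsto_0_iff)
  then have "AE \<omega> in M. \<exists>n\<ge>0. \<omega> \<notin> ?B n"
    using poisson_process_hit_sets(2)[OF P T] by (intro AE_eventually_notin finite_measure_axioms)
  then show ?thesis using AE_space by eventually_elim auto
qed


text \<open>With \<open>x = \<kappa> * real n powr \<epsilon>\<close> and
  \<open>m \<ge> d / \<epsilon>\<close> the polynomial factor is at most a constant times
  \<open>x ^ m\<close>, and \<open>x ^ m / exp x\<close> tends to 0. The 5 comes from the count of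
  grid points, \<open>2 * \<lceil>y\<rceil> + 3 \<le> 2 * y + 5\<close>.\<close>

lemma power_exp_powr_tendsto_0:
  fixes a \<kappa> \<epsilon> :: real
  assumes "0 \<le> a" "0 < \<kappa>" "0 < \<epsilon>"
  shows "(\<lambda>n. (a * real n + 5) ^ d * exp (- (\<kappa> * real n powr \<epsilon>))) \<longlonglongrightarrow> 0"
proof -
  obtain m :: nat where m: "real d / \<epsilon> \<le> real m" using real_arch_simple by blast
  let ?x = "\<lambda>n::nat. \<kappa> * real n powr \<epsilon>"
  have "filterlim (\<lambda>n::nat. real n powr \<epsilon>) at_top sequentially"
  proof (rule filterlim_cong[OF refl refl, THEN iffD1])
    show "\<forall>\<^sub>F n in sequentially. exp (\<epsilon> * ln (real n)) = real n powr \<epsilon>"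
      using eventually_gt_at_top[of 0] by eventually_elim (simp add: powr_def)
    show "filterlim (\<lambda>n::nat. exp (\<epsilon> * ln (real n))) at_top sequentially"
      using assms(3) by (intro filterlim_compose[OF exp_at_top]
        filterlim_tendsto_pos_mult_at_top[OF tendsto_const]
        filterlim_compose[OF ln_at_top filterlim_real_sequentially])
  qed
  then have x: "filterlim ?x at_top sequentially"
    using assms(2) by (intro filterlim_tendsto_pos_mult_at_top[OF tendsto_const])
  have "(\<lambda>n. ((a + 5) ^ d / \<kappa> ^ m) * (?x n ^ m / exp (?x n))) \<longlonglongrightarrow> ((a + 5) ^ d / \<kappa> ^ m) * 0"
    by (intro tendsto_intros filterlim_compose[OF tendsto_power_div_exp_0 x])
  then have lim: "(\<lambda>n. ((a + 5) ^ d / \<kappa> ^ m) * (?x n ^ m / exp (?x n))) \<longlonglongrightarrow> 0" by simp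
  show ?thesis
  proof (rule tendsto_sandwich[OF _ _ tendsto_const lim])
    show "\<forall>\<^sub>F n in sequentially. 0 \<le> (a * real n + 5) ^ d * exp (- ?x n)"
      using assms(1) by (intro always_eventually) auto
    show "\<forall>\<^sub>F n in sequentially. (a * real n + 5) ^ d * exp (- ?x n) \<le> ((a + 5) ^ d / \<kappa> ^ m) * (?x n ^ m / exp (?x n))"
      using eventually_gt_at_top[of 0]
    proof eventually_elim
      case (elim n)
      have n: "1 \<le> real n" using elim by simp
      have "a * real n + 5 \<le> (a + 5) * real n" using n assms(1) by (simp add: algebra_simps)
      then have "(a * real n + 5) ^ d \<le> ((a + 5) * real n) ^ d" using assms(1) by (intro power_mono) auto
      also have "\<dots> = (a + 5) ^ d * real n powr (real d)" using n by (simp add: power_mult_distrib powr_realpow)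
      also have "\<dots> \<le> (a + 5) ^ d * (?x n ^ m / \<kappa> ^ m)"
      proof (intro mult_left_mono)
        have "real n powr (real d) \<le> real n powr (\<epsilon> * real m)"
          using n m assms(3) by (intro powr_mono) (auto simp: field_simps)
        also have "\<dots> = (real n powr \<epsilon>) ^ m"
          using n by (simp add: powr_powr[symmetric] powr_realpow)
        also have "\<dots> = ?x n ^ m / \<kappa> ^ m"
          using assms(2) by (simp add: power_mult_distrib)
        finally show "real n powr (real d) \<le> ?x n ^ m / \<kappa> ^ m" .
      qed (use assms(1) in simp)
      finally have "(a * real n + 5) ^ d \<le> (a + 5) ^ d * (?x n ^ m / \<kappa> ^ m)" .
      then have "(a * real n + 5) ^ d * exp (- ?x n) \<le> (a + 5) ^ d * (?x n ^ m / \<kappa> ^ m) * exp (- ?x n)"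
        by (intro mult_right_mono) auto
      then show ?case by (simp only: exp_minus divide_inverse mult_ac)
    qed
  qed
qed

lemma pow_le_of_near:
  fixes w g :: "'a::euclidean_space"
  shows "pow w p \<le> pow g p + norm (w - g) * (norm (w - fst p) + norm (g - fst p))"
proof -
  let ?a = "norm (w - fst p)" and ?b = "norm (g - fst p)"
  have "?a - ?b \<le> norm (w - g)" using norm_triangle_ineq2[of "w - fst p" "g - fst p"] by simp
  then have "(?a - ?b) * (?a + ?b) \<le> norm (w - g) * (?a + ?b)" by (intro mult_right_mono) auto
  moreover have "(?a - ?b) * (?a + ?b) = ?a\<^sup>2 - ?b\<^sup>2" by (simp add: power2_eq_square algebra_simps)
  ultimately show ?thesis unfolding pow_def by linarith
qed

text \<open>A union bound over a grid of mesh proportional to \<open>1 / n\<close>: polynomially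
  many grid points, each left uncovered at level \<open>b - 1 / n\<close> with probability at most
  \<open>exp (- (\<kappa> * real n powr \<epsilon>))\<close>. Almost surely some such grid is
  completely covered, and then the whole ball is covered at the slightly higher level
  \<open>b - 1 / (2 * n)\<close>.\<close>

lemma poisson_AE_cover_bounded:
  fixes \<eta> :: "'w \<Rightarrow> ('a::euclidean_space \<times> real) set" and k H :: nat
  assumes P: "poisson_process M (intensity f) \<eta>"
    and f: "f \<in> borel_measurable lebesgue" "\<And>x. 0 \<le> f x"
    and \<epsilon>: "\<epsilon> > 0" and I: "\<And>n::nat. n > n0 \<Longrightarrow>
      ennreal (real n powr \<epsilon>) \<le> frac_integral (real DIM('a) / 2 + 1) f (b - 1 / real n)"
  shows "AE \<omega> in M. \<eta> \<omega> \<inter> tail_set (real H) = {} \<longrightarrow>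
    (\<exists>t<b. \<forall>w\<in>cball 0 (real k). \<exists>p\<in>\<eta> \<omega>. pow w p \<le> t)"
proof -
  interpret prob_space M using P by (rule poisson_process_prob_space)
  let ?d = "real DIM('a)"
  define \<kappa> where "\<kappa> = unit_ball_vol ?d * Gamma (?d / 2 + 1)"
  \<comment> \<open>Radius \<open>k + 1\<close> because grid points may leave the ball, by at most
    1; level \<open>b\<close> because it exceeds all levels used.\<close>
  define R where "R = tail_bound (real k + 1) b (real H)"
  \<comment> \<open>This makes \<open>?d / (c * n)\<close> equal to
    \<open>1 / (4 * (k + R + 2) * n)\<close>. The distances of \<open>w\<close> and its grid point
    to the nucleus add up to at most \<open>2 * (k + R + 2)\<close>, so the power rises by at most
    \<open>1 / (2 * n)\<close>.\<close>
  define c where "c = 4 * ?d * (real k + R + 2)"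
  define G where "G n = grid_round (c * real n) ` cball (0::'a) (real k)" for n :: nat
  define B where "B n = (if n > n0 then \<Union>g\<in>G n. {\<omega> \<in> space M. \<eta> \<omega> \<inter> {p. pow g p \<le> b - 1 / real n} = {}} else {})" for n
  have \<kappa>: "\<kappa> > 0"
    unfolding \<kappa>_def by (intro mult_pos_pos unit_ball_vol_pos Gamma_real_pos) (auto simp: add_nonneg_pos)
  have R: "R \<ge> 0" unfolding R_def tail_bound_def by (auto intro!: add_nonneg_nonneg)
  have d: "?d \<ge> 1" using DIM_positive[where 'a = 'a] by linarith
  have c: "c \<ge> 4 * ?d" "c > 0"
  proof -
    show "c \<ge> 4 * ?d" unfolding c_def using R d by (simp add: mult_le_cancel_left1)
    then show "c > 0" using d by linarith
  qed
  have cn: "c * real n > 0" if "n > n0" for n using c that by simp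
  have G: "finite (G n)" "card (G n) \<le> nat (2 * \<lceil>c * real n * real k\<rceil> + 3) ^ DIM('a)" if "n > n0" for n
    unfolding G_def using grid_round_image[OF cn[OF that], of "cball (0::'a) (real k)" "real k"] by auto
  note S = emeasure_intensity_pow_le[OF f, where 'a = 'a]
  have Bm: "B n \<in> sets M" for n
    unfolding B_def using G(1) poisson_process_hit_sets(1)[OF P S(1)] by auto
  have Bp: "prob (B n) \<le> (2 * c * real k * real n + 5) ^ DIM('a) * exp (- (\<kappa> * real n powr \<epsilon>))" if n: "n > n0" for n
  proof -
    have single: "prob {\<omega> \<in> space M. \<eta> \<omega> \<inter> {p. pow g p \<le> b - 1 / real n} = {}} \<le> exp (- (\<kappa> * real n powr \<epsilon>))" for g
    proof (rule poisson_process_void_prob_le[OF P S(1)])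
      have "ennreal (\<kappa> * real n powr \<epsilon>) = ennreal \<kappa> * ennreal (real n powr \<epsilon>)"
        using \<kappa> by (intro ennreal_mult) auto
      also have "\<dots> \<le> ennreal \<kappa> * frac_integral (?d / 2 + 1) f (b - 1 / real n)"
        by (intro mult_left_mono I[OF n]) simp
      also have "\<dots> = emeasure (intensity f) {p. pow g p \<le> b - 1 / real n}"
        unfolding S(2) \<kappa>_def ..
      finally show "ennreal (\<kappa> * real n powr \<epsilon>) \<le> emeasure (intensity f) {p. pow g p \<le> b - 1 / real n}" .
    qed
    have "prob (B n) \<le> (\<Sum>g\<in>G n. prob {\<omega> \<in> space M. \<eta> \<omega> \<inter> {p. pow g p \<le> b - 1 / real n} = {}})"
      unfolding B_def using n G(1)[OF n] poisson_process_hit_sets(1)[OF P S(1)]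
      by (auto intro!: finite_measure_subadditive_finite)
    also have "\<dots> \<le> (\<Sum>g\<in>G n. exp (- (\<kappa> * real n powr \<epsilon>)))" by (intro sum_mono single)
    also have "\<dots> = real (card (G n)) * exp (- (\<kappa> * real n powr \<epsilon>))" by simp
    also have "real (card (G n)) \<le> (2 * c * real k * real n + 5) ^ DIM('a)"
    proof -
      have "real (card (G n)) \<le> real (nat (2 * \<lceil>c * real n * real k\<rceil> + 3) ^ DIM('a))"
        using G(2)[OF n] by (simp only: of_nat_le_iff)
      also have "\<dots> = real (nat (2 * \<lceil>c * real n * real k\<rceil> + 3)) ^ DIM('a)" by simp
      also have "\<dots> \<le> (2 * c * real k * real n + 5) ^ DIM('a)"
      proof (intro power_mono)
        have "0 \<le> c * real n * real k" using c by simp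
        then have "real (nat (2 * \<lceil>c * real n * real k\<rceil> + 3)) \<le> 2 * (c * real n * real k) + 5" by linarith
        then show "real (nat (2 * \<lceil>c * real n * real k\<rceil> + 3)) \<le> 2 * c * real k * real n + 5"
          by (simp add: mult_ac)
      qed simp
      finally show ?thesis .
    qed
    finally show ?thesis by (simp add: mult_right_mono)
  qed
  have "(\<lambda>n. prob (B n)) \<longlonglongrightarrow> 0"
  proof (rule tendsto_sandwich[OF _ _ tendsto_const])
    show "(\<lambda>n. (2 * c * real k * real n + 5) ^ DIM('a) * exp (- (\<kappa> * real n powr \<epsilon>))) \<longlonglongrightarrow> 0"
      using c \<kappa> \<epsilon> by (intro power_exp_powr_tendsto_0) auto
    show "\<forall>\<^sub>F n in sequentially. prob (B n) \<le> (2 * c * real k * real n + 5) ^ DIM('a) * exp (- (\<kappa> * real n powr \<epsilon>))"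
      using eventually_gt_at_top[of n0] by eventually_elim (rule Bp)
  qed simp
  then have "AE \<omega> in M. \<exists>n\<ge>Suc n0. \<omega> \<notin> B n" by (intro AE_eventually_notin finite_measure_axioms Bm)
  then show ?thesis
    using AE_space
  proof eventually_elim
    case (elim \<omega>)
    then obtain n where n: "n > n0" "\<omega> \<notin> B n" by (auto simp: Suc_le_eq)
    show ?case
    proof
      assume tail: "\<eta> \<omega> \<inter> tail_set (real H) = {}"
      have n1: "real n \<ge> 1" using n(1) by simp
      show "\<exists>t<b. \<forall>w\<in>cball 0 (real k). \<exists>p\<in>\<eta> \<omega>. pow w p \<le> t"
      proof (intro exI[of _ "b - 1 / (2 * real n)"] conjI ballI)
        show "b - 1 / (2 * real n) < b" using n1 by simp
        fix w :: 'a assume w: "w \<in> cball 0 (real k)"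
        define g where "g = grid_round (c * real n) w"
        have "g \<in> G n" unfolding G_def g_def using w by blast
        then have "\<eta> \<omega> \<inter> {p. pow g p \<le> b - 1 / real n} \<noteq> {}"
          using n elim(2) unfolding B_def by auto
        then obtain p where p: "p \<in> \<eta> \<omega>" "pow g p \<le> b - 1 / real n" by blast
        have wg: "norm (w - g) \<le> ?d / (c * real n)"
          unfolding g_def using norm_grid_round_diff[OF cn[OF n(1)], of w] by (simp add: norm_minus_commute)
        also have dc: "?d / (c * real n) \<le> 1 / (4 * (real k + R + 2) * real n)"
        proof -
          have e: "c * real n = ?d * (4 * (real k + R + 2) * real n)" unfolding c_def by (simp only: mult_ac)
          show ?thesis unfolding e using d by simp
        qed
        finally have wg': "norm (w - g) \<le> 1 / (4 * (real k + R + 2) * real n)" .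
        have "4 * (real k + R + 2) * real n \<ge> 1 * 1" using n1 R by (intro mult_mono) auto
        then have "1 / (4 * (real k + R + 2) * real n) \<le> 1" by simp
        then have gk: "norm g \<le> real k + 1"
          using wg' w norm_triangle_sub[of g w] by (simp add: norm_minus_commute)
        have "p \<notin> tail_set (real H)" using tail p(1) by blast
        moreover have "pow g p \<le> b" using p(2) n1 by (simp add: order_trans[of _ "b - 1 / real n"])
        ultimately have "norm (fst p) \<le> R" unfolding R_def using gk bounded_of_not_tail[of p "real H" g] by auto
        then have sum: "norm (w - fst p) + norm (g - fst p) \<le> 2 * (real k + R + 2)"
          using w gk norm_triangle_ineq4[of w "fst p"] norm_triangle_ineq4[of g "fst p"] by simp
        have "pow w p \<le> pow g p + norm (w - g) * (norm (w - fst p) + norm (g - fst p))" by (rule pow_le_of_near)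
        also have "norm (w - g) * (norm (w - fst p) + norm (g - fst p)) \<le>
            1 / (4 * (real k + R + 2) * real n) * (2 * (real k + R + 2))"
          using wg' sum n1 R by (intro mult_mono) auto
        also have "\<dots> = 1 / (2 * real n)"
        proof -
          have "1 / (4 * Y * x) * (2 * Y) = 1 / (2 * x)" if "0 < Y" "0 < x" for x Y :: real
            using that by (simp add: field_simps)
          moreover have "0 < real k + R + 2" "0 < real n" using n1 R by linarith+
          ultimately show ?thesis by blast
        qed
        finally have "pow w p \<le> pow g p + 1 / (2 * real n)" by simp
        also have "\<dots> \<le> b - 1 / real n + 1 / (2 * real n)" using p(2) by simp
        also have "\<dots> = b - 1 / (2 * real n)" using n1 by (simp add: field_simps)
        finally show "\<exists>p\<in>\<eta> \<omega>. pow w p \<le> b - 1 / (2 * real n)" using p(1) by blast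
      qed
    qed
  qed
qed

text \<open>If no level carried mass, \<open>f\<close> would vanish almost everywhere, since the
  levels exhaust \<open>E\<close> and \<open>f\<close> is 0 off \<open>interior E\<close>; the
  intensity would then be trivial.\<close>

lemma exists_positive_level:
  assumes adm: "admissible DIM('a) E f" and \<tau>: "\<forall>t\<in>E. \<exists>N::nat. t \<le> \<tau> N"
    and pos: "emeasure (intensity f :: ('a::euclidean_space \<times> real) measure) (cbox 0 One \<times> UNIV) > 0"
  shows "\<exists>j. (\<integral>\<^sup>+h\<in>{..\<tau> j}. ennreal (f h) \<partial>lebesgue) > 0"
proof (rule ccontr)
  assume "\<not> ?thesis"
  then have z: "(\<integral>\<^sup>+h. ennreal (f h) * indicator {..\<tau> j} h \<partial>lebesgue) = 0" for j by (simp add: zero_less_iff_neq_zero)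
  have f: "f \<in> borel_measurable lebesgue" "\<And>x. x \<notin> interior E \<Longrightarrow> f x = 0"
    using adm L1loc_plus_measurable unfolding admissible_def L1loc_plus_def by auto
  have "AE h in lebesgue. ennreal (f h) * indicator {..\<tau> j} h = 0" for j
    using z[of j] by (subst nn_integral_0_iff_AE[symmetric])
      (auto intro!: borel_measurable_times_ennreal borel_measurable_indicator measurable_compose[OF f(1) measurable_ennreal])
  then have "AE h in lebesgue. \<forall>j. ennreal (f h) * indicator {..\<tau> j} h = 0"
    unfolding AE_all_countable by (rule allI)
  then have "AE h in lebesgue. ennreal (f h) * indicator UNIV h = 0"
  proof eventually_elim
    case (elim h)
    show ?case
    proof (cases "h \<in> E")
      case True
      then obtain N where "h \<le> \<tau> N" using \<tau> by blast
      then show ?thesis using elim[rule_format, of N] by simp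
    next
      case False
      then have "h \<notin> interior E" using interior_subset by blast
      then show ?thesis by (simp add: f(2))
    qed
  qed
  then have "(\<integral>\<^sup>+h\<in>UNIV. ennreal (f h) \<partial>lebesgue) = 0"
    by (subst nn_integral_0_iff_AE)
      (auto intro!: borel_measurable_times_ennreal borel_measurable_indicator measurable_compose[OF f(1) measurable_ennreal])
  then have "emeasure (intensity f :: ('a \<times> real) measure) (cbox 0 One \<times> UNIV) = 0"
    by (subst emeasure_intensity_Times[OF f(1)]) auto
  then show False using pos by simp
qed

section \<open>The skeletons as random closed sets\<close>

lemma poisson_AE_surround:
  fixes \<eta> :: "'w \<Rightarrow> ('a::euclidean_space \<times> real) set"
  assumes P: "poisson_process M (intensity f) \<eta>" and f: "f \<in> borel_measurable lebesgue"
    and pos: "(\<integral>\<^sup>+h\<in>{..t}. ennreal (f h) \<partial>lebesgue) > 0"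
  shows "AE \<omega> in M. \<forall>r::nat. \<forall>J\<in>Pow Basis. \<exists>q\<in>\<eta> \<omega>. q \<in> orthant (1 + real r) J \<and> snd q \<le> t"
proof -
  note O = emeasure_intensity_orthant[OF f pos, where 'a = 'a]
  have "AE \<omega> in M. \<eta> \<omega> \<inter> (orthant (1 + real r) J \<inter> UNIV \<times> {..t}) \<noteq> {}" for r J
    by (rule poisson_process_infinite_hit[OF P O])
  then have "AE \<omega> in M. \<forall>r::nat. \<forall>J\<in>Pow Basis. \<eta> \<omega> \<inter> (orthant (1 + real r) J \<inter> UNIV \<times> {..t}) \<noteq> {}"
    unfolding AE_all_countable by (auto intro!: AE_finite_allI)
  then show ?thesis
  proof eventually_elim
    case (elim \<omega>)
    show ?case
    proof (intro allI ballI)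
      fix r :: nat and J :: "'a set" assume "J \<in> Pow Basis"
      then have "\<eta> \<omega> \<inter> (orthant (1 + real r) J \<inter> UNIV \<times> {..t}) \<noteq> {}" using elim by blast
      then show "\<exists>q\<in>\<eta> \<omega>. q \<in> orthant (1 + real r) J \<and> snd q \<le> t" by fastforce
    qed
  qed
qed

text \<open>If the levels are unbounded, a single point covers every ball at a sufficiently high
  level. Otherwise \<open>E = {..<b}\<close>, and the union bound applies with an \<open>H\<close>
  for which the tail set contains no points.\<close>

lemma poisson_AE_cover:
  fixes \<eta> :: "'w \<Rightarrow> ('a::euclidean_space \<times> real) set"
  assumes P: "poisson_process M (intensity f) \<eta>" and adm: "admissible DIM('a) E f"
    and \<tau>: "\<forall>t\<in>E. \<exists>N::nat. t \<le> \<tau> N" "(\<exists>b. E = {..<b}) \<or> (\<forall>t. \<exists>N. t \<le> \<tau> N)"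
    and ne: "AE \<omega> in M. \<eta> \<omega> \<noteq> {}"
  shows "AE \<omega> in M. \<forall>\<rho>. \<exists>j. \<forall>w\<in>cball 0 \<rho>. \<exists>p\<in>\<eta> \<omega>. pow w p \<le> \<tau> j"
proof -
  note f = admissible_measurable[OF adm] admissible_nonneg[OF adm]
  consider b where "E = {..<b}" | "\<forall>t. \<exists>N. t \<le> \<tau> N" using \<tau>(2) by blast
  then show ?thesis
  proof cases
    case 1
    obtain \<epsilon> n0 where \<epsilon>: "\<epsilon> > 0" "\<And>n::nat. n > n0 \<Longrightarrow>
        ennreal (real n powr \<epsilon>) \<le> frac_integral (real DIM('a) / 2 + 1) f (b - 1 / real n)"
      using adm 1 unfolding admissible_def by blast
    have "AE \<omega> in M. \<forall>H k::nat. \<eta> \<omega> \<inter> tail_set (real H) = {} \<longrightarrow>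
      (\<exists>t<b. \<forall>w\<in>cball 0 (real k). \<exists>p\<in>\<eta> \<omega>. pow w p \<le> t)"
      unfolding AE_all_countable
    proof (intro allI)
      fix H k :: nat
      show "AE \<omega> in M. \<eta> \<omega> \<inter> tail_set (real H) = {} \<longrightarrow> (\<exists>t<b. \<forall>w\<in>cball 0 (real k). \<exists>p\<in>\<eta> \<omega>. pow w p \<le> t)"
        by (rule poisson_AE_cover_bounded[OF P f \<epsilon>])
    qed
    with poisson_AE_tail[OF P adm] show ?thesis
    proof eventually_elim
      case (elim \<omega>)
      from elim(1) obtain H :: nat where H: "\<eta> \<omega> \<inter> tail_set (real H) = {}" by blast
      show ?case
      proof
        fix \<rho> :: real
        obtain k :: nat where k: "\<rho> \<le> real k" using real_arch_simple by blast
        from elim(2) H obtain t where t: "t < b" "\<forall>w\<in>cball 0 (real k). \<exists>p\<in>\<eta> \<omega>. pow w p \<le> t" by blast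
        then obtain N where N: "t \<le> \<tau> N" using \<tau>(1) 1 by blast
        have "\<exists>p\<in>\<eta> \<omega>. pow w p \<le> \<tau> N" if "w \<in> cball 0 \<rho>" for w
        proof -
          have "w \<in> cball 0 (real k)" using that k by simp
          then obtain p where "p \<in> \<eta> \<omega>" "pow w p \<le> t" using t(2) by blast
          then show ?thesis using N by (intro bexI[of _ p]) simp_all
        qed
        then show "\<exists>j. \<forall>w\<in>cball 0 \<rho>. \<exists>p\<in>\<eta> \<omega>. pow w p \<le> \<tau> j" by blast
      qed
    qed
  next
    case 2
    from ne show ?thesis
    proof eventually_elim
      case (elim \<omega>)
      then obtain q where q: "q \<in> \<eta> \<omega>" by blast
      show ?case
      proof
        fix \<rho> :: real
        obtain N where N: "(\<rho> + norm (fst q))\<^sup>2 + snd q \<le> \<tau> N" using 2 by blast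
        have "pow w q \<le> \<tau> N" if "w \<in> cball 0 \<rho>" for w
        proof -
          have "norm (w - fst q) \<le> \<rho> + norm (fst q)"
            using that norm_triangle_ineq4[of w "fst q"] by simp
          then have "(norm (w - fst q))\<^sup>2 \<le> (\<rho> + norm (fst q))\<^sup>2" by (intro power_mono) auto
          then show ?thesis unfolding pow_def using N by linarith
        qed
        then show "\<exists>j. \<forall>w\<in>cball 0 \<rho>. \<exists>p\<in>\<eta> \<omega>. pow w p \<le> \<tau> j" using q by blast
      qed
    qed
  qed
qed

lemma poisson_AE_good:
  fixes \<eta> :: "'w \<Rightarrow> ('a::euclidean_space \<times> real) set"
  assumes P: "poisson_process M (intensity f) \<eta>" and adm: "admissible DIM('a) E f"
    and pos: "emeasure (intensity f :: ('a \<times> real) measure) (cbox 0 One \<times> UNIV) > 0"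
    and \<tau>: "incseq \<tau>" "\<forall>N. \<tau> N \<in> E" "\<forall>t\<in>E. \<exists>N::nat. t \<le> \<tau> N" "(\<exists>b. E = {..<b}) \<or> (\<forall>t. \<exists>N. t \<le> \<tau> N)"
  shows "AE \<omega> in M. \<forall>H r. \<eta> \<omega> \<inter> tail_set (real H) = {} \<longrightarrow> (\<forall>\<^sub>F N in sequentially. \<eta> \<omega> \<in> good_configs \<tau> H r N)"
    and "AE \<omega> in M. \<forall>N. finite (\<eta> \<omega> \<inter> window \<tau> N)"
    and "emeasure (intensity f) (window \<tau> N :: ('a \<times> real) set) < \<infinity>"
proof -
  note f = admissible_measurable[OF adm] admissible_nonneg[OF adm]
  obtain j0 where j0: "(\<integral>\<^sup>+h\<in>{..\<tau> j0}. ennreal (f h) \<partial>lebesgue) > 0"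
    using exists_positive_level[OF adm \<tau>(3) pos] by blast
  note sur = poisson_AE_surround[OF P f(1) j0]
  then have "AE \<omega> in M. \<eta> \<omega> \<noteq> {}" by eventually_elim blast
  note cov = poisson_AE_cover[OF P adm \<tau>(3,4) this]
  from sur cov show "AE \<omega> in M. \<forall>H r. \<eta> \<omega> \<inter> tail_set (real H) = {} \<longrightarrow>
    (\<forall>\<^sub>F N in sequentially. \<eta> \<omega> \<in> good_configs \<tau> H r N)"
  proof eventually_elim
    case (elim \<omega>)
    show ?case
    proof (intro allI impI)
      fix H r assume "\<eta> \<omega> \<inter> tail_set (real H) = {}"
      then show "\<forall>\<^sub>F N in sequentially. \<eta> \<omega> \<in> good_configs \<tau> H r N"
        by (rule eventually_good_config[OF \<tau>(1)]) (use elim in blast)+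
    qed
  qed
  show fin: "emeasure (intensity f) (window \<tau> N :: ('a \<times> real) set) < \<infinity>" for N
  proof (rule le_less_trans)
    show "emeasure (intensity f) (window \<tau> N :: ('a \<times> real) set) \<le>
        ennreal (unit_ball_vol DIM('a) * real N ^ DIM('a)) * (\<integral>\<^sup>+h\<in>{..\<tau> N}. ennreal (f h) \<partial>lebesgue)"
      by (rule emeasure_intensity_bounded_window[OF f(1) window_subset]) simp
    show "\<dots> < \<infinity>"
      using admissible_mono_integral[OF adm, of "\<tau> N"] \<tau>(2) by (simp add: ennreal_mult_less_top)
  qed
  show "AE \<omega> in M. \<forall>N. finite (\<eta> \<omega> \<inter> window \<tau> N)"
    unfolding AE_all_countable
    using poisson_process_AE_finite[OF P borel_closed[OF closed_window] fin] by blast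
qed

lemma closed_of_closed_Int_cball:
  fixes S :: "'a::euclidean_space set"
  assumes "\<And>r::nat. closed (S \<inter> cball 0 (real r))"
  shows "closed S"
  unfolding closure_subset_eq[symmetric]
proof
  fix x assume x: "x \<in> closure S"
  obtain r :: nat where r: "norm x + 1 \<le> real r" using real_arch_simple by blast
  have "x \<in> S \<inter> cball 0 (real r)"
  proof (rule closed_approachable[THEN iffD1, OF assms], intro allI impI)
    fix e :: real assume "e > 0"
    then obtain y where y: "y \<in> S" "dist y x < min e 1"
      using x closure_approachable[of x S] by (metis min_less_iff_conj zero_less_one)
    then have "norm y \<le> real r" using norm_triangle_sub[of y x] r by (simp add: dist_norm)
    then show "\<exists>y\<in>S \<inter> cball 0 (real r). dist y x < e" using y by (intro bexI[of _ y]) auto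
  qed
  then show "x \<in> S" by blast
qed

text \<open>\<open>T\<close> differs from the event \<open>S\<close> inside a null set, which the
  completion absorbs.\<close>

lemma sets_completion_AE_eq:
  assumes S: "S \<in> sets M" and T: "T \<subseteq> space M" and eq: "AE \<omega> in M. \<omega> \<in> S \<longleftrightarrow> \<omega> \<in> T"
  shows "T \<in> sets (completion M)"
proof -
  from eq obtain N where N: "{\<omega> \<in> space M. \<not> (\<omega> \<in> S \<longleftrightarrow> \<omega> \<in> T)} \<subseteq> N" "N \<in> null_sets M"
    by (auto elim: AE_E simp: null_sets_def)
  show ?thesis
  proof (rule sets_completionI)
    show "T = (S - N) \<union> (T \<inter> N)" using N(1) T sets.sets_into_space[OF S] by blast
    show "T \<inter> N \<subseteq> N" by blast
    show "N \<in> null_sets M" by (rule N)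
    show "S - N \<in> sets M" using S N(2) by auto
  qed
qed

lemma poisson_AE_skel_eventually:
  fixes \<eta> :: "'w \<Rightarrow> ('a::euclidean_space \<times> real) set"
  assumes P: "poisson_process M (intensity f) \<eta>" and adm: "admissible DIM('a) E f"
    and pos: "emeasure (intensity f :: ('a \<times> real) measure) (cbox 0 One \<times> UNIV) > 0"
    and \<tau>: "incseq \<tau>" "\<forall>N. \<tau> N \<in> E" "\<forall>t\<in>E. \<exists>N::nat. t \<le> \<tau> N" "(\<exists>b. E = {..<b}) \<or> (\<forall>t. \<exists>N. t \<le> \<tau> N)"
  shows "AE \<omega> in M. \<forall>r::nat. \<forall>\<^sub>F N in sequentially.
    laguerre_skel dual (\<eta> \<omega>) \<inter> cball 0 (real r) = window_skel dual (real N) (window \<tau> N) (\<eta> \<omega>) \<inter> cball 0 (real r)"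
  using poisson_AE_tail[OF P adm] poisson_AE_good(1,2)[OF P adm pos \<tau>]
proof eventually_elim
  case (elim \<omega>)
  then obtain H where H: "\<eta> \<omega> \<inter> tail_set (real H) = {}" by blast
  show ?case
  proof
    fix r :: nat
    have "\<forall>\<^sub>F N in sequentially. \<eta> \<omega> \<in> good_configs \<tau> H r N" using elim(2) H by blast
    then show "\<forall>\<^sub>F N in sequentially. laguerre_skel dual (\<eta> \<omega>) \<inter> cball 0 (real r) =
        window_skel dual (real N) (window \<tau> N) (\<eta> \<omega>) \<inter> cball 0 (real r)"
    proof eventually_elim
      case (elim N)
      then show ?case
        using good_config_skel[OF _ H _ \<tau>(1)] \<open>\<forall>N. finite (\<eta> \<omega> \<inter> window \<tau> N)\<close> by blast
    qed
  qed
qed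

text \<open>Along growing windows the skeletons are almost surely eventually constant on each ball.
  This gives closedness, and a hitting event agrees almost surely with the limit inferior of the
  hitting events in the windows, hence is measurable for the completion.\<close>

lemma random_closed_set_laguerre_skel:
  fixes \<eta> :: "'w \<Rightarrow> ('a::euclidean_space \<times> real) set"
  assumes P: "poisson_process M (intensity f) \<eta>" and adm: "admissible DIM('a) E f"
    and pos: "emeasure (intensity f :: ('a \<times> real) measure) (cbox 0 One \<times> UNIV) > 0"
  shows "random_closed_set M (\<lambda>\<omega>. laguerre_skel dual (\<eta> \<omega>))"
proof -
  have "(\<exists>a. E = {a..}) \<or> (\<exists>b. E = {..<b}) \<or> E = UNIV" using adm unfolding admissible_def by blast
  then obtain \<tau> :: "nat \<Rightarrow> real" where \<tau>: "incseq \<tau>" "\<forall>N. \<tau> N \<in> E" "\<forall>t\<in>E. \<exists>N. t \<le> \<tau> N"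
    "(\<exists>b. E = {..<b}) \<or> (\<forall>t. \<exists>N. t \<le> \<tau> N)" by (rule admissible_levels)
  let ?Z = "\<lambda>\<omega>. laguerre_skel dual (\<eta> \<omega>)"
  let ?V = "\<lambda>N \<omega>. window_skel dual (real N) (window \<tau> N) (\<eta> \<omega>)"
  note ev = poisson_AE_skel_eventually[OF P adm pos \<tau>, of dual]
  have cl: "AE \<omega> in M. closed (?Z \<omega>)"
    using ev
  proof eventually_elim
    case (elim \<omega>)
    show ?case
    proof (rule closed_of_closed_Int_cball)
      fix r :: nat
      obtain N where "?Z \<omega> \<inter> cball 0 (real r) = ?V N \<omega> \<inter> cball 0 (real r)"
        using eventually_happens[OF spec[OF elim, of r]] by auto
      then show "closed (?Z \<omega> \<inter> cball 0 (real r))"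
        using closed_Int[OF closed_window_skel closed_cball] by metis
    qed
  qed
  have "closed_version ?Z \<in> completion M \<rightarrow>\<^sub>M borel_of fell_topology"
  proof (rule measurable_fell_topology)
    show "closed (closed_version ?Z \<omega>)" for \<omega> unfolding closed_version_def by simp
    fix a b :: 'a
    obtain r :: nat where r: "cbox a b \<subseteq> cball 0 (real r)"
    proof -
      obtain c where "\<forall>x\<in>cbox a b. norm x \<le> c" using bounded_cbox[of a b] unfolding bounded_iff by blast
      moreover obtain r :: nat where "c \<le> real r" using real_arch_simple by blast
      ultimately show thesis by (intro that[of r]) (auto intro: order_trans)
    qed
    let ?S = "{\<omega> \<in> space M. \<exists>N0. \<forall>N\<in>{N0..}. ?V N \<omega> \<inter> cbox a b \<noteq> {}}"
    let ?T = "{\<omega> \<in> space M. closed_version ?Z \<omega> \<inter> cbox a b \<noteq> {}}"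
    have hit: "{\<omega> \<in> space M. ?V N \<omega> \<inter> cbox a b \<noteq> {}} \<in> sets M" for N
    proof -
      have "{A. window_skel dual (real N) (window \<tau> N) A \<inter> cbox a b \<noteq> {}} \<in> sets (config_space (window \<tau> N :: ('a \<times> real) set))"
        by (intro window_skel_hit_in_config_space borel_closed closed_window bounded_window compact_cbox)
      from measurable_sets[OF measurable_config_space[OF P] this]
      show ?thesis by (simp add: vimage_def Int_def conj_commute)
    qed
    have "?S = (\<Union>N0. \<Inter>N\<in>{N0..}. {\<omega> \<in> space M. ?V N \<omega> \<inter> cbox a b \<noteq> {}})" by auto
    also have "\<dots> \<in> sets M" using hit by (intro sets.countable_UN sets.countable_INT' image_subsetI) auto
    finally have S: "?S \<in> sets M" .
    have "AE \<omega> in M. \<omega> \<in> ?S \<longleftrightarrow> \<omega> \<in> ?T"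
      using ev cl AE_space
    proof eventually_elim
      case (elim \<omega>)
      obtain N1 where N1: "\<And>N. N \<ge> N1 \<Longrightarrow> ?Z \<omega> \<inter> cball 0 (real r) = ?V N \<omega> \<inter> cball 0 (real r)"
        using spec[OF elim(1), of r] unfolding eventually_sequentially by blast
      have eq: "?V N \<omega> \<inter> cbox a b \<noteq> {} \<longleftrightarrow> ?Z \<omega> \<inter> cbox a b \<noteq> {}" if "N \<ge> N1" for N
        using N1[OF that] r by blast
      have "(\<exists>N0. \<forall>N\<in>{N0..}. ?V N \<omega> \<inter> cbox a b \<noteq> {}) \<longleftrightarrow> ?Z \<omega> \<inter> cbox a b \<noteq> {}"
      proof
        assume "\<exists>N0. \<forall>N\<in>{N0..}. ?V N \<omega> \<inter> cbox a b \<noteq> {}"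
        then obtain N0 where "\<forall>N\<in>{N0..}. ?V N \<omega> \<inter> cbox a b \<noteq> {}" by blast
        then have "?V (max N0 N1) \<omega> \<inter> cbox a b \<noteq> {}" by (rule bspec) simp
        then show "?Z \<omega> \<inter> cbox a b \<noteq> {}" using eq[of "max N0 N1"] by simp
      next
        assume z: "?Z \<omega> \<inter> cbox a b \<noteq> {}"
        show "\<exists>N0. \<forall>N\<in>{N0..}. ?V N \<omega> \<inter> cbox a b \<noteq> {}"
        proof (intro exI[of _ N1] ballI)
          fix N assume "N \<in> {N1..}"
          then show "?V N \<omega> \<inter> cbox a b \<noteq> {}" using eq[of N] z by simp
        qed
      qed
      then show ?case using elim(2,3) unfolding closed_version_def by simp
    qed
    then have "?T \<in> sets (completion M)" by (intro sets_completion_AE_eq[OF S]) auto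
    then show "{\<omega> \<in> space (completion M). closed_version ?Z \<omega> \<inter> cbox a b \<noteq> {}} \<in> sets (completion M)" by simp
  qed
  then show ?thesis
    unfolding random_closed_set_def using cl poisson_process_prob_space[OF P] by blast
qed

section \<open>Comparison with the skeleton in a window\<close>

lemma continuous_map_borel_of_measurable:
  fixes g :: "'b \<Rightarrow> 'c::topological_space"
  assumes "continuous_map X euclidean g"
  shows "g \<in> borel_of X \<rightarrow>\<^sub>M borel"
proof (rule borel_measurableI)
  fix S :: "'c set" assume "open S"
  then have "openin X {x \<in> topspace X. g x \<in> S}"
    using assms by (intro openin_continuous_map_preimage) auto
  moreover have "{U. openin X U} \<subseteq> Pow (topspace X)"
    using openin_subset by auto
  ultimately show "g -` S \<inter> space (borel_of X) \<in> sets (borel_of X)"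
    unfolding borel_of_def by (auto simp: vimage_def Int_def conj_commute)
qed

text \<open>Off the two exceptional events the global skeleton and the one in the window agree on
  the ball of radius \<open>r\<close>, so \<open>g\<close> changes by less than \<open>e\<close>; on
  their union it changes by at most \<open>2 * c\<close>.\<close>

lemma law_window_approx:
  fixes \<eta> :: "'w \<Rightarrow> ('a::euclidean_space \<times> real) set" and g :: "'a set \<Rightarrow> real"
  assumes P: "poisson_process M \<Lambda> \<eta>" and rcs: "random_closed_set M (\<lambda>\<omega>. laguerre_skel dual (\<eta> \<omega>))"
    and g: "continuous_map fell_topology euclideanreal g" "\<And>F. closed F \<Longrightarrow> \<bar>g F\<bar> \<le> c"
    and loc: "\<forall>F F'. closed F \<and> closed F' \<and> F \<inter> cball 0 (real r) = F' \<inter> cball 0 (real r) \<longrightarrow> \<bar>g F - g F'\<bar> < e"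
    and fin: "AE \<omega> in M. finite (\<eta> \<omega> \<inter> window \<tau> N)" and \<tau>: "incseq \<tau>"
    and tail: "measure M {\<omega> \<in> space M. \<eta> \<omega> \<inter> tail_set (real H) \<noteq> {}} \<le> a"
    and good: "measure M {\<omega> \<in> space M. \<eta> \<omega> \<notin> good_configs \<tau> H r N} \<le> a'"
  shows "\<bar>integral\<^sup>L (rcs_law M (\<lambda>\<omega>. laguerre_skel dual (\<eta> \<omega>))) g -
    integral\<^sup>L (distr M (config_space (window \<tau> N)) \<eta>) (\<lambda>A. g (window_skel dual (real N) (window \<tau> N) A))\<bar>
    \<le> e + 2 * c * (a + a')"
proof -
  interpret M: prob_space M using P by (rule poisson_process_prob_space)
  interpret C: prob_space "completion M" by (rule M.prob_space_completion)
  let ?Z = "\<lambda>\<omega>. laguerre_skel dual (\<eta> \<omega>)" and ?W = "window \<tau> N :: ('a \<times> real) set"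
  let ?v = "\<lambda>A. window_skel dual (real N) ?W A"
  let ?T = "{\<omega> \<in> space M. \<eta> \<omega> \<inter> tail_set (real H) \<noteq> {}}" and ?G = "{\<omega> \<in> space M. \<eta> \<omega> \<notin> good_configs \<tau> H r N}"
  have c0: "0 \<le> c" using g(2)[of "{}"] abs_ge_zero[of "g {}"] by simp
  have e0: "0 < e" using loc[rule_format, of "{}" "{}"] by simp
  have gm: "g \<in> borel_of fell_topology \<rightarrow>\<^sub>M borel"
    using g(1) by (rule continuous_map_borel_of_measurable)
  have Zm: "closed_version ?Z \<in> completion M \<rightarrow>\<^sub>M borel_of fell_topology" and Zc: "AE \<omega> in M. closed (?Z \<omega>)"
    using rcs unfolding random_closed_set_def by blast+
  have vm: "?v \<in> config_space ?W \<rightarrow>\<^sub>M borel_of fell_topology"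
    by (intro window_skel_measurable borel_closed closed_window bounded_window)
  note \<eta>m = measurable_config_space[OF P, of ?W]
  have gv: "(\<lambda>\<omega>. g (?v (\<eta> \<omega>))) \<in> borel_measurable M"
    using measurable_compose[OF \<eta>m measurable_compose[OF vm gm]] .
  have gZ: "(\<lambda>\<omega>. g (closed_version ?Z \<omega>)) \<in> borel_measurable (completion M)"
    using measurable_compose[OF Zm gm] .
  have i1: "integral\<^sup>L (rcs_law M ?Z) g = integral\<^sup>L (completion M) (\<lambda>\<omega>. g (closed_version ?Z \<omega>))"
    unfolding rcs_law_def using Zm gm by (rule integral_distr)
  have "integral\<^sup>L (distr M (config_space ?W) \<eta>) (\<lambda>A. g (?v A)) = integral\<^sup>L M (\<lambda>\<omega>. g (?v (\<eta> \<omega>)))"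
    using \<eta>m measurable_compose[OF vm gm] by (rule integral_distr)
  also have "\<dots> = integral\<^sup>L (completion M) (\<lambda>\<omega>. g (?v (\<eta> \<omega>)))"
    using gv by (rule integral_completion[symmetric])
  finally have i2: "integral\<^sup>L (distr M (config_space ?W) \<eta>) (\<lambda>A. g (?v A)) = integral\<^sup>L (completion M) (\<lambda>\<omega>. g (?v (\<eta> \<omega>)))" .
  have cv: "closed (closed_version ?Z \<omega>)" for \<omega> unfolding closed_version_def by simp
  have int1: "integrable (completion M) (\<lambda>\<omega>. g (closed_version ?Z \<omega>))"
    using gZ g(2)[OF cv] by (intro C.integrable_const_bound[of _ c]) auto
  have int2: "integrable (completion M) (\<lambda>\<omega>. g (?v (\<eta> \<omega>)))"
    using measurable_completion[OF gv] g(2)[OF closed_window_skel] by (intro C.integrable_const_bound[of _ c]) auto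
  have T: "?T \<in> sets M" using poisson_process_hit_sets(2)[OF P borel_closed[OF closed_tail_set]] .
  have G: "?G \<in> sets M"
  proof -
    have "- good_configs \<tau> H r N \<in> sets (config_space ?W)"
      using sets.compl_sets[OF good_configs_in_config_space[of \<tau> H r N]] by (simp add: Compl_eq_Diff_UNIV)
    from measurable_sets[OF \<eta>m this] show ?thesis by (simp add: vimage_def Int_def conj_commute)
  qed
  let ?b = "\<lambda>\<omega>. e + 2 * c * (indicator ?T \<omega> + indicator ?G \<omega>) :: real"
  have intb: "integrable (completion M) ?b"
    using T G by (intro Bochner_Integration.integrable_add integrable_mult_right C.integrable_const integrable_real_indicator)
      (auto simp: C.emeasure_eq_measure)
  have "AE \<omega> in completion M. \<bar>g (closed_version ?Z \<omega>) - g (?v (\<eta> \<omega>))\<bar> \<le> ?b \<omega>"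
    using AE_completion[OF fin] AE_completion[OF Zc] AE_space
  proof eventually_elim
    case (elim \<omega>)
    show ?case
    proof (cases "\<omega> \<in> ?T \<union> ?G")
      case True
      have "\<bar>g (closed_version ?Z \<omega>)\<bar> \<le> c" "\<bar>g (?v (\<eta> \<omega>))\<bar> \<le> c"
        using g(2)[OF cv] g(2)[OF closed_window_skel] by blast+
      then have "\<bar>g (closed_version ?Z \<omega>) - g (?v (\<eta> \<omega>))\<bar> \<le> 2 * c * 1" by linarith
      also have "\<dots> \<le> 2 * c * (indicator ?T \<omega> + indicator ?G \<omega>)"
        using True c0 by (intro mult_left_mono) (auto simp: indicator_def)
      finally show ?thesis using e0 by linarith
    next
      case False
      have \<omega>: "\<omega> \<in> space M" using elim(3) by simp
      then have "\<eta> \<omega> \<in> good_configs \<tau> H r N" "\<eta> \<omega> \<inter> tail_set (real H) = {}" using False by auto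
      from good_config_skel[OF this elim(1) \<tau>, of dual]
      have "?Z \<omega> \<inter> cball 0 (real r) = ?v (\<eta> \<omega>) \<inter> cball 0 (real r)" .
      moreover have "closed_version ?Z \<omega> = ?Z \<omega>" unfolding closed_version_def using elim(2) by simp
      ultimately have "\<bar>g (closed_version ?Z \<omega>) - g (?v (\<eta> \<omega>))\<bar> < e"
        using loc[rule_format, of "?Z \<omega>" "?v (\<eta> \<omega>)"] elim(2) closed_window_skel by metis
      then show ?thesis using False by simp
    qed
  qed
  then have "integral\<^sup>L (completion M) (\<lambda>\<omega>. \<bar>g (closed_version ?Z \<omega>) - g (?v (\<eta> \<omega>))\<bar>) \<le> integral\<^sup>L (completion M) ?b"
    using int1 int2 intb by (intro integral_mono_AE) auto
  also have "integral\<^sup>L (completion M) ?b = e + 2 * c * (M.prob ?T + M.prob ?G)"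
  proof -
    have "integral\<^sup>L (completion M) ?b = integral\<^sup>L M ?b"
      by (intro integral_completion borel_measurable_add borel_measurable_const
          borel_measurable_times borel_measurable_indicator T G)
    also have "\<dots> = e + 2 * c * (M.prob ?T + M.prob ?G)"
      using T G by (subst Bochner_Integration.integral_add)
        (auto simp: M.prob_space M.emeasure_eq_measure intro!: Bochner_Integration.integrable_add integrable_mult_right integrable_real_indicator)
    finally show ?thesis .
  qed
  also have "\<dots> \<le> e + 2 * c * (a + a')"
    using tail good c0 by (intro add_left_mono mult_left_mono add_mono) auto
  finally have "integral\<^sup>L (completion M) (\<lambda>\<omega>. \<bar>g (closed_version ?Z \<omega>) - g (?v (\<eta> \<omega>))\<bar>) \<le> e + 2 * c * (a + a')" .
  moreover have "\<bar>integral\<^sup>L (completion M) (\<lambda>\<omega>. g (closed_version ?Z \<omega>)) - integral\<^sup>L (completion M) (\<lambda>\<omega>. g (?v (\<eta> \<omega>)))\<bar>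
     \<le> integral\<^sup>L (completion M) (\<lambda>\<omega>. \<bar>g (closed_version ?Z \<omega>) - g (?v (\<eta> \<omega>))\<bar>)"
    unfolding Bochner_Integration.integral_diff[OF int1 int2, symmetric] by (rule integral_abs_bound)
  ultimately show ?thesis unfolding i1 i2 by linarith
qed

text \<open>For \<open>h \<le> - H\<close> the factor \<open>\<bar>h\<bar> powr \<delta>\<close> is
  at least \<open>H powr \<delta>\<close>, so the moment of order \<open>d / 2\<close> below
  \<open>- H\<close> is at most \<open>H powr (- \<delta>)\<close> times the moment bounded in
  \<open>n\<close>. The condition \<open>- H \<le> x0\<close> puts the tail within the range of that
  moment.\<close>

lemma uniform_tail_bound:
  fixes fs :: "nat \<Rightarrow> real \<Rightarrow> real"
  assumes f: "\<And>n. fs n \<in> borel_measurable lebesgue" "\<And>n x. 0 \<le> fs n x" and \<delta>: "\<delta> > 0"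
    and sup: "(SUP n. \<integral>\<^sup>+h\<in>{..x0}. ennreal (\<bar>h\<bar> powr (real DIM('a) / 2 + \<delta>) * fs n h) \<partial>lebesgue) < \<infinity>"
    and e: "e > 0"
  shows "\<forall>\<^sub>F H in sequentially. \<forall>n. emeasure (intensity (fs n)) (tail_set (real H) :: ('a::euclidean_space \<times> real) set) \<le> ennreal e"
proof -
  define S where "S = (SUP n. \<integral>\<^sup>+h\<in>{..x0}. ennreal (\<bar>h\<bar> powr (real DIM('a) / 2 + \<delta>) * fs n h) \<partial>lebesgue)"
  define K where "K = unit_ball_vol (real DIM('a)) * 3 ^ DIM('a)"
  have bound: "emeasure (intensity (fs n)) (tail_set (real H) :: ('a \<times> real) set) \<le> ennreal K * S * ennreal (real H powr (- \<delta>))"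
    if H: "1 \<le> H" "- real H \<le> x0" for n H
  proof -
    let ?d = "real DIM('a) / 2"
    have "(\<integral>\<^sup>+h\<in>{..- real H}. ennreal (\<bar>h\<bar> powr ?d * fs n h) \<partial>lebesgue) \<le>
      (\<integral>\<^sup>+h. ennreal (real H powr (- \<delta>)) * (ennreal (\<bar>h\<bar> powr (?d + \<delta>) * fs n h) * indicator {..x0} h) \<partial>lebesgue)"
    proof (intro nn_integral_mono)
      fix h :: real
      show "ennreal (\<bar>h\<bar> powr ?d * fs n h) * indicator {..- real H} h \<le>
        ennreal (real H powr (- \<delta>)) * (ennreal (\<bar>h\<bar> powr (?d + \<delta>) * fs n h) * indicator {..x0} h)"
      proof (cases "h \<le> - real H")
        case True
        have hH: "real H \<le> \<bar>h\<bar>" "0 < real H" "\<bar>h\<bar> > 0" using True H by auto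
        have "real H powr \<delta> \<le> \<bar>h\<bar> powr \<delta>" using hH \<delta> by (intro powr_mono2) auto
        then have "\<bar>h\<bar> powr ?d * real H powr \<delta> \<le> \<bar>h\<bar> powr ?d * \<bar>h\<bar> powr \<delta>" by (intro mult_left_mono) auto
        also have "\<dots> = \<bar>h\<bar> powr (?d + \<delta>)" by (simp add: powr_add)
        finally have "\<bar>h\<bar> powr ?d \<le> real H powr (- \<delta>) * \<bar>h\<bar> powr (?d + \<delta>)"
          using hH by (simp add: powr_minus field_simps)
        then have "\<bar>h\<bar> powr ?d * fs n h \<le> real H powr (- \<delta>) * \<bar>h\<bar> powr (?d + \<delta>) * fs n h"
          using f(2) by (intro mult_right_mono)
        then have "ennreal (\<bar>h\<bar> powr ?d * fs n h) \<le> ennreal (real H powr (- \<delta>) * (\<bar>h\<bar> powr (?d + \<delta>) * fs n h))"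
          by (intro ennreal_leI) (simp add: mult.assoc)
        also have "\<dots> = ennreal (real H powr (- \<delta>)) * ennreal (\<bar>h\<bar> powr (?d + \<delta>) * fs n h)"
          using f(2) by (intro ennreal_mult) auto
        finally show ?thesis using True H(2) by simp
      qed simp
    qed
    also have "\<dots> = ennreal (real H powr (- \<delta>)) * (\<integral>\<^sup>+h\<in>{..x0}. ennreal (\<bar>h\<bar> powr (?d + \<delta>) * fs n h) \<partial>lebesgue)"
    proof (intro nn_integral_cmult borel_measurable_times_ennreal borel_measurable_indicator)
      have "(\<lambda>h. \<bar>h\<bar> powr (?d + \<delta>)) \<in> borel_measurable lebesgue"
        by (rule measurable_completion) measurable
      then have "(\<lambda>h. \<bar>h\<bar> powr (?d + \<delta>) * fs n h) \<in> borel_measurable lebesgue"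
        by (rule borel_measurable_times[OF _ f(1)])
      then show "(\<lambda>h. ennreal (\<bar>h\<bar> powr (?d + \<delta>) * fs n h)) \<in> borel_measurable lebesgue"
        by (rule measurable_compose[OF _ measurable_ennreal])
    qed (simp add: sets_completionI_sets)
    also have "\<dots> \<le> ennreal (real H powr (- \<delta>)) * S"
      unfolding S_def by (intro mult_left_mono SUP_upper) auto
    finally have "ennreal K * (\<integral>\<^sup>+h\<in>{..- real H}. ennreal (\<bar>h\<bar> powr ?d * fs n h) \<partial>lebesgue) \<le>
        ennreal K * (ennreal (real H powr (- \<delta>)) * S)" by (intro mult_left_mono) auto
    then show ?thesis
      unfolding K_def by (subst emeasure_intensity_tail_set[OF f]) (simp_all add: mult_ac)
  qed
  have "(\<lambda>H::nat. real H powr (- \<delta>)) \<longlonglongrightarrow> 0"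
    using \<delta> by (intro tendsto_neg_powr filterlim_real_sequentially) simp
  then have "(\<lambda>H::nat. ennreal (real H powr (- \<delta>))) \<longlonglongrightarrow> 0"
    by (simp add: ennreal_tendsto_0_iff)
  moreover have KS: "ennreal K * S < top" using sup unfolding S_def by (simp add: ennreal_mult_less_top)
  ultimately have "(\<lambda>H::nat. ennreal K * S * ennreal (real H powr (- \<delta>))) \<longlonglongrightarrow> ennreal K * S * 0"
    by (intro ennreal_tendsto_cmult)
  then have "\<forall>\<^sub>F H::nat in sequentially. ennreal K * S * ennreal (real H powr (- \<delta>)) < ennreal e"
    using e by (intro order_tendstoD) auto
  moreover have "\<forall>\<^sub>F H::nat in sequentially. - x0 \<le> real H"
    using filterlim_real_sequentially by (simp add: filterlim_at_top)
  ultimately show ?thesis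
    using eventually_ge_at_top[of 1]
  proof eventually_elim
    case (elim H)
    show ?case
    proof
      fix n
      have "emeasure (intensity (fs n)) (tail_set (real H) :: ('a \<times> real) set) \<le> ennreal K * S * ennreal (real H powr (- \<delta>))"
        using elim by (intro bound) auto
      then show "emeasure (intensity (fs n)) (tail_set (real H) :: ('a \<times> real) set) \<le> ennreal e"
        using elim(1) by (simp add: order_trans[OF _ less_imp_le])
    qed
  qed
qed

lemma poisson_hit_prob_le_of_emeasure_le:
  assumes P: "poisson_process M \<Lambda> \<eta>" and B: "B \<in> sets borel" and le: "emeasure \<Lambda> B \<le> ennreal e" and e: "0 \<le> e"
  shows "measure M {\<omega> \<in> space M. \<eta> \<omega> \<inter> B \<noteq> {}} \<le> e"
proof -
  have fin: "emeasure \<Lambda> B < \<infinity>" using le by (rule le_less_trans) simp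
  have "measure \<Lambda> B \<le> e"
    using le fin e by (metis emeasure_eq_ennreal_measure ennreal_le_iff infinity_ennreal_def less_irrefl)
  then show ?thesis using poisson_process_hit_prob_le[OF P B fin] by linarith
qed

lemma weak_convergence_laguerre_skel:
  fixes Ms :: "nat \<Rightarrow> 'w measure" and M :: "'u measure"
    and \<eta>s :: "nat \<Rightarrow> 'w \<Rightarrow> ('a::euclidean_space \<times> real) set"
    and \<eta> :: "'u \<Rightarrow> ('a \<times> real) set"
    and fs :: "nat \<Rightarrow> real \<Rightarrow> real" and f :: "real \<Rightarrow> real"
  assumes adms: "\<And>n. admissible DIM('a) (Es n) (fs n)" and adm: "admissible DIM('a) E f"
    and L1: "\<And>x. x \<in> E \<Longrightarrow> (\<lambda>n. \<integral>\<^sup>+h\<in>{..x}. ennreal \<bar>fs n h - f h\<bar> \<partial>lebesgue) \<longlonglongrightarrow> 0"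
    and \<delta>: "\<delta> > 0"
    and sup: "(SUP n. \<integral>\<^sup>+h\<in>{..x0}. ennreal (\<bar>h\<bar> powr (real DIM('a) / 2 + \<delta>) * fs n h) \<partial>lebesgue) < \<infinity>"
    and poss: "\<And>n. emeasure (intensity (fs n) :: ('a \<times> real) measure) (cbox 0 One \<times> UNIV) > 0"
    and pos: "emeasure (intensity f :: ('a \<times> real) measure) (cbox 0 One \<times> UNIV) > 0"
    and Ps: "\<And>n. poisson_process (Ms n) (intensity (fs n)) (\<eta>s n)"
    and P: "poisson_process M (intensity f) \<eta>"
  shows "rcs_converges_weakly Ms (\<lambda>n \<omega>. laguerre_skel dual (\<eta>s n \<omega>)) M (\<lambda>\<omega>. laguerre_skel dual (\<eta> \<omega>))"
  unfolding rcs_converges_weakly_def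
proof (intro conjI allI)
  show rcss: "random_closed_set (Ms n) (\<lambda>\<omega>. laguerre_skel dual (\<eta>s n \<omega>))" for n
    by (rule random_closed_set_laguerre_skel[OF Ps adms poss])
  show rcs: "random_closed_set M (\<lambda>\<omega>. laguerre_skel dual (\<eta> \<omega>))"
    by (rule random_closed_set_laguerre_skel[OF P adm pos])
  interpret M: prob_space M using P by (rule poisson_process_prob_space)
  note fsm = admissible_measurable[OF adms] admissible_nonneg[OF adms]
  note fm = admissible_measurable[OF adm] admissible_nonneg[OF adm]
  have dm: "(\<lambda>x. \<bar>fs n x - f x\<bar>) \<in> borel_measurable lebesgue" for n using fsm fm by measurable
  have "(\<exists>a. E = {a..}) \<or> (\<exists>b. E = {..<b}) \<or> E = UNIV" using adm unfolding admissible_def by blast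
  then obtain \<tau> :: "nat \<Rightarrow> real" where \<tau>: "incseq \<tau>" "\<forall>N. \<tau> N \<in> E" "\<forall>t\<in>E. \<exists>N. t \<le> \<tau> N"
    "(\<exists>b. E = {..<b}) \<or> (\<forall>t. \<exists>N. t \<le> \<tau> N)" by (rule admissible_levels)
  let ?W = "\<lambda>N. window \<tau> N :: ('a \<times> real) set"
  have WB: "?W N \<in> sets borel" for N by (rule borel_closed[OF closed_window])
  have TB: "tail_set (real H) \<in> sets (borel :: ('a \<times> real) measure)" for H by (rule borel_closed[OF closed_tail_set])
  note good = poisson_AE_good[OF P adm pos \<tau>]
  let ?D = "\<lambda>n. intensity (\<lambda>x. \<bar>fs n x - f x\<bar>) :: ('a \<times> real) measure"
  have Dlim: "(\<lambda>n. emeasure (?D n) (?W N)) \<longlonglongrightarrow> 0" for N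
  proof (rule tendsto_sandwich[OF _ _ tendsto_const])
    let ?c = "ennreal (unit_ball_vol DIM('a) * real N ^ DIM('a))"
    have "(\<lambda>n. ?c * (\<integral>\<^sup>+h\<in>{..\<tau> N}. ennreal \<bar>fs n h - f h\<bar> \<partial>lebesgue)) \<longlonglongrightarrow> ?c * 0"
      using \<tau>(2) by (intro ennreal_tendsto_cmult L1) auto
    then show "(\<lambda>n. ?c * (\<integral>\<^sup>+h\<in>{..\<tau> N}. ennreal \<bar>fs n h - f h\<bar> \<partial>lebesgue)) \<longlonglongrightarrow> 0" by simp
    show "\<forall>\<^sub>F n in sequentially. emeasure (?D n) (?W N) \<le> ?c * (\<integral>\<^sup>+h\<in>{..\<tau> N}. ennreal \<bar>fs n h - f h\<bar> \<partial>lebesgue)"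
      by (intro always_eventually allI emeasure_intensity_bounded_window[OF dm window_subset]) simp
  qed simp
  have Dfin: "\<forall>\<^sub>F n in sequentially. emeasure (?D n) (?W N) < \<infinity>" for N
    using Dlim[of N] by (intro order_tendstoD) auto
  \<comment> \<open>Deduced from finiteness for \<open>f\<close>, because \<open>\<tau> N\<close>
    lies in \<open>E\<close> but perhaps not yet in \<open>Es n\<close>.\<close>
  have Wfins: "\<forall>\<^sub>F n in sequentially. emeasure (intensity (fs n)) (?W N) < \<infinity>" for N
    using Dfin[of N]
  proof eventually_elim
    case (elim n)
    have "emeasure (intensity (fs n)) (?W N) \<le> emeasure (intensity f) (?W N) + emeasure (?D n) (?W N)"
      by (rule emeasure_intensity_le_diff[OF fsm(1) fm WB])
    also have "\<dots> < \<infinity>" using elim good(3)[of N] by simp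
    finally show ?case .
  qed
  have dlim: "(\<lambda>n. 2 * measure (?D n) (?W N)) \<longlonglongrightarrow> 0" for N
  proof -
    have "(\<lambda>n. measure (?D n) (?W N)) \<longlonglongrightarrow> enn2real 0"
      unfolding measure_def using Dlim[of N] by (intro tendsto_enn2real) auto
    then have "(\<lambda>n. 2 * measure (?D n) (?W N)) \<longlonglongrightarrow> 2 * enn2real 0" by (intro tendsto_intros)
    then show ?thesis by simp
  qed
  have tv: "\<forall>\<^sub>F n in sequentially. \<forall>X\<in>sets (config_space (?W N)).
      \<bar>measure (Ms n) {\<omega> \<in> space (Ms n). \<eta>s n \<omega> \<in> X} - measure M {\<omega> \<in> space M. \<eta> \<omega> \<in> X}\<bar> \<le> 2 * measure (?D n) (?W N)" for N
    using Dfin[of N] Wfins[of N]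
  proof eventually_elim
    case (elim n)
    show ?case
    proof
      fix X assume X: "X \<in> sets (config_space (?W N))"
      show "\<bar>measure (Ms n) {\<omega> \<in> space (Ms n). \<eta>s n \<omega> \<in> X} - measure M {\<omega> \<in> space M. \<eta> \<omega> \<in> X}\<bar> \<le> 2 * measure (?D n) (?W N)"
        by (rule tv_config_space[OF Ps P sets_intensity sets_intensity WB elim(2) good(3) _ X])
          (rule intensity_sum_diff_le[OF fsm fm elim(2) good(3) elim(1) WB])
    qed
  qed
  show "weakly_converges fell_topology (\<lambda>n. rcs_law (Ms n) (\<lambda>\<omega>. laguerre_skel dual (\<eta>s n \<omega>)))
      (rcs_law M (\<lambda>\<omega>. laguerre_skel dual (\<eta> \<omega>)))"
    unfolding weakly_converges_def
  proof (intro allI impI, elim conjE)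
    fix g :: "'a set \<Rightarrow> real"
    assume g: "continuous_map fell_topology euclideanreal g" and "bounded (g ` topspace fell_topology)"
    then obtain c0 where "\<forall>x\<in>g ` topspace fell_topology. norm x \<le> c0" unfolding bounded_iff by blast
    then have c: "\<bar>g F\<bar> \<le> c0" if "closed F" for F using that by (auto simp: topspace_fell_topology)
    have c0: "0 \<le> c0" using c[of "{}"] by simp
    let ?I = "\<lambda>n. integral\<^sup>L (rcs_law (Ms n) (\<lambda>\<omega>. laguerre_skel dual (\<eta>s n \<omega>))) g"
    let ?L = "integral\<^sup>L (rcs_law M (\<lambda>\<omega>. laguerre_skel dual (\<eta> \<omega>))) g"
    show "?I \<longlonglongrightarrow> ?L"
    proof (rule LIMSEQ_I)
      fix e :: real assume e: "0 < e"
      \<comment> \<open>Error budget: each of the two comparisons with the window costs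
        \<open>e / 8\<close> from the locality of \<open>g\<close> plus less than
        \<open>e / 4\<close> from the exceptional events, namely \<open>a\<close> for the tail and
        \<open>2 * a\<close> or \<open>3 * a\<close> for a bad window. With \<open>e / 8\<close> for
        the change of law in the window the total stays below \<open>e\<close>.\<close>
      define a where "a = e / (40 * (c0 + 1))"
      have a: "a > 0" "2 * c0 * (a + 3 * a) < e / 4" "2 * c0 * (a + 2 * a) < e / 4"
      proof -
        show "a > 0" unfolding a_def using e c0 by simp
        have "40 * (c0 * a) < e" unfolding a_def using e c0 by (simp add: field_simps)
        moreover have "0 \<le> c0 * a" using \<open>a > 0\<close> c0 by simp
        moreover have "2 * c0 * (a + 3 * a) = 8 * (c0 * a)" "2 * c0 * (a + 2 * a) = 6 * (c0 * a)"
          by (simp_all add: algebra_simps)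
        ultimately show "2 * c0 * (a + 3 * a) < e / 4" "2 * c0 * (a + 2 * a) < e / 4"
          by linarith+
      qed
      obtain r :: nat where r: "\<forall>F F'. closed F \<and> closed F' \<and> F \<inter> cball 0 (real r) = F' \<inter> cball 0 (real r) \<longrightarrow> \<bar>g F - g F'\<bar> < e / 8"
        using continuous_map_fell_local[OF g, of "e / 8"] e by auto
      have "\<forall>\<^sub>F H in sequentially. emeasure (intensity f) (tail_set (real H) :: ('a \<times> real) set) < ennreal a"
        using admissible_tail_tendsto[OF adm] a(1) by (intro order_tendstoD) auto
      with uniform_tail_bound[OF fsm \<delta> sup a(1)]
      have "\<forall>\<^sub>F H in sequentially. (\<forall>n. emeasure (intensity (fs n)) (tail_set (real H) :: ('a \<times> real) set) \<le> ennreal a) \<and>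
        emeasure (intensity f) (tail_set (real H) :: ('a \<times> real) set) \<le> ennreal a"
        by eventually_elim (simp add: less_imp_le)
      then obtain H where H: "\<And>n. emeasure (intensity (fs n)) (tail_set (real H) :: ('a \<times> real) set) \<le> ennreal a"
        "emeasure (intensity f) (tail_set (real H) :: ('a \<times> real) set) \<le> ennreal a"
        using eventually_happens[of _ sequentially] by auto
      have tails: "measure (Ms n) {\<omega> \<in> space (Ms n). \<eta>s n \<omega> \<inter> tail_set (real H) \<noteq> {}} \<le> a" for n
        using a(1) by (intro poisson_hit_prob_le_of_emeasure_le[OF Ps TB H(1)]) simp
      have tail: "measure M {\<omega> \<in> space M. \<eta> \<omega> \<inter> tail_set (real H) \<noteq> {}} \<le> a"
        using a(1) by (intro poisson_hit_prob_le_of_emeasure_le[OF P TB H(2)]) simp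
      let ?G = "\<lambda>N. good_configs \<tau> H r N :: ('a \<times> real) set set"
      have Gs: "- ?G N \<in> sets (config_space (?W N))" for N
        using sets.compl_sets[OF good_configs_in_config_space[of \<tau> H r N]] by (simp add: Compl_eq_Diff_UNIV)
      have Gm: "{\<omega> \<in> space M. \<eta> \<omega> \<notin> ?G N} \<in> sets M" for N
        using measurable_sets[OF measurable_config_space[OF P] Gs[of N]] by (simp add: vimage_def Int_def conj_commute)
      have Tm: "{\<omega> \<in> space M. \<eta> \<omega> \<inter> tail_set (real H) \<noteq> {}} \<in> sets M"
        by (rule poisson_process_hit_sets(2)[OF P TB])
      \<comment> \<open>Windows are eventually good only for configurations without tail points, so
        the tail event is removed first and its probability added back afterwards.\<close>
      let ?X = "\<lambda>N. {\<omega> \<in> space M. \<eta> \<omega> \<notin> ?G N} - {\<omega> \<in> space M. \<eta> \<omega> \<inter> tail_set (real H) \<noteq> {}}"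
      have "(\<lambda>N. M.prob (?X N)) \<longlonglongrightarrow> 0"
      proof (rule measure_tendsto_0_of_AE[OF M.finite_measure_axioms])
        show "?X N \<in> sets M" for N using Gm Tm by (rule sets.Diff)
        show "AE \<omega> in M. \<forall>\<^sub>F N in sequentially. \<omega> \<notin> ?X N"
          using good(1)
        proof eventually_elim
          case (elim \<omega>)
          show ?case
          proof (cases "\<eta> \<omega> \<inter> tail_set (real H) = {}")
            case True
            then have "\<forall>\<^sub>F N in sequentially. \<eta> \<omega> \<in> ?G N" using elim by blast
            then show ?thesis by eventually_elim simp
          next
            case False
            then show ?thesis by simp
          qed
        qed
      qed
      then have "\<forall>\<^sub>F N in sequentially. M.prob (?X N) < a" using a(1) by (rule order_tendstoD)
      then obtain N where N: "M.prob (?X N) < a" using eventually_happens[of _ sequentially] by auto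
      have goodM: "M.prob {\<omega> \<in> space M. \<eta> \<omega> \<notin> ?G N} \<le> 2 * a"
      proof -
        have "M.prob {\<omega> \<in> space M. \<eta> \<omega> \<notin> ?G N} \<le> M.prob (?X N \<union> {\<omega> \<in> space M. \<eta> \<omega> \<inter> tail_set (real H) \<noteq> {}})"
          using Gm Tm by (intro M.finite_measure_mono) auto
        also have "\<dots> \<le> M.prob (?X N) + M.prob {\<omega> \<in> space M. \<eta> \<omega> \<inter> tail_set (real H) \<noteq> {}}"
          using Gm Tm by (intro measure_Un_le) auto
        finally show ?thesis using N tail by linarith
      qed
      let ?v = "\<lambda>A. g (window_skel dual (real N) (?W N) A)"
      let ?J = "\<lambda>n. integral\<^sup>L (distr (Ms n) (config_space (?W N)) (\<eta>s n)) ?v"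
      let ?K = "integral\<^sup>L (distr M (config_space (?W N)) \<eta>) ?v"
      have fin: "AE \<omega> in M. finite (\<eta> \<omega> \<inter> ?W N)" using good(2) by eventually_elim blast
      have LK: "\<bar>?L - ?K\<bar> \<le> e / 8 + 2 * c0 * (a + 2 * a)"
        by (rule law_window_approx[OF P rcs g _ r fin \<tau>(1) tail goodM]) (rule c)
      have IJ: "\<forall>\<^sub>F n in sequentially. \<bar>?I n - ?J n\<bar> \<le> e / 8 + 2 * c0 * (a + 3 * a)"
        using tv[of N] Wfins[of N] order_tendstoD(2)[OF dlim[of N] a(1)]
      proof eventually_elim
        case (elim n)
        \<comment> \<open>Being a bad configuration is an event of the window, so total variation
          carries its small probability from \<open>\<eta>\<close> to \<open>\<eta>s n\<close> at
          the price of another \<open>a\<close>.\<close>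
        have "measure (Ms n) {\<omega> \<in> space (Ms n). \<eta>s n \<omega> \<in> - ?G N} \<le> M.prob {\<omega> \<in> space M. \<eta> \<omega> \<in> - ?G N} + a"
          using bspec[OF elim(1) Gs] elim(3) by linarith
        then have goods: "measure (Ms n) {\<omega> \<in> space (Ms n). \<eta>s n \<omega> \<notin> ?G N} \<le> 3 * a" using goodM by simp
        note fins = poisson_process_AE_finite[OF Ps WB elim(2)]
        show ?case
          by (rule law_window_approx[OF Ps rcss g _ r fins \<tau>(1) tails goods]) (rule c)
      qed
      have vm: "?v \<in> borel_measurable (config_space (?W N))"
      proof -
        have gm: "g \<in> borel_of fell_topology \<rightarrow>\<^sub>M borel" using g by (rule continuous_map_borel_of_measurable)
        show ?thesis
          by (rule measurable_compose[OF window_skel_measurable[OF WB bounded_window] gm])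
      qed
      have "?J \<longlonglongrightarrow> ?K"
      proof (rule integral_tendsto_of_tv[where d = "\<lambda>n. 2 * measure (?D n) (?W N)" and c = c0])
        show "prob_space (distr (Ms n) (config_space (?W N)) (\<eta>s n))" for n
          by (rule prob_space.prob_space_distr[OF poisson_process_prob_space[OF Ps] measurable_config_space[OF Ps]])
        show "prob_space (distr M (config_space (?W N)) \<eta>)"
          by (rule M.prob_space_distr[OF measurable_config_space[OF P]])
        show "sets (distr (Ms n) (config_space (?W N)) (\<eta>s n)) = sets (distr M (config_space (?W N)) \<eta>)" for n by simp
        show "(\<lambda>n. 2 * measure (?D n) (?W N)) \<longlonglongrightarrow> 0" by (rule dlim)
        show "?v \<in> borel_measurable (distr M (config_space (?W N)) \<eta>)" using vm by simp
        show "\<bar>?v A\<bar> \<le> c0" for A by (intro c closed_window_skel)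
        show "\<forall>\<^sub>F n in sequentially. \<forall>X\<in>sets (distr M (config_space (?W N)) \<eta>).
          \<bar>measure (distr (Ms n) (config_space (?W N)) (\<eta>s n)) X - measure (distr M (config_space (?W N)) \<eta>) X\<bar> \<le> 2 * measure (?D n) (?W N)"
          using tv[of N]
        proof eventually_elim
          case (elim n)
          show ?case
          proof
            fix X assume "X \<in> sets (distr M (config_space (?W N)) \<eta>)"
            then have X: "X \<in> sets (config_space (?W N))" by simp
            have "\<eta>s n -` X \<inter> space (Ms n) = {\<omega> \<in> space (Ms n). \<eta>s n \<omega> \<in> X}" "\<eta> -` X \<inter> space M = {\<omega> \<in> space M. \<eta> \<omega> \<in> X}"
              by auto
            then show "\<bar>measure (distr (Ms n) (config_space (?W N)) (\<eta>s n)) X - measure (distr M (config_space (?W N)) \<eta>) X\<bar>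
                \<le> 2 * measure (?D n) (?W N)"
              using bspec[OF elim X] by (simp add: measure_distr[OF measurable_config_space[OF Ps] X]
                measure_distr[OF measurable_config_space[OF P] X])
          qed
        qed
      qed
      then have "\<forall>\<^sub>F n in sequentially. dist (?J n) ?K < e / 8" using e by (intro tendstoD) auto
      with IJ have "\<forall>\<^sub>F n in sequentially. norm (?I n - ?L) < e"
      proof eventually_elim
        case (elim n)
        then show ?case using LK a(2,3) unfolding dist_real_def real_norm_def by linarith
      qed
      then show "\<exists>no. \<forall>n\<ge>no. norm (?I n - ?L) < e"
        unfolding eventually_sequentially .
    qed
  qed
qed

theorem theorem3p5:
  fixes Ms :: "nat \<Rightarrow> 'w measure" and M :: "'u measure"
    and \<eta>s :: "nat \<Rightarrow> 'w \<Rightarrow> ('a::euclidean_space \<times> real) set"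
    and \<eta> :: "'u \<Rightarrow> ('a \<times> real) set"
    and Es :: "nat \<Rightarrow> real set" and E :: "real set"
    and fs :: "nat \<Rightarrow> real \<Rightarrow> real" and f :: "real \<Rightarrow> real"
    and x0 \<delta> :: real
  assumes "DIM('a) \<ge> 2"
    and "\<And>n. admissible DIM('a) (Es n) (fs n)"
    and "incseq Es" and "(\<Union>n. Es n) = E"
    and "admissible DIM('a) E f"
    and "frac_integral 1 f (1 / 2) > 0"
    and "\<And>x. x \<in> E \<Longrightarrow>
           (\<lambda>n. \<integral>\<^sup>+h\<in>{..x}. ennreal \<bar>fs n h - f h\<bar> \<partial>lebesgue) \<longlonglongrightarrow> 0"
    and "\<delta> > 0"
    and "(SUP n. \<integral>\<^sup>+h\<in>{..x0}. ennreal (\<bar>h\<bar> powr (real DIM('a) / 2 + \<delta>) * fs n h) \<partial>lebesgue) < \<infinity>"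
    and "\<And>n. emeasure (intensity (fs n) :: ('a \<times> real) measure) (cbox 0 One \<times> UNIV) > 0"
    and "emeasure (intensity f :: ('a \<times> real) measure) (cbox 0 One \<times> UNIV) > 0"
    and "\<And>n. poisson_process (Ms n) (intensity (fs n)) (\<eta>s n)"
    and "poisson_process M (intensity f) \<eta>"
  shows "rcs_converges_weakly Ms (\<lambda>n \<omega>. skel (laguerre_diagram (\<eta>s n \<omega>)))
           M (\<lambda>\<omega>. skel (laguerre_diagram (\<eta> \<omega>))) \<and>
         rcs_converges_weakly Ms (\<lambda>n \<omega>. skel (dual_laguerre (\<eta>s n \<omega>)))
           M (\<lambda>\<omega>. skel (dual_laguerre (\<eta> \<omega>)))"
  using weak_convergence_laguerre_skel[OF assms(2,5,7,8,9,10,11,12,13), of False]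
    weak_convergence_laguerre_skel[OF assms(2,5,7,8,9,10,11,12,13), of True]
  unfolding laguerre_skel_def by simp

end
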